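(* Let $F=\mathbb{R}$, $\mathbb{C}$ or $\mathbb{H}$, $G=\mathrm{SL}(2,F)$, $L\simeq F^\times$, and let $\mathcal{E}$, $\mathcal{E}^w$ be the Hilbert $C^*(L)$-modules and $\mathcal{I}_w$ the standard intertwining integral described in the context. Let $\mathcal{F}_w$ be the operator defined on $\mathcal{S}(F^2)$ by $$\mathcal{F}_w f(x)=\int_{F^2}e^{-2i\pi\,\mathrm{Re}\langle w.y,\bar{x}\rangle}f(y)\,dy .$$ Then $\mathcal{F}_w$ extends to an operator $\mathcal{U}_w$ on $\mathcal{E}^w$ such that: (1) $\mathcal{U}_w$ normalises $\mathcal{I}_w$, that is: (i) $\mathcal{U}_w$ is an isometry of Hilbert modules over $C^*(L)$ between $\mathcal{E}^w$ and $\mathcal{E}$ that commutes with the left action of $C^*_r(G)$; (ii) there exists a continuous function $\gamma:L\to\mathbb{C}$ such that the composition $\mathcal{I}_w\circ\mathcal{U}_w$ acts on a dense subspace of functions in $\mathcal{E}^w$ by right convolution with $\gamma$ over $L$. (2) The corresponding function $\gamma$ is given on $L\simeq F^\times$ by $\gamma(l)=e^{-2i\pi\,\mathrm{Re}(l^{-1})}$.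
   Context: Notation. $F$ is $\mathbb{R}$, $\mathbb{C}$ or the quaternions $\mathbb{H}$; $d_F=\dim_{\mathbb{R}}F$; $\bar{x}$ is the conjugate of $x$ (taken componentwise for vectors), $\mathrm{Re}(x)=\frac12(x+\bar x)$, $|x|_F=\sqrt{\bar x x}$. On $F^2$, $\langle x,y\rangle=\bar x_1y_1+\bar x_2y_2$, with norm $\|\cdot\|$, and $dx$ is Lebesgue measure on $F^2\simeq\mathbb{R}^{2d_F}$. $\mathcal{S}(F^2)$ is the Schwartz space of $\mathbb{R}^{2d_F}$. On $F^\times$ the Haar measure is $d^\times x=dx/|x|_F^{d_F}$. For a function $f$ on $F^2$ and $\alpha\in F^\times$, $f^\alpha(x)=f(x\alpha)$. Group. $G=\mathrm{SL}(2,F)$ is the group of $2\times2$ matrices over $F$ of determinant $1$ (with the usual notion of determinant for quaternionic matrices when $F=\mathbb{H}$), acting on $F^2$ by matrix multiplication $g.x$. $N$ is the subgroup of matrices $\begin{pmatrix}1&t\\0&1\end{pmatrix}$, $\bar N$ that of matrices $\bar n_t=\begin{pmatrix}1&0\\t&1\end{pmatrix}$, $t\in F$, and $L$ is the $\Theta$-stable Levi component of the upper triangular subgroup, where $\Theta(g)={}^t\bar g^{-1}$; it consists of the matrices $\begin{pmatrix}l&0\\0&l^{-1}\end{pmatrix}$ and is identified with $F^\times$. Set $w=\begin{pmatrix}0&-1\\1&0\end{pmatrix}$. $G/N$ is identified with $F^2\setminus\{0\}$ by sending a matrix to its first column; the $G$-invariant measure corresponds to Lebesgue measure. The module $\mathcal{E}$.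 For functions $f,g$ on $F^2$ put $\langle f,g\rangle(\alpha)=|\alpha|_F^{d_F}\int_{F^2}\overline{f(x)}g(x\alpha)\,dx$ ($\alpha\in F^\times$) whenever this makes sense. $L$ acts on the right by $f.l=|l|_F^{-d_F}f^{l^{-1}}$, which integrates to $(f.\varphi)(x)=\int_{F^\times}f(xl^{-1})\varphi(l)|l|_F^{-d_F}\,d^\times l$ for $\varphi\in C_c(L)\subset C^*(L)$. $\mathcal{E}$ is the Hilbert $C^*(L)$-module obtained from $C_c(F^2\setminus\{0\})$ by extending this action to $C^*(L)$ and completing for the norm induced by the $C^*(L)$-valued inner product $\langle\cdot,\cdot\rangle$. The module $\mathcal{E}^w$. For $\varphi\in C_c(L)$ let $\varphi^w(l)=\varphi(w^{-1}lw)=\varphi(l^{-1})$; this extends to an involutive automorphism $a\mapsto a^w$ of $C^*(L)$. $\mathcal{E}^w$ is $\mathcal{E}$ with the $C^*(L)$-module structure $\xi._w a=\xi.a^w$ and inner product $\langle\xi,\eta\rangle_w=(\langle\xi,\eta\rangle)^w$. On functions, $\langle f,g\rangle_w(l)=\langle f,g\rangle(l^{-1})$ and $f._w l=|l|_F^{d_F}f^l$. Functions in $\mathcal{S}(F^2)$ define elements of both $\mathcal{E}$ and $\mathcal{E}^w$: the inclusions of $C_c^\infty(F^2\setminus\{0\})$ in $\mathcal{E}$ and $\mathcal{E}^w$ extend to $\mathcal{S}(F^2)$ by continuity. Left action. $G$ acts on $\mathcal{E}$ and $\mathcal{E}^w$ by $g.f=f(g^{-1}\cdot)$; this integrates to an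 action of $C^*(G)$ by bounded module operators which factors through the reduced $C^*$-algebra $C^*_r(G)$. Standard intertwining integral. $\mathcal{I}_w f(g)=\int_{\bar N}f(gw\bar n)\,d\bar n$ converges for $f\in C_c(G/N)$ and defines a map $C_c(G/N)\to C(G/N)$. Under $G/N\simeq F^2\setminus\{0\}$ it is given by $\mathcal{I}_w f(x)=\int_F f\left(tx+w.\frac{\bar x}{\|x\|^2}\right)dt$. In the composition $\mathcal{I}_w\circ\mathcal{U}_w$, $\mathcal{I}_w$ denotes its extension to a subspace $\mathcal{E}_0$ of $\mathcal{E}$ chosen so that the composition is well defined on the dense subspace considered. Convolution. Right convolution with $\gamma$ over $L\simeq F^\times$ is $f\mapsto f*_{F^\times}\gamma$, with $(f*_{F^\times}\gamma)(x)=\int_{F^\times}f(\lambda x)\,\gamma(\lambda^{-1})\,d^\times\lambda$; for the function $\gamma$ of part (2) this is $\int_{F^\times}e^{-2i\pi\,\mathrm{Re}(\lambda)}f(\lambda x)\,d^\times\lambda$.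
   Formalization: Proved for F = R, C; for F = H the map a -> a^w is not an automorphism, so E^w is undefined and the claim is empty. Right convolution with γ carries the extra factor |λ|^d of the module action (i.e. additive dλ); with d^×λ alone the γ in (2) would have to be |l|^{-d} e^{-2iπ Re(l^{-1})}. *)

theory Defs
  imports "HOL-Analysis.Analysis"
begin

section \<open>The scalars: real numbers, complex numbers, quaternions\<close>

text \<open>By Frobenius' theorem every type of this class is isomorphic, with its norm and
  conjugation, to \<open>\<real>\<close>, \<open>\<complex>\<close> or \<open>\<H>\<close>; the three instances are given below.
  \<open>norm\<close> is \<open>|\<cdot>|\<^sub>F\<close> and \<open>DIM('f)\<close> is \<open>d\<^sub>F\<close>.\<close>

class rch = real_normed_div_algebra + euclidean_space +
  fixes cjg :: "'a \<Rightarrow> 'a"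
  assumes cjg_mult_self: "cjg x * x = (norm x)\<^sup>2 *\<^sub>R 1"
    and add_cjg: "x + cjg x = (2 * inner 1 x) *\<^sub>R 1"

text \<open>By \<open>add_cjg\<close>, \<open>of_real (re x) = (x + cjg x) / 2\<close>.\<close>

definition re :: "'f::rch \<Rightarrow> real"
  where "re x = inner 1 x"

instantiation real :: rch
begin
definition cjg_real :: "real \<Rightarrow> real" where "cjg_real x = x"
instance
proof
  fix x :: real
  show "cjg x * x = (norm x)\<^sup>2 *\<^sub>R 1" by (simp add: cjg_real_def power2_eq_square)
  show "x + cjg x = (2 * inner 1 x) *\<^sub>R 1" by (simp add: cjg_real_def)
qed
end

instantiation complex :: rch
begin
definition cjg_complex :: "complex \<Rightarrow> complex" where "cjg_complex x = cnj x"
instance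
proof
  fix x :: complex
  show "cjg x * x = (norm x)\<^sup>2 *\<^sub>R 1"
    unfolding cjg_complex_def scaleR_conv_of_real complex_norm_square by simp
  show "x + cjg x = (2 * inner 1 x) *\<^sub>R 1"
    by (simp add: cjg_complex_def complex_eq_iff inner_complex_def)
qed
end

datatype quat = Quat (q0: real) (q1: real) (q2: real) (q3: real)

lemma quat_eq_iff: "x = y \<longleftrightarrow> q0 x = q0 y \<and> q1 x = q1 y \<and> q2 x = q2 y \<and> q3 x = q3 y"
  by (cases x; cases y) auto

instantiation quat :: real_vector
begin

definition "0 = Quat 0 0 0 0"
definition "x + y = Quat (q0 x + q0 y) (q1 x + q1 y) (q2 x + q2 y) (q3 x + q3 y)"
definition "- x = Quat (- q0 x) (- q1 x) (- q2 x) (- q3 x)"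
definition "x - y = Quat (q0 x - q0 y) (q1 x - q1 y) (q2 x - q2 y) (q3 x - q3 y)"
definition "r *\<^sub>R x = Quat (r * q0 x) (r * q1 x) (r * q2 x) (r * q3 x)"

instance
  by standard
    (simp_all add: zero_quat_def plus_quat_def uminus_quat_def minus_quat_def scaleR_quat_def
      quat_eq_iff algebra_simps)

end

instantiation quat :: real_inner
begin

definition "inner x y = q0 x * q0 y + q1 x * q1 y + q2 x * q2 y + q3 x * q3 y"
definition "norm (x::quat) = sqrt (inner x x)"
definition "sgn (x::quat) = x /\<^sub>R norm x"
definition "dist (x::quat) y = norm (x - y)"
definition "(uniformity :: (quat \<times> quat) filter) = (INF e\<in>{0 <..}. principal {(x, y). dist x y < e})"
definition "open (U :: quat set) \<longleftrightarrow> (\<forall>x\<in>U. eventually (\<lambda>(x', y). x' = x \<longrightarrow> y \<in> U) uniformity)"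

lemma quat_inner_self_eq_0: "inner x x = 0 \<longleftrightarrow> x = (0::quat)"
proof -
  have "inner x x = (q0 x)\<^sup>2 + (q1 x)\<^sup>2 + (q2 x)\<^sup>2 + (q3 x)\<^sup>2"
    by (simp add: inner_quat_def power2_eq_square)
  moreover have "(q0 x)\<^sup>2 \<ge> 0" "(q1 x)\<^sup>2 \<ge> 0" "(q2 x)\<^sup>2 \<ge> 0" "(q3 x)\<^sup>2 \<ge> 0" by simp_all
  ultimately have "inner x x = 0 \<longleftrightarrow>
      (q0 x)\<^sup>2 = 0 \<and> (q1 x)\<^sup>2 = 0 \<and> (q2 x)\<^sup>2 = 0 \<and> (q3 x)\<^sup>2 = 0"
    by linarith
  then show ?thesis by (simp add: quat_eq_iff zero_quat_def)
qed

instance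
proof
  fix x y z :: quat and r :: real
  show "dist x y = norm (x - y)" by (simp add: dist_quat_def)
  show "sgn x = x /\<^sub>R norm x" by (simp add: sgn_quat_def)
  show "(uniformity :: (quat \<times> quat) filter) = (INF e\<in>{0 <..}. principal {(x, y). dist x y < e})"
    by (simp add: uniformity_quat_def)
  show "open U \<longleftrightarrow> (\<forall>x\<in>U. eventually (\<lambda>(x', y). x' = x \<longrightarrow> y \<in> U) uniformity)" for U :: "quat set"
    by (simp add: open_quat_def)
  show "inner x y = inner y x" by (simp add: inner_quat_def algebra_simps)
  show "inner (x + y) z = inner x z + inner y z"
    by (simp add: inner_quat_def plus_quat_def algebra_simps)
  show "inner (r *\<^sub>R x) y = r * inner x y"
    by (simp add: inner_quat_def scaleR_quat_def algebra_simps)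
  show "0 \<le> inner x x" by (simp add: inner_quat_def)
  show "inner x x = 0 \<longleftrightarrow> x = 0" by (rule quat_inner_self_eq_0)
  show "norm x = sqrt (inner x x)" by (simp add: norm_quat_def)
qed

end

instantiation quat :: real_normed_div_algebra
begin

definition "1 = Quat 1 0 0 0"
definition "x * y = Quat
   (q0 x * q0 y - q1 x * q1 y - q2 x * q2 y - q3 x * q3 y)
   (q0 x * q1 y + q1 x * q0 y + q2 x * q3 y - q3 x * q2 y)
   (q0 x * q2 y - q1 x * q3 y + q2 x * q0 y + q3 x * q1 y)
   (q0 x * q3 y + q1 x * q2 y - q2 x * q1 y + q3 x * q0 y)"
definition "inverse x = Quat (q0 x / inner x x) (- q1 x / inner x x) (- q2 x / inner x x)
   (- q3 x / inner x x)"
definition "x div (y::quat) = x * inverse y"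

lemma quat_inner_mult: "inner (x * y) (x * y) = inner x x * inner y (y::quat)"
  by (simp add: times_quat_def inner_quat_def algebra_simps)

instance
proof
  fix x y z :: quat and r :: real
  show "x * y * z = x * (y * z)"
    by (simp add: quat_eq_iff times_quat_def algebra_simps)
  show "(x + y) * z = x * z + y * z" "x * (y + z) = x * y + x * z"
    by (simp_all add: quat_eq_iff times_quat_def plus_quat_def algebra_simps)
  show "1 * x = x" "x * 1 = x" "(0::quat) \<noteq> 1"
    by (simp_all add: quat_eq_iff times_quat_def one_quat_def zero_quat_def)
  have scale: "r *\<^sub>R x * y = r *\<^sub>R (x * y)" "x * r *\<^sub>R y = r *\<^sub>R (x * y)" for r and x y :: quat
    by (simp_all add: quat_eq_iff times_quat_def scaleR_quat_def algebra_simps)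
  show "r *\<^sub>R x * y = r *\<^sub>R (x * y)" "x * r *\<^sub>R y = r *\<^sub>R (x * y)"
    by (fact scale)+
  show "norm (x * y) = norm x * norm y"
    by (simp add: norm_quat_def quat_inner_mult real_sqrt_mult)
  show "x div y = x * inverse y" by (simp add: divide_quat_def)
  show "inverse 0 = (0::quat)"
    by (simp add: quat_eq_iff inverse_quat_def zero_quat_def)
  assume "x \<noteq> 0"
  then have n: "inner x x \<noteq> 0" by simp
  have e: "inverse x = (1 / inner x x) *\<^sub>R Quat (q0 x) (- q1 x) (- q2 x) (- q3 x)"
    by (simp add: inverse_quat_def scaleR_quat_def)
  have c: "Quat (q0 x) (- q1 x) (- q2 x) (- q3 x) * x = inner x x *\<^sub>R 1"
      "x * Quat (q0 x) (- q1 x) (- q2 x) (- q3 x) = inner x x *\<^sub>R 1"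
    by (simp_all add: quat_eq_iff times_quat_def inner_quat_def scaleR_quat_def one_quat_def)
  show "inverse x * x = 1" "x * inverse x = 1"
    unfolding e scale c using n
    by (simp_all add: scaleR_quat_def one_quat_def)
qed

end

instantiation quat :: euclidean_space
begin

definition "Basis = {Quat 1 0 0 0, Quat 0 1 0 0, Quat 0 0 1 0, Quat 0 0 0 1}"

instance
proof
  fix u v x :: quat
  show "(Basis :: quat set) \<noteq> {}" "finite (Basis :: quat set)" by (simp_all add: Basis_quat_def)
  show "inner u v = (if u = v then 1 else 0)" if "u \<in> Basis" "v \<in> Basis"
    using that unfolding Basis_quat_def inner_quat_def
    by (elim insertE emptyE) simp_all
  have "(\<forall>u\<in>Basis. inner x u = 0) \<longleftrightarrow> q0 x = 0 \<and> q1 x = 0 \<and> q2 x = 0 \<and> q3 x = 0"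
    unfolding Basis_quat_def inner_quat_def by simp
  also have "\<dots> \<longleftrightarrow> x = 0"
    by (cases x) (simp add: zero_quat_def)
  finally show "(\<forall>u\<in>Basis. inner x u = 0) \<longleftrightarrow> x = 0" .
qed

end

instantiation quat :: rch
begin
definition "cjg x = Quat (q0 x) (- q1 x) (- q2 x) (- q3 x)"
instance
proof
  fix x :: quat
  show "cjg x * x = (norm x)\<^sup>2 *\<^sub>R 1"
    by (simp add: quat_eq_iff cjg_quat_def times_quat_def power2_norm_eq_inner
        inner_quat_def one_quat_def scaleR_quat_def)
  show "x + cjg x = (2 * inner 1 x) *\<^sub>R 1"
    by (simp add: quat_eq_iff cjg_quat_def plus_quat_def one_quat_def inner_quat_def
        scaleR_quat_def)
qed
end


section \<open>The plane \<open>F\<^sup>2\<close> and the group \<open>SL(2,F)\<close>\<close>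

definition hip :: "'f::rch^2 \<Rightarrow> 'f^2 \<Rightarrow> 'f"
  where "hip x y = cjg (x$1) * y$1 + cjg (x$2) * y$2"

definition vcjg :: "'f::rch^2 \<Rightarrow> 'f^2"
  where "vcjg x = (\<chi> i. cjg (x$i))"

definition rsmult :: "'f::rch^2 \<Rightarrow> 'f \<Rightarrow> 'f^2"
  where "rsmult x \<alpha> = (\<chi> i. x$i * \<alpha>)"

text \<open>The usual determinant when \<open>F\<close> is commutative, the Dieudonne determinant
  (with values in the nonnegative reals) for the quaternions.\<close>

definition det2 :: "'f::rch^2^2 \<Rightarrow> 'f"
  where "det2 g =
    (if \<forall>x y::'f. x * y = y * x then g$1$1 * g$2$2 - g$1$2 * g$2$1
     else of_real (if g$1$1 = 0 then norm (g$1$2) * norm (g$2$1)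
       else norm (g$1$1 * g$2$2 - g$1$1 * g$2$1 * inverse (g$1$1) * g$1$2)))"

definition SL2 :: "('f::rch^2^2) set"
  where "SL2 = {g. det2 g = 1}"

definition weyl :: "'f::rch^2^2"
  where "weyl = vector [vector [0, -1], vector [1, 0]]"

definition nbar :: "'f::rch \<Rightarrow> 'f^2^2"
  where "nbar t = vector [vector [1, 0], vector [t, 1]]"


section \<open>Function spaces\<close>

definition Cc :: "'x::topological_space set \<Rightarrow> ('x \<Rightarrow> complex) set"
  where "Cc S = {f. continuous_on S f \<and> (\<exists>K\<subseteq>S. compact K \<and> (\<forall>x. x \<notin> K \<longrightarrow> f x = 0))}"

abbreviation CcL :: "('f::rch \<Rightarrow> complex) set"
  where "CcL \<equiv> Cc (- {0})"

abbreviation CcV :: "('f::rch^2 \<Rightarrow> complex) set"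
  where "CcV \<equiv> Cc (- {0})"

definition partials :: "'v::euclidean_space list \<Rightarrow> ('v \<Rightarrow> complex) \<Rightarrow> ('v \<Rightarrow> complex)"
  where "partials bs f = foldr (\<lambda>b g x. frechet_derivative g (at x) b) bs f"

definition schwartz :: "('v::euclidean_space \<Rightarrow> complex) set"
  where "schwartz = {f. \<forall>bs\<in>lists Basis.
    (\<forall>x. partials bs f differentiable at x) \<and>
    (\<forall>k::nat. bounded (range (\<lambda>x. norm x ^ k *\<^sub>R partials bs f x)))}"

text \<open>The functions used as elements of the module: \<open>C\<^sub>c(F\<^sup>2 - {0}) + S(F\<^sup>2)\<close>.\<close>

definition modfuns :: "('f::rch^2 \<Rightarrow> complex) set"
  where "modfuns = {f. \<exists>g\<in>CcV. \<exists>h\<in>schwartz. f = (\<lambda>x. g x + h x)}"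

definition fourier_w :: "('f::rch^2 \<Rightarrow> complex) \<Rightarrow> ('f^2 \<Rightarrow> complex)"
  where "fourier_w f x =
    (\<integral>y. exp (- 2 * \<i> * complex_of_real (pi * re (hip (weyl *v y) (vcjg x)))) * f y \<partial>lborel)"


section \<open>C*-algebras, Hilbert modules\<close>

class complex_banach = banach +
  fixes scaleC :: "complex \<Rightarrow> 'a \<Rightarrow> 'a"  (infixr "*\<^sub>C" 75)
  assumes scaleC_add_right: "c *\<^sub>C (x + y) = c *\<^sub>C x + c *\<^sub>C y"
    and scaleC_add_left: "(c + d) *\<^sub>C x = c *\<^sub>C x + d *\<^sub>C x"
    and scaleC_scaleC: "c *\<^sub>C d *\<^sub>C x = (c * d) *\<^sub>C x"
    and scaleC_of_real: "complex_of_real r *\<^sub>C x = r *\<^sub>R x"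
    and norm_scaleC: "norm (c *\<^sub>C x) = cmod c * norm x"

class cstar_algebra = complex_banach + real_normed_algebra +
  fixes star :: "'a \<Rightarrow> 'a"
  assumes mult_scaleC_left: "(c *\<^sub>C x) * y = c *\<^sub>C (x * y)"
    and mult_scaleC_right: "x * (c *\<^sub>C y) = c *\<^sub>C (x * y)"
    and star_star: "star (star x) = x"
    and star_add: "star (x + y) = star x + star y"
    and star_scaleC: "star (c *\<^sub>C x) = cnj c *\<^sub>C star x"
    and star_mult: "star (x * y) = star y * star x"
    and cstar_identity: "norm (star x * x) = (norm x)\<^sup>2"

text \<open>A model \<open>j\<close> of the C*-completion of a *-algebra \<open>D\<close> of functions (product \<open>mul\<close>,
  involution \<open>inv\<close>) for a C*-seminorm \<open>p\<close>; it is unique up to a unique isomorphism.\<close>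

locale cstar_completion =
  fixes D :: "('x \<Rightarrow> complex) set"
    and mul :: "('x \<Rightarrow> complex) \<Rightarrow> ('x \<Rightarrow> complex) \<Rightarrow> ('x \<Rightarrow> complex)"
    and inv :: "('x \<Rightarrow> complex) \<Rightarrow> ('x \<Rightarrow> complex)"
    and p :: "('x \<Rightarrow> complex) \<Rightarrow> real"
    and j :: "('x \<Rightarrow> complex) \<Rightarrow> 'a::cstar_algebra"
  assumes j_add: "\<phi> \<in> D \<Longrightarrow> \<psi> \<in> D \<Longrightarrow> j (\<lambda>x. \<phi> x + \<psi> x) = j \<phi> + j \<psi>"
    and j_scale: "\<phi> \<in> D \<Longrightarrow> j (\<lambda>x. c * \<phi> x) = c *\<^sub>C j \<phi>"
    and j_mul: "\<phi> \<in> D \<Longrightarrow> \<psi> \<in> D \<Longrightarrow> j (mul \<phi> \<psi>) = j \<phi> * j \<psi>"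
    and j_inv: "\<phi> \<in> D \<Longrightarrow> j (inv \<phi>) = star (j \<phi>)"
    and j_norm: "\<phi> \<in> D \<Longrightarrow> norm (j \<phi>) = p \<phi>"
    and j_dense: "closure (j ` D) = UNIV"

text \<open>A (right) Hilbert module; completeness and definiteness come from the class
  \<open>complex_banach\<close>.\<close>

locale hilbert_module =
  fixes act :: "'e::complex_banach \<Rightarrow> 'a::cstar_algebra \<Rightarrow> 'e"
    and ip :: "'e \<Rightarrow> 'e \<Rightarrow> 'a"
  assumes act_add_left: "act (x + y) a = act x a + act y a"
    and act_add_right: "act x (a + b) = act x a + act x b"
    and act_scaleC_left: "act (c *\<^sub>C x) a = c *\<^sub>C act x a"
    and act_scaleC_right: "act x (c *\<^sub>C a) = c *\<^sub>C act x a"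
    and act_act: "act (act x a) b = act x (a * b)"
    and ip_add_right: "ip x (y + z) = ip x y + ip x z"
    and ip_scaleC_right: "ip x (c *\<^sub>C y) = c *\<^sub>C ip x y"
    and ip_act_right: "ip x (act y a) = ip x y * a"
    and star_ip: "star (ip x y) = ip y x"
    and ip_pos: "\<exists>b. ip x x = star b * b"
    and norm_ip: "(norm x)\<^sup>2 = norm (ip x x)"

text \<open>Isomorphism of Hilbert modules (unitary operator).\<close>

definition module_isometry ::
  "('e::complex_banach \<Rightarrow> 'a::cstar_algebra \<Rightarrow> 'e) \<Rightarrow> ('e \<Rightarrow> 'e \<Rightarrow> 'a) \<Rightarrow>
   ('h::complex_banach \<Rightarrow> 'a \<Rightarrow> 'h) \<Rightarrow> ('h \<Rightarrow> 'h \<Rightarrow> 'a) \<Rightarrow> ('e \<Rightarrow> 'h) \<Rightarrow> bool"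
  where "module_isometry act ip act' ip' U \<longleftrightarrow>
    (\<forall>x y. U (x + y) = U x + U y) \<and> (\<forall>c x. U (c *\<^sub>C x) = c *\<^sub>C U x) \<and>
    (\<forall>x a. U (act x a) = act' (U x) a) \<and> (\<forall>x y. ip' (U x) (U y) = ip x y) \<and> bij U"


section \<open>The C*-algebra of \<open>L = F\<^sup>\<times>\<close>\<close>

text \<open>The matrix \<open>diag(l, l\<^sup>-\<^sup>1)\<close> is identified with \<open>l\<close>; functions on \<open>L\<close> are functions on
  \<open>F\<close>, whose value at \<open>0\<close> is irrelevant.\<close>

definition haarL :: "('f::rch) measure"
  where "haarL = density lborel (\<lambda>x. ennreal (1 / norm x ^ DIM('f)))"

definition L1L :: "('f::rch \<Rightarrow> complex) set"
  where "L1L = {\<phi>. integrable haarL \<phi>}"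

definition convL :: "('f::rch \<Rightarrow> complex) \<Rightarrow> ('f \<Rightarrow> complex) \<Rightarrow> ('f \<Rightarrow> complex)"
  where "convL \<phi> \<psi> l = (\<integral>m. \<phi> m * \<psi> (inverse m * l) \<partial>haarL)"

definition starL :: "('f::rch \<Rightarrow> complex) \<Rightarrow> ('f \<Rightarrow> complex)"
  where "starL \<phi> l = cnj (\<phi> (inverse l))"

text \<open>\<open>C*(L)\<close> is the enveloping C*-algebra of \<open>L\<^sup>1(L)\<close>, i.e. its completion for the largest
  C*-seminorm.\<close>

definition cstar_seminormsL :: "(('f::rch \<Rightarrow> complex) \<Rightarrow> real) set"
  where "cstar_seminormsL = {q.
    (\<forall>\<phi>\<in>L1L. 0 \<le> q \<phi> \<and> q \<phi> \<le> (\<integral>l. cmod (\<phi> l) \<partial>haarL)) \<and>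
    (\<forall>\<phi>\<in>L1L. \<forall>c. q (\<lambda>l. c * \<phi> l) = cmod c * q \<phi>) \<and>
    (\<forall>\<phi>\<in>L1L. \<forall>\<psi>\<in>L1L. q (\<lambda>l. \<phi> l + \<psi> l) \<le> q \<phi> + q \<psi>) \<and>
    (\<forall>\<phi>\<in>L1L. \<forall>\<psi>\<in>L1L. q (convL \<phi> \<psi>) \<le> q \<phi> * q \<psi>) \<and>
    (\<forall>\<phi>\<in>L1L. q (convL (starL \<phi>) \<phi>) = (q \<phi>)\<^sup>2)}"

definition cstar_normL :: "('f::rch \<Rightarrow> complex) \<Rightarrow> real"
  where "cstar_normL \<phi> = (SUP q\<in>cstar_seminormsL. q \<phi>)"

abbreviation is_cstarL :: "(('f::rch \<Rightarrow> complex) \<Rightarrow> 'a::cstar_algebra) \<Rightarrow> bool"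
  where "is_cstarL j \<equiv> cstar_completion L1L convL starL cstar_normL j"

text \<open>The isometric involutive automorphism \<open>a \<mapsto> a\<^sup>w\<close> of \<open>C*(L)\<close> extending
  \<open>\<phi>\<^sup>w(l) = \<phi>(w\<^sup>-\<^sup>1 l w) = \<phi>(l\<^sup>-\<^sup>1)\<close>.
  For the quaternions \<open>\<phi> \<mapsto> \<phi>\<^sup>w\<close> reverses convolution products, so there is no such automorphism.\<close>

locale weyl_twist =
  fixes j :: "('f::rch \<Rightarrow> complex) \<Rightarrow> 'a::cstar_algebra" and tw :: "'a \<Rightarrow> 'a"
  assumes tw_add: "tw (a + b) = tw a + tw b"
    and tw_scaleC: "tw (c *\<^sub>C a) = c *\<^sub>C tw a"
    and tw_mult: "tw (a * b) = tw a * tw b"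
    and tw_star: "tw (star a) = star (tw a)"
    and tw_tw: "tw (tw a) = a"
    and tw_norm: "norm (tw a) = norm a"
    and tw_j: "\<phi> \<in> CcL \<Longrightarrow> tw (j \<phi>) = j (\<lambda>l. \<phi> (inverse l))"


section \<open>The Hilbert module\<close>

definition pairing :: "('f::rch^2 \<Rightarrow> complex) \<Rightarrow> ('f^2 \<Rightarrow> complex) \<Rightarrow> ('f \<Rightarrow> complex)"
  where "pairing f g \<alpha> = norm \<alpha> ^ DIM('f) * (\<integral>x. cnj (f x) * g (rsmult x \<alpha>) \<partial>lborel)"

text \<open>The integrated right action \<open>f \<mapsto> \<integral> (f.l) \<phi>(l) d\<^sup>\<times>l\<close>, where
  \<open>(f.l)(x) = |l|\<^sup>-\<^sup>d f(xl\<^sup>-\<^sup>1)\<close>. It is also used for functions \<open>\<phi>\<close> without compact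
  support: this is what right convolution with \<open>\<phi>\<close> over \<open>L\<close> means. After \<open>\<lambda> = l\<^sup>-\<^sup>1\<close> it reads
  \<open>\<integral> f(x\<lambda>) \<phi>(\<lambda>\<^sup>-\<^sup>1) |\<lambda>|\<^sup>d d\<^sup>\<times>\<lambda> = \<integral> f(x\<lambda>) \<phi>(\<lambda>\<^sup>-\<^sup>1) d\<lambda>\<close>. (Without the factor \<open>|\<lambda>|\<^sup>d\<close> the
  function by which the composition below acts would be
  \<open>|l|\<^sup>-\<^sup>d exp(-2 i \<pi> Re(l\<^sup>-\<^sup>1))\<close>.)\<close>

definition ract_integrand :: "('f::rch^2 \<Rightarrow> complex) \<Rightarrow> ('f \<Rightarrow> complex) \<Rightarrow> 'f^2 \<Rightarrow> 'f \<Rightarrow> complex"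
  where "ract_integrand f \<phi> x l = f (rsmult x (inverse l)) * \<phi> l * (1 / norm l ^ DIM('f))"

definition ract :: "('f::rch^2 \<Rightarrow> complex) \<Rightarrow> ('f \<Rightarrow> complex) \<Rightarrow> ('f^2 \<Rightarrow> complex)"
  where "ract f \<phi> x = (\<integral>l. ract_integrand f \<phi> x l \<partial>haarL)"

text \<open>A model of the module: \<open>\<iota>\<close> identifies functions with elements of the completion.
  Since \<open>\<iota>\<close> has dense range on \<open>CcV\<close> and satisfies \<open>\<iota>_ip\<close>, its values on Schwartz
  functions are determined by those on \<open>CcV\<close> (extension by continuity).\<close>

locale ps_module = hilbert_module act ip
  for act :: "'e::complex_banach \<Rightarrow> 'a::cstar_algebra \<Rightarrow> 'e" and ip +
  fixes j :: "('f::rch \<Rightarrow> complex) \<Rightarrow> 'a"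
    and \<iota> :: "('f^2 \<Rightarrow> complex) \<Rightarrow> 'e"
  assumes cstarL: "is_cstarL j"
    and \<iota>_add: "f \<in> modfuns \<Longrightarrow> g \<in> modfuns \<Longrightarrow> \<iota> (\<lambda>x. f x + g x) = \<iota> f + \<iota> g"
    and \<iota>_scale: "f \<in> modfuns \<Longrightarrow> \<iota> (\<lambda>x. c * f x) = c *\<^sub>C \<iota> f"
    and \<iota>_ip: "f \<in> modfuns \<Longrightarrow> g \<in> modfuns \<Longrightarrow> ip (\<iota> f) (\<iota> g) = j (pairing f g)"
    and \<iota>_act: "f \<in> CcV \<Longrightarrow> \<phi> \<in> CcL \<Longrightarrow> act (\<iota> f) (j \<phi>) = \<iota> (ract f \<phi>)"
    and \<iota>_dense: "closure (\<iota> ` CcV) = UNIV"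

text \<open>The structure of the twisted module, on the same Banach space.\<close>

definition act_w :: "('a \<Rightarrow> 'a) \<Rightarrow> ('e \<Rightarrow> 'a \<Rightarrow> 'e) \<Rightarrow> 'e \<Rightarrow> 'a \<Rightarrow> 'e"
  where "act_w tw act \<xi> a = act \<xi> (tw a)"

definition ip_w :: "('a \<Rightarrow> 'a) \<Rightarrow> ('e \<Rightarrow> 'e \<Rightarrow> 'a) \<Rightarrow> 'e \<Rightarrow> 'e \<Rightarrow> 'a"
  where "ip_w tw ip \<xi> \<eta> = tw (ip \<xi> \<eta>)"


section \<open>The reduced C*-algebra of \<open>G\<close> and its action\<close>

text \<open>A Haar measure on \<open>G\<close>, as a Borel measure on the space of matrices concentrated on the
  closed subset \<open>SL2\<close>.\<close>

definition is_haarG :: "('f::rch^2^2) measure \<Rightarrow> bool"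
  where "is_haarG \<mu> \<longleftrightarrow> sets \<mu> = sets borel \<and> emeasure \<mu> (- SL2) = 0 \<and>
    (\<forall>K. compact K \<longrightarrow> K \<subseteq> SL2 \<longrightarrow> emeasure \<mu> K < \<infinity>) \<and>
    (\<forall>V. open V \<longrightarrow> V \<inter> SL2 \<noteq> {} \<longrightarrow> emeasure \<mu> V > 0) \<and>
    (\<forall>g\<in>SL2. distr \<mu> borel (\<lambda>h. g ** h) = \<mu>)"

definition convG :: "('f::rch^2^2) measure \<Rightarrow> ('f^2^2 \<Rightarrow> complex) \<Rightarrow> ('f^2^2 \<Rightarrow> complex) \<Rightarrow>
    ('f^2^2 \<Rightarrow> complex)"
  where "convG \<mu> \<phi> \<psi> g = (\<integral>h. \<phi> h * \<psi> (matrix_inv h ** g) \<partial>\<mu>)"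

text \<open>No modular function, as \<open>G\<close> is unimodular.\<close>

definition starG :: "('f::rch^2^2 \<Rightarrow> complex) \<Rightarrow> ('f^2^2 \<Rightarrow> complex)"
  where "starG \<phi> g = cnj (\<phi> (matrix_inv g))"

definition L2normG :: "('f::rch^2^2) measure \<Rightarrow> ('f^2^2 \<Rightarrow> complex) \<Rightarrow> real"
  where "L2normG \<mu> \<phi> = sqrt (\<integral>g. (cmod (\<phi> g))\<^sup>2 \<partial>\<mu>)"

text \<open>The norm of left convolution by \<open>\<phi>\<close> on \<open>L\<^sup>2(G)\<close>.\<close>

definition reduced_normG :: "('f::rch^2^2) measure \<Rightarrow> ('f^2^2 \<Rightarrow> complex) \<Rightarrow> real"
  where "reduced_normG \<mu> \<phi> = (SUP \<psi>\<in>{\<psi>\<in>Cc SL2. L2normG \<mu> \<psi> \<le> 1}. L2normG \<mu> (convG \<mu> \<phi> \<psi>))"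

abbreviation is_cstar_redG ::
  "('f::rch^2^2) measure \<Rightarrow> (('f^2^2 \<Rightarrow> complex) \<Rightarrow> 'b::cstar_algebra) \<Rightarrow> bool"
  where "is_cstar_redG \<mu> jr \<equiv> cstar_completion (Cc SL2) (convG \<mu>) starG (reduced_normG \<mu>) jr"

text \<open>The integrated form of \<open>g.f = f(g\<^sup>-\<^sup>1 \<cdot>)\<close>.\<close>

definition gact :: "('f::rch^2^2) measure \<Rightarrow> ('f^2^2 \<Rightarrow> complex) \<Rightarrow> ('f^2 \<Rightarrow> complex) \<Rightarrow>
    ('f^2 \<Rightarrow> complex)"
  where "gact \<mu> \<phi> f x = (\<integral>g. \<phi> g * f (matrix_inv g *v x) \<partial>\<mu>)"

text \<open>The action of the reduced C*-algebra by bounded module operators; by density of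
  \<open>jr ` Cc SL2\<close> and \<open>\<iota> ` CcV\<close> it is determined by \<open>lact_gact\<close>.\<close>

locale left_action =
  fixes act :: "'e::complex_banach \<Rightarrow> 'a::cstar_algebra \<Rightarrow> 'e" and ip :: "'e \<Rightarrow> 'e \<Rightarrow> 'a"
    and \<iota> :: "('f::rch^2 \<Rightarrow> complex) \<Rightarrow> 'e"
    and \<mu> :: "('f^2^2) measure" and jr :: "('f^2^2 \<Rightarrow> complex) \<Rightarrow> 'b::cstar_algebra"
    and lact :: "'b \<Rightarrow> 'e \<Rightarrow> 'e"
  assumes lact_add_left: "lact (b + c) x = lact b x + lact c x"
    and lact_add_right: "lact b (x + y) = lact b x + lact b y"
    and lact_scaleC_left: "lact (z *\<^sub>C b) x = z *\<^sub>C lact b x"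
    and lact_scaleC_right: "lact b (z *\<^sub>C x) = z *\<^sub>C lact b x"
    and lact_mult: "lact (b * c) x = lact b (lact c x)"
    and lact_norm: "norm (lact b x) \<le> norm b * norm x"
    and lact_act: "lact b (act x a) = act (lact b x) a"
    and lact_star: "ip (lact b x) y = ip x (lact (star b) y)"
    and lact_gact: "\<phi> \<in> Cc SL2 \<Longrightarrow> f \<in> CcV \<Longrightarrow> lact (jr \<phi>) (\<iota> f) = \<iota> (gact \<mu> \<phi> f)"


section \<open>The standard intertwining integral\<close>

text \<open>A function \<open>f\<close> on \<open>F\<^sup>2 - {0}\<close> is the function \<open>g \<mapsto> f(column 1 g)\<close> on \<open>G/N\<close>.\<close>

definition interw :: "('f::rch^2 \<Rightarrow> complex) \<Rightarrow> 'f^2^2 \<Rightarrow> complex"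
  where "interw f g = (\<integral>t. f (column 1 (g ** weyl ** nbar t)) \<partial>lborel)"

text \<open>The functions in the module to which the integral extends (\<open>E\<^sub>0\<close>).\<close>

definition interw_dom :: "('f::rch^2 \<Rightarrow> complex) set"
  where "interw_dom = {f\<in>modfuns. \<forall>g\<in>SL2. integrable lborel (\<lambda>t. f (column 1 (g ** weyl ** nbar t)))}"

definition dense_subspace :: "(('f::rch^2 \<Rightarrow> complex) \<Rightarrow> 'e::complex_banach) \<Rightarrow>
    ('f^2 \<Rightarrow> complex) set \<Rightarrow> bool"
  where "dense_subspace \<iota> D \<longleftrightarrow> D \<subseteq> modfuns \<and> (\<lambda>x. 0) \<in> D \<and>
    (\<forall>f\<in>D. \<forall>g\<in>D. (\<lambda>x. f x + g x) \<in> D) \<and> (\<forall>c. \<forall>f\<in>D. (\<lambda>x. c * f x) \<in> D) \<and>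
    closure (\<iota> ` D) = UNIV"

text \<open>The composition of \<open>U\<close> with the intertwining integral acts on a dense subspace of
  functions by right convolution with \<open>\<gamma>\<close>; all integrals converge absolutely.\<close>

definition composition_acts_by :: "(('f::rch^2 \<Rightarrow> complex) \<Rightarrow> 'e::complex_banach) \<Rightarrow> ('e \<Rightarrow> 'e) \<Rightarrow>
    ('f \<Rightarrow> complex) \<Rightarrow> bool"
  where "composition_acts_by \<iota> U \<gamma> \<longleftrightarrow>
    (\<exists>D. dense_subspace \<iota> D \<and> (\<forall>f\<in>D. \<exists>h\<in>interw_dom. U (\<iota> f) = \<iota> h \<and>
      (\<forall>g\<in>SL2. integrable haarL (ract_integrand f \<gamma> (column 1 g)) \<and>
        interw h g = ract f \<gamma> (column 1 g))))"

end

theory Submission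
  imports Defs "HOL-Probability.Characteristic_Functions"
begin

text \<open>
  With \<open>K x = (cjg x\<^sub>2, - cjg x\<^sub>1)\<close> the phase is \<open>Re\<langle>w.y, cjg x\<rangle> = inner (K x) y\<close>, so
  \<open>fourier_w\<close> is the Fourier transform composed with the isometry \<open>K\<close>. The form is antisymmetric,
  hence \<open>fourier_w\<close> is an involution by Fourier inversion; it preserves the \<open>L\<^sup>2\<close>
  pairing by Plancherel, and for commutative \<open>F\<close> it turns dilation by \<open>\<alpha>\<close> into dilation by
  \<open>\<alpha>\<^sup>-\<^sup>1\<close> and commutes with \<open>SL(2,F)\<close>. This gives
  \<open>\<langle>fourier_w f, fourier_w k\<rangle>(\<alpha>) = \<langle>f, k\<rangle>(\<alpha>\<^sup>-\<^sup>1)\<close> on Schwartz functions. The norm of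
  the module is dominated by a weighted sup norm through the \<open>L\<^sup>1\<close> norm of the pairing, so Schwartz
  functions are dense and the transform extends to a unitary, which commutes with \<open>C\<^sup>*\<^sub>r(G)\<close>. The
  composition with the intertwining integral is Fourier inversion on \<open>F\<close> along the second
  coordinate of the basis given by the columns of \<open>g\<close>.

  If \<open>F\<close> is not commutative, the multiplicative twist required by the hypotheses does not exist: it
  would make \<open>C\<^sup>*(L)\<close> commutative, whereas the representation \<open>l \<mapsto> l/|l|\<close> of \<open>L\<close> on
  \<open>F \<otimes> \<complex>\<close> is not.\<close>

section \<open>Lebesgue measure and the Haar measure of \<open>L\<close>\<close>

text \<open>The abstract data are prescribed on compactly supported functions only: the twist on
  \<open>CcL\<close>, the action of C*_r(G) on \<open>CcV\<close>. The transform does not preserve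
  compact support, so every identity has to be carried between \<open>CcV\<close> and the Schwartz
  space. Cutoffs approximate Schwartz functions from \<open>CcV\<close>, and Gaussian averages
  approximate functions in \<open>CcV\<close> by Schwartz functions. Both converge pointwise off the
  origin under one fixed polynomial weight, and W2(x) W2(x\<alpha>) is integrable over F \<times>
  F^2; dominated convergence then gives L^1 convergence of pairings, hence convergence in the
  module. On the group side the obstacle is that a Schwartz function averaged over SL(2,F) is not
  shown to be Schwartz again. Its class is reached only through inner products, and both linearity
  over C*(L) and commutation with C*_r(G) are proved in that weak form.\<close>

lemma
  fixes f :: "'a::topological_space \<Rightarrow> 'c::{banach,second_countable_topology}"
  assumes M[measurable_cong]: "sets M = sets borel" and [measurable]: "T \<in> borel_measurable borel"
    and inv: "\<And>h. h \<in> borel_measurable borel \<Longrightarrow> (\<integral>\<^sup>+x. h (T x) \<partial>M) = (\<integral>\<^sup>+x. h x \<partial>M)"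
    and [measurable]: "f \<in> borel_measurable borel"
  shows integrable_invariant: "integrable M (\<lambda>x. f (T x)) \<longleftrightarrow> integrable M f"
    and integral_invariant: "(\<integral>x. f (T x) \<partial>M) = (\<integral>x. f x \<partial>M)"
proof -
  have D: "distr M borel T = M"
  proof (rule measure_eqI)
    fix A assume "A \<in> sets (distr M borel T)"
    then have [measurable]: "A \<in> sets borel" by simp
    have "emeasure (distr M borel T) A = (\<integral>\<^sup>+x. indicator A x \<partial>distr M borel T)" by simp
    also have "\<dots> = (\<integral>\<^sup>+x. indicator A (T x) \<partial>M)" by (subst nn_integral_distr) auto
    also have "\<dots> = (\<integral>\<^sup>+x. indicator A x \<partial>M)" by (rule inv) measurable
    finally show "emeasure (distr M borel T) A = emeasure M A" by (simp add: M)
  qed (simp add: M)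
  have "integrable M (\<lambda>x. f (T x)) \<longleftrightarrow> integrable (distr M borel T) f"
    by (subst integrable_distr_eq) auto
  then show "integrable M (\<lambda>x. f (T x)) \<longleftrightarrow> integrable M f" unfolding D .
  have "(\<integral>x. f (T x) \<partial>M) = (\<integral>x. f x \<partial>distr M borel T)"
    by (subst integral_distr) auto
  then show "(\<integral>x. f (T x) \<partial>M) = (\<integral>x. f x \<partial>M)" unfolding D .
qed

lemma nn_integral_lborel_shift:
  fixes f :: "'a::euclidean_space \<Rightarrow> ennreal"
  assumes [measurable]: "f \<in> borel_measurable borel"
  shows "(\<integral>\<^sup>+x. f (c + x) \<partial>lborel) = (\<integral>\<^sup>+x. f x \<partial>lborel)"
proof -
  have "(\<integral>\<^sup>+x. f x \<partial>lborel) = (\<integral>\<^sup>+x. f x \<partial>distr lborel borel ((+) c))"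
    by (simp add: lborel_distr_plus)
  also have "\<dots> = (\<integral>\<^sup>+x. f (c + x) \<partial>lborel)"
    by (subst nn_integral_distr) auto
  finally show ?thesis by simp
qed

lemma nn_integral_lborel_reflect:
  fixes f :: "'a::euclidean_space \<Rightarrow> ennreal"
  assumes [measurable]: "f \<in> borel_measurable borel"
  shows "(\<integral>\<^sup>+x. f (c - x) \<partial>lborel) = (\<integral>\<^sup>+x. f x \<partial>lborel)"
proof -
  have e: "density (distr lborel borel (\<lambda>x. c + (-1) *\<^sub>R x)) (\<lambda>_. 1) = (lborel :: 'a measure)"
    using lborel_affine[of "-1" c] by simp
  have "(\<integral>\<^sup>+x. f x \<partial>lborel) = (\<integral>\<^sup>+x. f x \<partial>density (distr lborel borel (\<lambda>x. c + (-1) *\<^sub>R x)) (\<lambda>_. 1))"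
    by (simp only: e)
  also have "\<dots> = (\<integral>\<^sup>+x. f (c - x) \<partial>lborel)"
    by (subst density_1, subst nn_integral_distr) auto
  finally show ?thesis by simp
qed

text \<open>Both sides are multiples of \<open>f \<mapsto> \<integral>f\<close>, because the image of Lebesgue measure is translation
  invariant; the constant is read off the unit ball.\<close>

lemma nn_integral_similarity:
  fixes T :: "'a::euclidean_space \<Rightarrow> 'b::euclidean_space"
  assumes lin: "linear T" and dim: "DIM('a) = DIM('b)" and r: "r > 0"
    and nT: "\<And>x. norm (T x) = r * norm x"
    and [measurable]: "f \<in> borel_measurable borel"
  shows "(\<integral>\<^sup>+x. f (T x) \<partial>lborel) = ennreal (1 / r ^ DIM('a)) * (\<integral>\<^sup>+x. f x \<partial>lborel)"
proof -
  have inj: "inj T"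
    unfolding linear_injective_0[OF lin] using nT r by (metis mult_eq_0_iff norm_eq_zero less_irrefl)
  have "dim (range T) = DIM('b)"
    using dim_image_eq[OF lin, of UNIV] inj dim by simp
  then have surj: "surj T"
    using dim_eq_full[of "range T"] linear_subspace_image[OF lin subspace_UNIV] span_eq_iff[of "range T"]
    by (metis dim_UNIV)
  have cT: "continuous_on UNIV T" using lin by (simp add: linear_continuous_on linear_conv_bounded_linear)
  then have [measurable]: "T \<in> borel_measurable borel" by (rule borel_measurable_continuous_onI)
  define A where "A = ball (0::'b) 1"
  have [measurable]: "A \<in> sets borel" by (simp add: A_def)
  define V where "V = unit_ball_vol (real DIM('a))"
  have V: "V > 0" by (simp add: V_def)
  have eA: "emeasure lborel A = ennreal V"
    by (simp add: A_def emeasure_ball V_def dim)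
  \<comment> \<open>The preimage of the unit ball is the ball of radius 1/r; this is where the
    constant comes from.\<close>
  have "(\<integral>\<^sup>+x. indicator A (T x) \<partial>lborel) = (\<integral>\<^sup>+x. indicator (ball (0::'a) (1/r)) x \<partial>lborel)"
    by (rule arg_cong[where f="nn_integral lborel"]) 
       (auto simp: A_def indicator_def nT fun_eq_iff dist_norm field_simps r)
  also have "\<dots> = emeasure lborel (ball (0::'a) (1/r))" by simp
  also have "\<dots> = ennreal (1 / r ^ DIM('a)) * ennreal V"
    using r by (simp add: emeasure_ball V_def ennreal_mult[symmetric] power_one_over mult.commute)
  finally have TA: "(\<integral>\<^sup>+x. indicator A (T x) \<partial>lborel) = ennreal (1 / r ^ DIM('a)) * ennreal V" .
  have "(\<integral>\<^sup>+x. indicator A (T x) \<partial>lborel) * (\<integral>\<^sup>+y. f y \<partial>lborel)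
      = (\<integral>\<^sup>+x. indicator A (T x) * (\<integral>\<^sup>+y. f y \<partial>lborel) \<partial>lborel)"
    by (simp add: nn_integral_multc)
  also have "\<dots> = (\<integral>\<^sup>+x. indicator A (T x) * (\<integral>\<^sup>+y. f (T x + y) \<partial>lborel) \<partial>lborel)"
    by (simp add: nn_integral_lborel_shift)
  also have "\<dots> = (\<integral>\<^sup>+x. (\<integral>\<^sup>+y. indicator A (T x) * f (T x + y) \<partial>lborel) \<partial>lborel)"
    by (simp add: nn_integral_cmult)
  also have "\<dots> = (\<integral>\<^sup>+y. (\<integral>\<^sup>+x. indicator A (T x) * f (T x + y) \<partial>lborel) \<partial>lborel)"
    by (rule lborel_pair.Fubini') measurable
  also have "\<dots> = (\<integral>\<^sup>+y. (\<integral>\<^sup>+x. indicator A (T x - y) * f (T x) \<partial>lborel) \<partial>lborel)"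
  proof (rule nn_integral_cong)
    fix y :: 'b
    \<comment> \<open>Surjectivity enters here: a translation by y in the target is the image of a
      translation by z in the source, which Lebesgue measure absorbs.\<close>
    obtain z where z: "y = T z" using surj by (metis surjD)
    have "(\<integral>\<^sup>+x. indicator A (T x - y) * f (T x) \<partial>lborel)
       = (\<integral>\<^sup>+x. indicator A (T (z + x) - y) * f (T (z + x)) \<partial>lborel)"
      by (rule nn_integral_lborel_shift[symmetric]) measurable
    also have "\<dots> = (\<integral>\<^sup>+x. indicator A (T x) * f (T x + y) \<partial>lborel)"
      by (simp add: linear_add[OF lin] z add.commute)
    finally show "(\<integral>\<^sup>+x. indicator A (T x) * f (T x + y) \<partial>lborel) = (\<integral>\<^sup>+x. indicator A (T x - y) * f (T x) \<partial>lborel)" by simp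
  qed
  also have "\<dots> = (\<integral>\<^sup>+x. (\<integral>\<^sup>+y. indicator A (T x - y) * f (T x) \<partial>lborel) \<partial>lborel)"
    by (rule lborel_pair.Fubini'[symmetric]) measurable
  also have "\<dots> = (\<integral>\<^sup>+x. (\<integral>\<^sup>+y. indicator A (T x - y) \<partial>lborel) * f (T x) \<partial>lborel)"
    by (simp add: nn_integral_multc)
  also have "\<dots> = (\<integral>\<^sup>+x. emeasure lborel A * f (T x) \<partial>lborel)"
    by (subst nn_integral_lborel_reflect) auto
  also have "\<dots> = emeasure lborel A * (\<integral>\<^sup>+x. f (T x) \<partial>lborel)"
    by (simp add: nn_integral_cmult)
  finally have "ennreal V * (\<integral>\<^sup>+x. f (T x) \<partial>lborel) = ennreal V * (ennreal (1 / r ^ DIM('a)) * (\<integral>\<^sup>+y. f y \<partial>lborel))"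
    by (simp add: TA eA mult_ac)
  then show ?thesis using V by (simp add: ennreal_mult_cancel_left)
qed

lemma distr_lborel_similarity:
  fixes T :: "'a::euclidean_space \<Rightarrow> 'b::euclidean_space"
  assumes lin: "linear T" and dim: "DIM('a) = DIM('b)" and r: "r > 0"
    and nT: "\<And>x. norm (T x) = r * norm x"
  shows "distr lborel borel T = density lborel (\<lambda>_. ennreal (1 / r ^ DIM('a)))"
proof (rule measure_eqI)
  have "continuous_on UNIV T" using lin by (simp add: linear_continuous_on linear_conv_bounded_linear)
  then have [measurable]: "T \<in> borel_measurable borel" by (rule borel_measurable_continuous_onI)
  fix A assume "A \<in> sets (distr lborel borel T)"
  then have [measurable]: "A \<in> sets borel" by simp
  have "emeasure (distr lborel borel T) A = (\<integral>\<^sup>+x. indicator A x \<partial>distr lborel borel T)" by simp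
  also have "\<dots> = (\<integral>\<^sup>+x. indicator A (T x) \<partial>lborel)" by (subst nn_integral_distr) auto
  also have "\<dots> = ennreal (1 / r ^ DIM('a)) * emeasure lborel A"
    by (subst nn_integral_similarity[OF lin dim r nT]) auto
  also have "\<dots> = emeasure (density lborel (\<lambda>_. ennreal (1 / r ^ DIM('a)))) A"
    by (simp add: emeasure_density nn_integral_cmult)
  finally show "emeasure (distr lborel borel T) A = emeasure (density lborel (\<lambda>_. ennreal (1 / r ^ DIM('a)))) A" .
qed auto

lemma
  fixes T :: "'a::euclidean_space \<Rightarrow> 'b::euclidean_space" and f :: "'b \<Rightarrow> 'c::{banach,second_countable_topology}"
  assumes lin: "linear T" and dim: "DIM('a) = DIM('b)" and r: "r > 0"
    and nT: "\<And>x. norm (T x) = r * norm x"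
    and [measurable]: "f \<in> borel_measurable borel"
  shows integrable_similarity: "integrable lborel (\<lambda>x. f (T x)) \<longleftrightarrow> integrable lborel f"
    and integral_similarity: "(\<integral>x. f (T x) \<partial>lborel) = (1 / r ^ DIM('a)) *\<^sub>R (\<integral>x. f x \<partial>lborel)"
proof -
  note D = distr_lborel_similarity[OF lin dim r nT]
  have "continuous_on UNIV T" using lin by (simp add: linear_continuous_on linear_conv_bounded_linear)
  then have [measurable]: "T \<in> borel_measurable borel" by (rule borel_measurable_continuous_onI)
  have "integrable lborel (\<lambda>x. f (T x)) \<longleftrightarrow> integrable (distr lborel borel T) f"
    by (simp add: integrable_distr_eq)
  also have "\<dots> \<longleftrightarrow> integrable lborel (\<lambda>x. (1 / r ^ DIM('a)) *\<^sub>R f x)"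
    unfolding D using r by (subst integrable_density) (auto simp: zero_le_divide_iff)
  also have "\<dots> \<longleftrightarrow> integrable lborel f" 
  proof
    assume "integrable lborel (\<lambda>x. (1 / r ^ DIM('a)) *\<^sub>R f x)"
    then have "integrable lborel (\<lambda>x. r ^ DIM('a) *\<^sub>R ((1 / r ^ DIM('a)) *\<^sub>R f x))"
      by (rule integrable_scaleR_right)
    moreover have "(\<lambda>x. r ^ DIM('a) *\<^sub>R ((1 / r ^ DIM('a)) *\<^sub>R f x)) = f" using r by simp
    ultimately show "integrable lborel f" by simp
  qed auto
  finally show "integrable lborel (\<lambda>x. f (T x)) \<longleftrightarrow> integrable lborel f" .
  have "(\<integral>x. f (T x) \<partial>lborel) = (\<integral>x. f x \<partial>distr lborel borel T)"
    by (simp add: integral_distr)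
  also have "\<dots> = (\<integral>x. (1 / r ^ DIM('a)) *\<^sub>R f x \<partial>lborel)"
    unfolding D using r by (subst integral_density) (auto simp: zero_le_divide_iff)
  finally show "(\<integral>x. f (T x) \<partial>lborel) = (1 / r ^ DIM('a)) *\<^sub>R (\<integral>x. f x \<partial>lborel)" by simp
qed

section \<open>Polynomial weights and their integrability\<close>

definition wt :: "nat \<Rightarrow> 'a::real_normed_vector \<Rightarrow> real"
  where "wt M x = 1 / (1 + (norm x)\<^sup>2) ^ M"

lemma wt_pos: "wt M x > 0"
  by (simp add: wt_def add_pos_nonneg)

lemma wt_nonneg [simp]: "wt M x \<ge> 0"
  by (rule less_imp_le[OF wt_pos])

lemma wt_le_1: "wt M x \<le> 1"
  unfolding wt_def by (simp add: divide_le_eq_1 add_pos_nonneg)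

lemma continuous_on_wt [continuous_intros]: "continuous_on S f \<Longrightarrow> continuous_on S (\<lambda>x. wt M (f x))"
  unfolding wt_def by (intro continuous_intros) (auto simp: add_nonneg_eq_0_iff)

lemma borel_measurable_wt [measurable]: "wt M \<in> borel_measurable (borel :: 'a::euclidean_space measure)"
  by (intro borel_measurable_continuous_onI continuous_intros)

text \<open>Each factor 1 + |x|^2 dominates 1 + x_b^2 for one coordinate, so DIM many of them
  dominate the product over the basis. What remains is a product of one-dimensional integrals of
  1/(1 + x^2).\<close>

lemma nn_integral_wt_finite:
  assumes M: "DIM('a::euclidean_space) \<le> M"
  shows "(\<integral>\<^sup>+x. ennreal (wt M (x::'a)) \<partial>lborel) < \<infinity>"
proof -
  have 1: "(\<integral>\<^sup>+x. ennreal (1 / (1 + x\<^sup>2)) \<partial>lborel) < \<infinity>"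
  proof -
    \<comment> \<open>On the half line arctan is an antiderivative. The half line and its reflection
      cover the whole line, with only an inequality below because 0 is counted twice.\<close>
    have half: "(\<integral>\<^sup>+x. ennreal (1 / (1 + x\<^sup>2)) * indicator {0..} x \<partial>lborel) = ennreal (pi / 2 - arctan 0)"
    proof (rule nn_integral_FTC_atLeast)
      show "DERIV arctan x :> 1 / (1 + x\<^sup>2)" for x
        using DERIV_arctan[of x] by (simp add: inverse_eq_divide)
    qed (auto intro: tendsto_arctan_at_top)
    have "(\<integral>\<^sup>+x. ennreal (1 / (1 + x\<^sup>2)) \<partial>lborel)
      \<le> (\<integral>\<^sup>+x. ennreal (1 / (1 + x\<^sup>2)) * indicator {0..} x + ennreal (1 / (1 + (0 - x)\<^sup>2)) * indicator {0..} (0 - x) \<partial>lborel)"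
      by (intro nn_integral_mono) (auto simp: indicator_def)
    also have "\<dots> = (\<integral>\<^sup>+x. ennreal (1 / (1 + x\<^sup>2)) * indicator {0..} x \<partial>lborel)
      + (\<integral>\<^sup>+x. ennreal (1 / (1 + (0 - x)\<^sup>2)) * indicator {0..} (0 - x) \<partial>lborel)"
      by (intro nn_integral_add) auto
    also have "(\<integral>\<^sup>+x. ennreal (1 / (1 + (0 - x)\<^sup>2)) * indicator {0..} (0 - x) \<partial>lborel)
      = (\<integral>\<^sup>+x. ennreal (1 / (1 + x\<^sup>2)) * indicator {0..} x \<partial>lborel)"
      by (rule nn_integral_lborel_reflect) auto
    finally show ?thesis
      unfolding half by (simp add: ennreal_plus[symmetric] del: ennreal_plus) (metis ennreal_less_top le_less_trans)
  qed
  have "(\<integral>\<^sup>+x. ennreal (wt M (x::'a)) \<partial>lborel) \<le> (\<integral>\<^sup>+x. (\<Prod>b\<in>Basis. ennreal (1 / (1 + (x \<bullet> b)\<^sup>2))) \<partial>(lborel::'a measure))"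
  proof (rule nn_integral_mono)
    fix x :: 'a
    have "(\<Prod>b\<in>(Basis::'a set). 1 + (x \<bullet> b)\<^sup>2) \<le> (\<Prod>b\<in>(Basis::'a set). 1 + (norm x)\<^sup>2)"
    proof (rule prod_mono)
      fix b :: 'a assume "b \<in> Basis"
      then have "\<bar>x \<bullet> b\<bar> \<le> norm x" by (rule Basis_le_norm)
      then have "\<bar>x \<bullet> b\<bar>\<^sup>2 \<le> (norm x)\<^sup>2" by (rule power_mono) simp
      then show "0 \<le> 1 + (x \<bullet> b)\<^sup>2 \<and> 1 + (x \<bullet> b)\<^sup>2 \<le> 1 + (norm x)\<^sup>2" by simp
    qed
    also have "\<dots> = (1 + (norm x)\<^sup>2) ^ DIM('a)" by simp
    also have "\<dots> \<le> (1 + (norm x)\<^sup>2) ^ M" using M by (intro power_increasing) auto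
    finally have "wt M x \<le> 1 / (\<Prod>b\<in>(Basis::'a set). 1 + (x \<bullet> b)\<^sup>2)"
      unfolding wt_def by (intro divide_left_mono mult_pos_pos prod_pos) (auto simp: add_pos_nonneg)
    also have "\<dots> = (\<Prod>b\<in>(Basis::'a set). 1 / (1 + (x \<bullet> b)\<^sup>2))" by (simp add: prod_dividef)
    finally have "ennreal (wt M x) \<le> ennreal (\<Prod>b\<in>(Basis::'a set). 1 / (1 + (x \<bullet> b)\<^sup>2))" by (rule ennreal_leI)
    then show "ennreal (wt M x) \<le> (\<Prod>b\<in>Basis. ennreal (1 / (1 + (x \<bullet> b)\<^sup>2)))"
      by (simp add: prod_ennreal)
  qed
  also have "\<dots> = (\<Prod>b\<in>(Basis::'a set). (\<integral>\<^sup>+x. ennreal (1 / (1 + x\<^sup>2)) \<partial>lborel))"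
    by (rule nn_integral_lborel_prod) auto
  also have "\<dots> < \<infinity>" using 1 by (auto simp: less_top[symmetric] power_eq_top_ennreal)
  finally show ?thesis .
qed

lemma integrable_wt: "DIM('a::euclidean_space) \<le> M \<Longrightarrow> integrable lborel (wt M :: 'a \<Rightarrow> real)"
  using nn_integral_wt_finite by (intro integrableI_nonneg) auto

lemma integrable_if_le_wt:
  fixes f :: "'a::euclidean_space \<Rightarrow> 'b::{banach,second_countable_topology}"
  assumes "DIM('a) \<le> M" "f \<in> borel_measurable borel" "\<And>x. norm (f x) \<le> C * wt M x"
  shows "integrable lborel f"
  by (rule Bochner_Integration.integrable_bound[of _ "\<lambda>x. C * wt M x"])
    (use assms integrable_wt[OF assms(1)] in \<open>auto intro!: AE_I2 order_trans[OF _ abs_ge_self]\<close>)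


section \<open>Coordinates on F^2, matrices, and invariance of Lebesgue measure\<close>

definition vec2 :: "'f \<Rightarrow> 'f \<Rightarrow> 'f^2"
  where "vec2 a b = (\<chi> i. if i = 1 then a else b)"

lemma vec2_nth [simp]: "vec2 a b $ 1 = a" "vec2 a b $ 2 = b"
  by (simp_all add: vec2_def)

lemma norm_vec_2: "norm (x::'f::real_normed_vector^2) = sqrt ((norm (x$1))\<^sup>2 + (norm (x$2))\<^sup>2)"
  by (simp add: norm_vec_def L2_set_def sum_2)

lemma norm_vec2: "norm (vec2 a b :: 'f::real_normed_vector^2) = norm (a, b)"
  by (simp add: norm_vec_2 norm_prod_def)

lemma linear_vec2: "linear (\<lambda>(a, b). vec2 a b :: 'f::real_vector^2)"
  by (rule linearI) (auto simp: vec_eq_iff forall_2)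

lemma continuous_on_vec2 [continuous_intros]:
  fixes f g :: "'a::topological_space \<Rightarrow> 'f::topological_space"
  assumes "continuous_on S f" "continuous_on S g"
  shows "continuous_on S (\<lambda>x. vec2 (f x) (g x))"
  unfolding vec2_def
proof (rule continuous_on_vec_lambda)
  fix i :: 2
  show "continuous_on S (\<lambda>x. if i = 1 then f x else g x)"
    using assms by (cases "i = 1") simp_all
qed

lemma borel_measurable_vec2 [measurable (raw)]:
  fixes f g :: "'a \<Rightarrow> 'f::euclidean_space"
  assumes "f \<in> borel_measurable M" "g \<in> borel_measurable M"
  shows "(\<lambda>x. vec2 (f x) (g x)) \<in> borel_measurable M"
  by (rule borel_measurable_continuous_Pair[OF assms, of vec2]) (auto intro!: continuous_intros simp: split_beta)

lemma borel_measurable_vec_nth [measurable (raw)]: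
  fixes f :: "'a \<Rightarrow> 'f::euclidean_space^'n"
  assumes [measurable]: "f \<in> borel_measurable M"
  shows "(\<lambda>x. f x $ i) \<in> borel_measurable M"
proof -
  have [measurable]: "(\<lambda>x::'f^'n. x $ i) \<in> borel_measurable borel"
    by (intro borel_measurable_continuous_onI continuous_intros)
  show ?thesis by measurable
qed

text \<open>The Euclidean norms of F \<times> F and of F^2 agree, so the coordinate map is a
  similarity of ratio 1. It makes Fubini available on F^2.\<close>

lemma
  fixes h :: "'f::euclidean_space^2 \<Rightarrow> 'c::{banach,second_countable_topology}"
  assumes [measurable]: "h \<in> borel_measurable borel"
  shows integrable_vec2: "integrable lborel (\<lambda>(a, b). h (vec2 a b)) \<longleftrightarrow> integrable lborel h"
    and integral_vec2: "(\<integral>(a, b). h (vec2 a b) \<partial>lborel) = (\<integral>x. h x \<partial>lborel)"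
proof -
  have n: "norm ((\<lambda>(a, b). vec2 a b :: 'f^2) x) = 1 * norm x" for x :: "'f \<times> 'f"
    by (cases x) (simp add: norm_vec2)
  show "integrable lborel (\<lambda>(a, b). h (vec2 a b)) \<longleftrightarrow> integrable lborel h"
    using integrable_similarity[OF linear_vec2 _ _ n, of h] by (simp add: case_prod_unfold)
  show "(\<integral>(a, b). h (vec2 a b) \<partial>lborel) = (\<integral>x. h x \<partial>lborel)"
    using integral_similarity[OF linear_vec2 _ _ n, of h] by (simp add: case_prod_unfold)
qed

lemma nn_integral_vec2:
  fixes h :: "'f::euclidean_space^2 \<Rightarrow> ennreal"
  assumes [measurable]: "h \<in> borel_measurable borel"
  shows "(\<integral>\<^sup>+x. h x \<partial>lborel) = (\<integral>\<^sup>+a. \<integral>\<^sup>+b. h (vec2 a b) \<partial>lborel \<partial>lborel)"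
proof -
  have n: "norm ((\<lambda>(a, b). vec2 a b :: 'f^2) x) = 1 * norm x" for x :: "'f \<times> 'f"
    by (cases x) (simp add: norm_vec2)
  have "(\<integral>\<^sup>+x. h x \<partial>lborel) = (\<integral>\<^sup>+x. h (vec2 (fst x) (snd x)) \<partial>lborel)"
    using nn_integral_similarity[OF linear_vec2 _ _ n, of h] by (simp add: split_beta)
  also have "\<dots> = (\<integral>\<^sup>+x. h (vec2 (fst x) (snd x)) \<partial>(lborel \<Otimes>\<^sub>M lborel))"
    by (simp add: lborel_prod)
  also have "\<dots> = (\<integral>\<^sup>+a. \<integral>\<^sup>+b. h (vec2 a b) \<partial>lborel \<partial>lborel)"
    by (subst lborel.nn_integral_fst[symmetric]) auto
  finally show ?thesis .
qed

definition mat2 :: "'f \<Rightarrow> 'f \<Rightarrow> 'f \<Rightarrow> 'f \<Rightarrow> 'f^2^2"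
  where "mat2 a b c d = vec2 (vec2 a b) (vec2 c d)"

lemma mat2_nth [simp]:
  "mat2 a b c d $ 1 $ 1 = a" "mat2 a b c d $ 1 $ 2 = b"
  "mat2 a b c d $ 2 $ 1 = c" "mat2 a b c d $ 2 $ 2 = d"
  by (simp_all add: mat2_def)

lemma matrix_vector_2: "(g::'f::semiring_1^2^2) *v x = vec2 (g$1$1 * x$1 + g$1$2 * x$2) (g$2$1 * x$1 + g$2$2 * x$2)"
  by (simp add: vec_eq_iff forall_2 matrix_vector_mult_def sum_2)

lemma matrix_matrix_2: "(g::'f::semiring_1^2^2) ** h = mat2
    (g$1$1 * h$1$1 + g$1$2 * h$2$1) (g$1$1 * h$1$2 + g$1$2 * h$2$2)
    (g$2$1 * h$1$1 + g$2$2 * h$2$1) (g$2$1 * h$1$2 + g$2$2 * h$2$2)"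
  by (simp add: vec_eq_iff forall_2 matrix_matrix_mult_def sum_2)

lemma mat2_eq_iff: "g = h \<longleftrightarrow> g$1$1 = h$1$1 \<and> g$1$2 = h$1$2 \<and> g$2$1 = h$2$1 \<and> g$2$2 = h$2$2" for g h :: "'f^2^2"
  by (simp add: vec_eq_iff forall_2)

lemma continuous_on_matrix_vector [continuous_intros]:
  fixes f :: "'a::topological_space \<Rightarrow> 'f::{euclidean_space,real_normed_algebra_1}^2^2"
  assumes "continuous_on S f" "continuous_on S u"
  shows "continuous_on S (\<lambda>x. f x *v u x)"
  unfolding matrix_vector_2 using assms by (intro continuous_intros)

lemma borel_measurable_matrix_vector [measurable (raw)]:
  fixes f :: "'a \<Rightarrow> 'f::{euclidean_space,real_normed_algebra_1}^2^2"
  assumes [measurable]: "f \<in> borel_measurable M" "u \<in> borel_measurable M"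
  shows "(\<lambda>x. f x *v u x) \<in> borel_measurable M"
  unfolding matrix_vector_2 by measurable

text \<open>Stated for nonnegative functions, so that products and shears can be treated by Tonelli
  without integrability conditions.\<close>

definition preserves_lborel :: "'f::rch^2^2 \<Rightarrow> bool"
  where "preserves_lborel g \<longleftrightarrow>
    (\<forall>h \<in> borel_measurable borel. (\<integral>\<^sup>+x. h (g *v x) \<partial>lborel) = (\<integral>\<^sup>+x. h x \<partial>lborel))"

lemma preserves_lborel_mult:
  assumes "preserves_lborel g" "preserves_lborel h"
  shows "preserves_lborel (g ** h)"
  unfolding preserves_lborel_def
proof
  fix f :: "'a^2 \<Rightarrow> ennreal" assume [measurable]: "f \<in> borel_measurable borel"
  have "(\<lambda>x. f (g *v x)) \<in> borel_measurable borel" by measurable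
  then have "(\<integral>\<^sup>+x. f (g *v (h *v x)) \<partial>lborel) = (\<integral>\<^sup>+x. f (g *v x) \<partial>lborel)"
    using bspec[OF assms(2)[unfolded preserves_lborel_def], of "\<lambda>x. f (g *v x)"] by simp
  also have "\<dots> = (\<integral>\<^sup>+x. f x \<partial>lborel)" using assms(1) unfolding preserves_lborel_def by simp
  finally show "(\<integral>\<^sup>+x. f ((g ** h) *v x) \<partial>lborel) = (\<integral>\<^sup>+x. f x \<partial>lborel)"
    by (simp add: matrix_vector_mul_assoc)
qed

lemma preserves_lborel_lower: "preserves_lborel (mat2 1 0 t 1)"
  unfolding preserves_lborel_def
proof
  fix h :: "'a^2 \<Rightarrow> ennreal" assume [measurable]: "h \<in> borel_measurable borel"
  have "(\<integral>\<^sup>+x. h (mat2 1 0 t 1 *v x) \<partial>lborel) = (\<integral>\<^sup>+a. \<integral>\<^sup>+b. h (vec2 a (t * a + b)) \<partial>lborel \<partial>lborel)"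
    by (subst nn_integral_vec2) (simp_all add: matrix_vector_2)
  also have "\<dots> = (\<integral>\<^sup>+a. \<integral>\<^sup>+b. h (vec2 a b) \<partial>lborel \<partial>lborel)"
    by (intro nn_integral_cong nn_integral_lborel_shift) measurable
  finally show "(\<integral>\<^sup>+x. h (mat2 1 0 t 1 *v x) \<partial>lborel) = (\<integral>\<^sup>+x. h x \<partial>lborel)"
    by (simp add: nn_integral_vec2)
qed

lemma preserves_lborel_upper: "preserves_lborel (mat2 1 t 0 1)"
  unfolding preserves_lborel_def
proof
  fix h :: "'a^2 \<Rightarrow> ennreal" assume [measurable]: "h \<in> borel_measurable borel"
  have "(\<integral>\<^sup>+x. h (mat2 1 t 0 1 *v x) \<partial>lborel) = (\<integral>\<^sup>+a. \<integral>\<^sup>+b. h (vec2 (a + t * b) b) \<partial>lborel \<partial>lborel)"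
    by (subst nn_integral_vec2) (simp_all add: matrix_vector_2)
  also have "\<dots> = (\<integral>\<^sup>+b. \<integral>\<^sup>+a. h (vec2 (t * b + a) b) \<partial>lborel \<partial>lborel)"
    by (subst lborel_pair.Fubini') (auto simp: add.commute)
  also have "\<dots> = (\<integral>\<^sup>+b. \<integral>\<^sup>+a. h (vec2 a b) \<partial>lborel \<partial>lborel)"
    by (intro nn_integral_cong nn_integral_lborel_shift) measurable
  also have "\<dots> = (\<integral>\<^sup>+a. \<integral>\<^sup>+b. h (vec2 a b) \<partial>lborel \<partial>lborel)"
    by (rule lborel_pair.Fubini') measurable
  finally show "(\<integral>\<^sup>+x. h (mat2 1 t 0 1 *v x) \<partial>lborel) = (\<integral>\<^sup>+x. h x \<partial>lborel)"
    by (simp add: nn_integral_vec2)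
qed

text \<open>A matrix of determinant one with nonzero lower left entry is a product of an upper, a
  lower and an upper shear. Any other one is brought to that case by one lower shear.\<close>

lemma preserves_lborel_det_1:
  fixes g :: "'f::rch^2^2"
  assumes comm: "\<And>x y::'f. x * y = y * x" and det: "g$1$1 * g$2$2 - g$1$2 * g$2$1 = 1"
  shows "preserves_lborel g"
proof -
  have lcomm: "x * (y * z) = y * (x * z)" for x y z :: 'f
    by (metis comm mult.assoc)
  have *: "preserves_lborel g" if det: "g$1$1 * g$2$2 - g$1$2 * g$2$1 = 1" and c: "g$2$1 \<noteq> 0" for g :: "'f^2^2"
  proof -
    define a b c d i where "a = g$1$1" and "b = g$1$2" and "c = g$2$1" and "d = g$2$2" and "i = inverse c"
    have i: "c * i = 1" using c by (simp add: c_def i_def)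
    have ad: "a * d = 1 + b * c" using det by (simp add: a_def b_def c_def d_def algebra_simps)
    \<comment> \<open>These solve 1 + p c = a and 1 + c q = d; the determinant then forces the
      remaining entry a q + p = b.\<close>
    define p q where "p = (a - 1) * i" and "q = (d - 1) * i"
    have pc: "p * c = a - 1" unfolding p_def by (metis comm i mult.assoc mult_1_right)
    have cq: "c * q = d - 1" unfolding q_def by (metis comm i mult.assoc mult_1_right)
    have "a * q = (a * d) * i - a * i" by (simp add: q_def left_diff_distrib right_diff_distrib mult.assoc)
    also have "\<dots> = i + b - a * i" by (simp add: ad distrib_right mult.assoc i)
    finally have aq: "a * q + p = b" by (simp add: p_def left_diff_distrib)
    have "g = mat2 1 p 0 1 ** mat2 1 0 c 1 ** mat2 1 q 0 1"
      unfolding mat2_eq_iff matrix_matrix_2 a_def[symmetric] b_def[symmetric] c_def[symmetric] d_def[symmetric]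
      by (simp add: pc cq aq c_def[symmetric] d_def[symmetric])
    then show ?thesis
      by (metis preserves_lborel_mult preserves_lborel_lower preserves_lborel_upper)
  qed
  show ?thesis
  proof (cases "g$2$1 = 0")
    case False then show ?thesis using * det by blast
  next
    case True
    then have "g$1$1 * g$2$2 = 1" using det by simp
    then have a: "g$1$1 \<noteq> 0" by (metis mult_zero_left zero_neq_one)
    \<comment> \<open>Adding the first row to the second puts the upper left entry, which is nonzero
      here, into the lower left corner.\<close>
    have "preserves_lborel (mat2 1 0 1 1 ** g)"
      using a det True by (intro *) (simp_all add: matrix_matrix_2 ring_distribs comm)
    then have "preserves_lborel (mat2 1 0 (-1) 1 ** (mat2 1 0 1 1 ** g))"
      by (rule preserves_lborel_mult[OF preserves_lborel_lower])
    moreover have "mat2 1 0 (-1) 1 ** (mat2 1 0 1 1 ** g) = g"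
      by (simp add: mat2_eq_iff matrix_matrix_2)
    ultimately show ?thesis by (simp only:)
  qed
qed

lemma
  fixes h :: "'f::rch^2 \<Rightarrow> 'c::{banach,second_countable_topology}"
  assumes g: "preserves_lborel g" and [measurable]: "h \<in> borel_measurable borel"
  shows integrable_preserves_lborel: "integrable lborel (\<lambda>x. h (g *v x)) \<longleftrightarrow> integrable lborel h"
    and integral_preserves_lborel: "(\<integral>x. h (g *v x) \<partial>lborel) = (\<integral>x. h x \<partial>lborel)"
  by (rule integral_invariant[where T="(*v) g"] integrable_invariant[where T="(*v) g"];
      use assms in \<open>auto simp: preserves_lborel_def\<close>)+

section \<open>Haar measure of the multiplicative group\<close>

lemma sets_haarL [simp, measurable_cong]: "sets haarL = sets borel"
  by (simp add: haarL_def)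

lemma space_haarL [simp]: "space haarL = UNIV"
  by (simp add: haarL_def)

lemma nn_integral_haarL:
  fixes f :: "'f::rch \<Rightarrow> ennreal"
  assumes [measurable]: "f \<in> borel_measurable borel"
  shows "(\<integral>\<^sup>+x. f x \<partial>haarL) = (\<integral>\<^sup>+x. ennreal (1 / norm x ^ DIM('f)) * f x \<partial>lborel)"
  unfolding haarL_def by (subst nn_integral_density) auto

lemma
  fixes f :: "'f::rch \<Rightarrow> 'c::{banach,second_countable_topology}"
  assumes [measurable]: "f \<in> borel_measurable borel"
  shows integral_haarL: "(\<integral>x. f x \<partial>haarL) = (\<integral>x. (1 / norm x ^ DIM('f)) *\<^sub>R f x \<partial>lborel)"
    and integrable_haarL: "integrable haarL f \<longleftrightarrow> integrable lborel (\<lambda>x. (1 / norm x ^ DIM('f)) *\<^sub>R f x)"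
  unfolding haarL_def by (subst integral_density integrable_density; simp)+

lemma AE_haarL_neq_0: "AE x in (haarL::'f::rch measure). x \<noteq> 0"
  unfolding haarL_def by (subst AE_density) (auto intro: AE_mp[OF AE_lborel_singleton[of 0]])

interpretation haarL: sigma_finite_measure "haarL :: 'f::rch measure"
  unfolding haarL_def by (subst sigma_finite_measure.sigma_finite_iff_density_finite[OF sigma_finite_lborel]) auto

interpretation haarL_pair: pair_sigma_finite "haarL :: 'f::rch measure" "haarL :: 'f measure" ..

text \<open>The density is homogeneous of degree -d, which cancels the factor r^-d of Lebesgue
  measure. Left and right multiplications are both similarities, so L is unimodular.\<close>

lemma nn_integral_haarL_similarity:
  fixes f :: "'f::rch \<Rightarrow> ennreal" and T :: "'f \<Rightarrow> 'f"
  assumes [measurable]: "f \<in> borel_measurable borel"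
    and T: "linear T" "r > 0" "\<And>x. norm (T x) = r * norm x"
  shows "(\<integral>\<^sup>+x. f (T x) \<partial>haarL) = (\<integral>\<^sup>+x. f x \<partial>haarL)"
proof -
  have [measurable]: "T \<in> borel_measurable borel"
    using T(1) by (intro borel_measurable_continuous_onI) (simp add: linear_continuous_on linear_conv_bounded_linear)
  have e: "1 / norm x ^ DIM('f) = r ^ DIM('f) * (1 / norm (T x) ^ DIM('f))" for x
    using T(2) by (simp add: T(3) power_mult_distrib)
  have "(\<integral>\<^sup>+x. f (T x) \<partial>haarL) = (\<integral>\<^sup>+x. ennreal (r ^ DIM('f)) * (ennreal (1 / norm (T x) ^ DIM('f)) * f (T x)) \<partial>lborel)"
  proof (subst nn_integral_haarL)
    show "(\<integral>\<^sup>+x. ennreal (1 / norm x ^ DIM('f)) * f (T x) \<partial>lborel) = (\<integral>\<^sup>+x. ennreal (r ^ DIM('f)) * (ennreal (1 / norm (T x) ^ DIM('f)) * f (T x)) \<partial>lborel)"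
      by (intro nn_integral_cong, subst e, subst ennreal_mult) (use T(2) in \<open>auto simp: mult.assoc\<close>)
  qed measurable
  also have "\<dots> = ennreal (r ^ DIM('f)) * (\<integral>\<^sup>+x. ennreal (1 / norm (T x) ^ DIM('f)) * f (T x) \<partial>lborel)"
    by (rule nn_integral_cmult) measurable
  also have "(\<integral>\<^sup>+x. ennreal (1 / norm (T x) ^ DIM('f)) * f (T x) \<partial>lborel)
     = ennreal (1 / r ^ DIM('f)) * (\<integral>\<^sup>+x. ennreal (1 / norm x ^ DIM('f)) * f x \<partial>lborel)"
    by (rule nn_integral_similarity[OF T(1) refl T(2,3)]) measurable
  finally show ?thesis
    using T(2) by (simp add: nn_integral_haarL mult.assoc[symmetric] ennreal_mult[symmetric])
qed

lemma
  fixes f :: "'f::rch \<Rightarrow> ennreal"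
  assumes "f \<in> borel_measurable borel" and m: "m \<noteq> 0"
  shows nn_integral_haarL_left: "(\<integral>\<^sup>+x. f (m * x) \<partial>haarL) = (\<integral>\<^sup>+x. f x \<partial>haarL)"
    and nn_integral_haarL_right: "(\<integral>\<^sup>+x. f (x * m) \<partial>haarL) = (\<integral>\<^sup>+x. f x \<partial>haarL)"
  by (rule nn_integral_haarL_similarity[where r="norm m", OF assms(1)];
      use m in \<open>auto simp: norm_mult algebra_simps intro!: linearI\<close>)+

text \<open>The same argument as for \<open>nn_integral_similarity\<close>: the image of the Haar measure under
  inversion is again an invariant measure, and the annulus \<open>1/2 < |x| < 2\<close> is stable under inversion.\<close>

lemma nn_integral_haarL_inverse:
  fixes f :: "'f::rch \<Rightarrow> ennreal"
  assumes [measurable]: "f \<in> borel_measurable borel"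
  shows "(\<integral>\<^sup>+x. f (inverse x) \<partial>haarL) = (\<integral>\<^sup>+x. f x \<partial>haarL)"
proof -
  define A where "A = {x::'f. 1/2 < norm x \<and> norm x < 2}"
  have [measurable]: "A \<in> sets borel" by (simp add: A_def)
  define a where "a = (\<integral>\<^sup>+x. indicator A (inverse x) \<partial>(haarL::'f measure))"
  \<comment> \<open>The annulus is symmetric under inversion, so a is its Haar measure.\<close>
  have a: "a = (\<integral>\<^sup>+x. ennreal (1 / norm x ^ DIM('f)) * indicator A x \<partial>lborel)"
  proof -
    have "(indicator A (inverse x) :: ennreal) = indicator A x" for x :: 'f
    proof (cases "x = 0")
      case False
      then have n: "norm (inverse x) = 1 / norm x" and x: "norm x > 0" by (simp_all add: norm_inverse divide_inverse)
      show ?thesis unfolding A_def indicator_def mem_Collect_eq n using x by (simp add: field_simps conj_commute)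
    qed simp
    then show ?thesis unfolding a_def by (subst nn_integral_haarL) auto
  qed
  \<comment> \<open>The bounds 0 < a < \<infinity> allow a to be cancelled at the end. They come
    from the size of the density on the annulus and from a ball around 1 contained in it.\<close>
  have "a \<le> (\<integral>\<^sup>+x. ennreal (2 ^ DIM('f)) * indicator (ball 0 2) (x::'f) \<partial>lborel)"
    unfolding a
  proof (rule nn_integral_mono)
    fix x :: 'f
    have "1 / norm x ^ DIM('f) \<le> 2 ^ DIM('f)" if "x \<in> A"
    proof -
      have "1 / norm x \<le> 2" "0 \<le> 1 / norm x" using that by (auto simp: A_def divide_le_eq)
      then have "(1 / norm x) ^ DIM('f) \<le> 2 ^ DIM('f)" by (rule power_mono)
      then show ?thesis by (simp add: power_one_over)
    qed
    then show "ennreal (1 / norm x ^ DIM('f)) * indicator A x \<le> ennreal (2 ^ DIM('f)) * indicator (ball 0 2) x"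
      by (auto simp: indicator_def A_def simp del: ennreal_power intro!: ennreal_leI)
  qed
  also have "\<dots> < \<infinity>"
    using emeasure_lborel_ball_finite[of "0::'f" 2]
    by (subst nn_integral_cmult_indicator) (auto simp del: ennreal_power intro!: ennreal_mult_less_top[THEN iffD2])
  finally have a_fin: "a < \<infinity>" .
  have "0 < ennreal (1 / 2 ^ DIM('f)) * emeasure lborel (ball (1::'f) (1/4))"
    by (simp add: emeasure_ball ennreal_mult[symmetric])
  also have "\<dots> = (\<integral>\<^sup>+x. ennreal (1 / 2 ^ DIM('f)) * indicator (ball 1 (1/4)) (x::'f) \<partial>lborel)"
    by (subst nn_integral_cmult_indicator) auto
  also have "\<dots> \<le> a"
    unfolding a
  proof (rule nn_integral_mono)
    fix x :: 'f
    have sub: "x \<in> A" if "x \<in> ball 1 (1/4)"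
      using that norm_triangle_ineq2[of x 1] norm_triangle_ineq2[of 1 x]
      by (auto simp: A_def dist_norm norm_minus_commute)
    have "1 / 2 ^ DIM('f) \<le> 1 / norm x ^ DIM('f)" if "x \<in> A"
    proof -
      have "norm x ^ DIM('f) \<le> 2 ^ DIM('f)" "norm x > 0" using that by (auto simp: A_def intro!: power_mono)
      then show ?thesis by (intro divide_left_mono) auto
    qed
    then show "ennreal (1 / 2 ^ DIM('f)) * indicator (ball 1 (1/4)) x \<le> ennreal (1 / norm x ^ DIM('f)) * indicator A x"
      using sub by (auto simp: indicator_def intro!: ennreal_leI)
  qed
  finally have a_pos: "0 < a" .
  have "a * (\<integral>\<^sup>+y. f y \<partial>haarL) = (\<integral>\<^sup>+x. indicator A (inverse x) * (\<integral>\<^sup>+y. f y \<partial>haarL) \<partial>(haarL::'f measure))"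
    by (simp add: a_def nn_integral_multc)
  also have "\<dots> = (\<integral>\<^sup>+x. (\<integral>\<^sup>+y. indicator A (inverse x) * f (y * inverse x) \<partial>haarL) \<partial>(haarL::'f measure))"
  proof (rule nn_integral_cong_AE, use AE_haarL_neq_0 in eventually_elim)
    fix x :: 'f assume "x \<noteq> 0"
    then show "indicator A (inverse x) * (\<integral>\<^sup>+y. f y \<partial>haarL) = (\<integral>\<^sup>+y. indicator A (inverse x) * f (y * inverse x) \<partial>haarL)"
      by (simp add: nn_integral_cmult nn_integral_haarL_right)
  qed
  also have "\<dots> = (\<integral>\<^sup>+y. (\<integral>\<^sup>+x. indicator A (inverse x) * f (y * inverse x) \<partial>haarL) \<partial>(haarL::'f measure))"
    by (rule haarL_pair.Fubini') measurable
  \<comment> \<open>Replacing x by x y turns y x^-1 into x^-1, so that f no longer depends on y. The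
    integral over y is then a by left invariance.\<close>
  also have "\<dots> = (\<integral>\<^sup>+y. (\<integral>\<^sup>+x. indicator A (inverse (x * y)) * f (inverse x) \<partial>haarL) \<partial>(haarL::'f measure))"
  proof (rule nn_integral_cong_AE, use AE_haarL_neq_0 in eventually_elim)
    fix y :: 'f assume y: "y \<noteq> 0"
    have "(\<integral>\<^sup>+x. indicator A (inverse x) * f (y * inverse x) \<partial>haarL)
      = (\<integral>\<^sup>+x. indicator A (inverse (x * y)) * f (y * inverse (x * y)) \<partial>haarL)"
      by (rule nn_integral_haarL_right[symmetric]) (use y in auto)
    also have "\<dots> = (\<integral>\<^sup>+x. indicator A (inverse (x * y)) * f (inverse x) \<partial>haarL)"
    proof (rule nn_integral_cong_AE, use AE_haarL_neq_0 in eventually_elim)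
      fix x :: 'f assume "x \<noteq> 0"
      then have "y * inverse (x * y) = inverse x"
        by (metis nonzero_inverse_mult_distrib mult.assoc right_inverse mult_1 y)
      then show "indicator A (inverse (x * y)) * f (y * inverse (x * y)) = indicator A (inverse (x * y)) * f (inverse x)"
        by simp
    qed
    finally show "(\<integral>\<^sup>+x. indicator A (inverse x) * f (y * inverse x) \<partial>haarL) = (\<integral>\<^sup>+x. indicator A (inverse (x * y)) * f (inverse x) \<partial>haarL)" .
  qed
  also have "\<dots> = (\<integral>\<^sup>+x. (\<integral>\<^sup>+y. indicator A (inverse (x * y)) * f (inverse x) \<partial>haarL) \<partial>(haarL::'f measure))"
    by (rule haarL_pair.Fubini') measurable
  also have "\<dots> = (\<integral>\<^sup>+x. a * f (inverse x) \<partial>(haarL::'f measure))"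
  proof (rule nn_integral_cong_AE, use AE_haarL_neq_0 in eventually_elim)
    fix x :: 'f assume x: "x \<noteq> 0"
    have "(\<integral>\<^sup>+y. indicator A (inverse (x * y)) \<partial>haarL) = a"
      unfolding a_def by (rule nn_integral_haarL_left) (use x in auto)
    then show "(\<integral>\<^sup>+y. indicator A (inverse (x * y)) * f (inverse x) \<partial>haarL) = a * f (inverse x)"
      by (simp add: nn_integral_multc)
  qed
  also have "\<dots> = a * (\<integral>\<^sup>+x. f (inverse x) \<partial>haarL)" by (simp add: nn_integral_cmult)
  finally show ?thesis using a_fin a_pos by (auto simp: ennreal_mult_cancel_left)
qed

lemma
  fixes f :: "'f::rch \<Rightarrow> 'c::{banach,second_countable_topology}"
  assumes "f \<in> borel_measurable borel"
  shows integral_haarL_inverse: "(\<integral>x. f (inverse x) \<partial>haarL) = (\<integral>x. f x \<partial>haarL)"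
    and integrable_haarL_inverse: "integrable haarL (\<lambda>x. f (inverse x)) \<longleftrightarrow> integrable haarL f"
  by (rule integral_invariant[where T=inverse] integrable_invariant[where T=inverse];
      use assms in \<open>auto intro: nn_integral_haarL_inverse\<close>)+

lemma
  fixes f :: "'f::rch \<Rightarrow> 'c::{banach,second_countable_topology}"
  assumes "f \<in> borel_measurable borel" and "m \<noteq> 0"
  shows integral_haarL_left: "(\<integral>x. f (m * x) \<partial>haarL) = (\<integral>x. f x \<partial>haarL)"
    and integrable_haarL_left: "integrable haarL (\<lambda>x. f (m * x)) \<longleftrightarrow> integrable haarL f"
  by (rule integral_invariant[where T="(*) m"] integrable_invariant[where T="(*) m"];
      use assms in \<open>auto intro: nn_integral_haarL_left\<close>)+

section \<open>Fourier inversion\<close>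

lemma (in pair_sigma_finite) integrable_pair_bound:
  fixes h :: "'a \<times> 'b \<Rightarrow> 'c::{banach,second_countable_topology}"
  assumes f: "integrable M1 f" and g: "integrable M2 g"
    and h[measurable]: "h \<in> borel_measurable (M1 \<Otimes>\<^sub>M M2)"
    and bound: "\<And>x y. norm (h (x, y)) \<le> (f x * g y :: real)"
  shows "integrable (M1 \<Otimes>\<^sub>M M2) h"
proof (rule Fubini_integrable)
  have 1: "integrable M2 (\<lambda>y. h (x, y))" if "x \<in> space M1" for x
    by (rule Bochner_Integration.integrable_bound[OF integrable_mult_right[OF g, of "f x"]])
      (use that in \<open>auto intro!: AE_I2 order_trans[OF bound]\<close>)
  then show "AE x in M1. integrable M2 (\<lambda>y. h (x, y))" by simp
  show "integrable M1 (\<lambda>x. \<integral>y. norm (h (x, y)) \<partial>M2)"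
  proof (rule Bochner_Integration.integrable_bound[OF integrable_mult_left[OF f, of "integral\<^sup>L M2 g"]], goal_cases)
    case 2
    show ?case
    proof (rule AE_I2)
      fix x assume x: "x \<in> space M1"
      have "(\<integral>y. norm (h (x, y)) \<partial>M2) \<le> (\<integral>y. f x * g y \<partial>M2)"
        using 1[OF x] g by (intro integral_mono bound) auto
      also have "\<dots> = f x * integral\<^sup>L M2 g" by simp
      finally show "norm (\<integral>y. norm (h (x, y)) \<partial>M2) \<le> norm (f x * integral\<^sup>L M2 g)"
        by (simp add: integral_nonneg_AE)
    qed
  qed measurable
qed (fact h)

lemma integral_lborel_shift:
  fixes f :: "'a::euclidean_space \<Rightarrow> 'b::{banach,second_countable_topology}"
  assumes [measurable]: "f \<in> borel_measurable borel"
  shows "(\<integral>x. f (c + x) \<partial>lborel) = (\<integral>x. f x \<partial>lborel)"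
  by (rule integral_invariant[where T="(+) c"]) (auto intro: nn_integral_lborel_shift)

section \<open>The additive character and the Gaussian\<close>

definition ee :: "real \<Rightarrow> complex"
  where "ee t = exp (- 2 * \<i> * complex_of_real (pi * t))"

lemma ee_add: "ee (s + t) = ee s * ee t"
  by (simp add: ee_def exp_add[symmetric] algebra_simps)

lemma ee_diff: "ee (s - t) = ee s * ee (- t)"
  using ee_add[of s "- t"] by simp

lemma ee_0 [simp]: "ee 0 = 1"
  by (simp add: ee_def)

lemma norm_ee [simp]: "cmod (ee t) = 1"
  by (simp add: ee_def norm_exp_eq_Re)

lemma cnj_ee [simp]: "cnj (ee t) = ee (- t)"
  by (simp add: ee_def exp_cnj)

lemma ee_sum: "ee (\<Sum>i\<in>A. f i) = (\<Prod>i\<in>A. ee (f i))"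
  by (induction A rule: infinite_finite_induct) (auto simp: ee_add)

lemma continuous_on_ee [continuous_intros]: "continuous_on S f \<Longrightarrow> continuous_on S (\<lambda>x. ee (f x))"
  unfolding ee_def by (intro continuous_intros)

lemma borel_measurable_ee [measurable]: "ee \<in> borel_measurable borel"
  by (intro borel_measurable_continuous_onI continuous_intros)

text \<open>With pi in the exponent the Gaussian has integral 1 and is its own transform for the
  character \<open>ee\<close>.\<close>

definition gs :: "'v::real_inner \<Rightarrow> real"
  where "gs x = exp (- pi * (norm x)\<^sup>2)"

lemma gs_pos: "gs x > 0" by (simp add: gs_def)

lemma gs_le_1: "gs x \<le> 1" by (simp add: gs_def)

lemma continuous_on_gs [continuous_intros]: "continuous_on S f \<Longrightarrow> continuous_on S (\<lambda>x. gs (f x))"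
  unfolding gs_def by (intro continuous_intros)

lemma borel_measurable_gs [measurable]: "(gs :: 'v::euclidean_space \<Rightarrow> real) \<in> borel_measurable borel"
  by (intro borel_measurable_continuous_onI continuous_intros)

definition fourier :: "('v::euclidean_space \<Rightarrow> complex) \<Rightarrow> 'v \<Rightarrow> complex"
  where "fourier f \<xi> = (\<integral>x. ee (inner \<xi> x) * f x \<partial>lborel)"

text \<open>Up to scaling by c with c^2 = 2 pi this is the standard normal density, whose
  characteristic function is known.\<close>

lemma
  shows integrable_gs_real: "integrable lborel (gs :: real \<Rightarrow> real)"
    and fourier_gs_real: "(\<integral>x. ee (\<xi> * x) * complex_of_real (gs x) \<partial>lborel) = complex_of_real (gs \<xi>)"
proof -
  define c where "c = sqrt (2 * pi)"
  have c: "c > 0" "c\<^sup>2 = 2 * pi" by (simp_all add: c_def)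
  have gs: "gs x = c * std_normal_density (0 + c * x)" for x :: real
  proof -
    have "- (c * x)\<^sup>2 / 2 = - pi * x\<^sup>2" using c(2) by (simp add: power_mult_distrib)
    then show ?thesis using c(1) by (simp add: std_normal_density_def gs_def c_def[symmetric])
  qed
  show "integrable lborel (gs :: real \<Rightarrow> real)"
    unfolding gs using c by (intro integrable_mult_right lborel_integrable_real_affine) auto
  have "complex_of_real (exp (- (c * (- \<xi>))\<^sup>2 / 2)) = char std_normal_distribution (c * (- \<xi>))"
    by (simp add: char_std_normal_distribution)
  also have "\<dots> = (\<integral>x. std_normal_density x *\<^sub>R iexp (c * (- \<xi>) * x) \<partial>lborel)"
    unfolding char_def by (subst integral_density) auto
  also have "\<dots> = \<bar>c\<bar> *\<^sub>R (\<integral>x. std_normal_density (0 + c * x) *\<^sub>R iexp (c * (- \<xi>) * (0 + c * x)) \<partial>lborel)"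
    by (rule lborel_integral_real_affine) (use c in auto)
  also have "\<dots> = (\<integral>x. ee (\<xi> * x) * complex_of_real (gs x) \<partial>lborel)"
  proof -
    have "iexp (c * (- \<xi>) * (0 + c * x)) = ee (\<xi> * x)" for x
    proof -
      have "c * (- \<xi>) * (0 + c * x) = - 2 * (pi * (\<xi> * x))" using c(2) by (simp add: power2_eq_square algebra_simps)
      then show ?thesis unfolding ee_def by (simp only:) (simp add: mult_ac)
    qed
    then have "\<bar>c\<bar> *\<^sub>R (std_normal_density (0 + c * x) *\<^sub>R iexp (c * (- \<xi>) * (0 + c * x))) = ee (\<xi> * x) * complex_of_real (gs x)" for x
      unfolding gs using c by (simp add: scaleR_conv_of_real)
    then show ?thesis by (simp flip: integral_scaleR_right)
  qed
  finally show "(\<integral>x. ee (\<xi> * x) * complex_of_real (gs x) \<partial>lborel) = complex_of_real (gs \<xi>)"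
    using c by (simp add: gs_def power_mult_distrib)
qed

lemma gs_prod: "gs (x::'v::euclidean_space) = (\<Prod>b\<in>Basis. gs (x \<bullet> b))"
proof -
  have "(norm x)\<^sup>2 = (\<Sum>b\<in>Basis. (x \<bullet> b)\<^sup>2)"
    unfolding power2_norm_eq_inner by (subst euclidean_inner) (simp add: power2_eq_square)
  then show ?thesis by (simp add: gs_def exp_sum[symmetric] sum_distrib_left sum_negf)
qed

lemma integrable_gs: "integrable lborel (gs :: 'v::euclidean_space \<Rightarrow> real)"
proof (rule integrableI_nonneg)
  have "(\<integral>\<^sup>+x. ennreal (gs (x::'v)) \<partial>lborel) = (\<integral>\<^sup>+x. (\<Prod>b\<in>Basis. ennreal (gs (x \<bullet> b))) \<partial>(lborel::'v measure))"
    by (subst gs_prod) (simp add: prod_ennreal less_imp_le[OF gs_pos])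
  also have "\<dots> = (\<Prod>b\<in>(Basis::'v set). (\<integral>\<^sup>+x. ennreal (gs (x::real)) \<partial>lborel))"
    by (rule nn_integral_lborel_prod) auto
  also have "\<dots> < \<infinity>"
    using integrable_gs_real by (auto simp: integrable_iff_bounded less_top[symmetric] power_eq_top_ennreal gs_def)
  finally show "(\<integral>\<^sup>+x. ennreal (gs (x::'v)) \<partial>lborel) < \<infinity>" .
qed (auto simp: less_imp_le[OF gs_pos])

lemma fourier_gs: "fourier (\<lambda>x. complex_of_real (gs x)) \<xi> = complex_of_real (gs (\<xi>::'v::euclidean_space))"
proof -
  interpret P: product_sigma_finite "\<lambda>b::'v. lborel::real measure" ..
  define F where "F b t = ee ((\<xi> \<bullet> b) * t) * complex_of_real (gs t)" for b :: 'v and t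
  have F: "ee (inner \<xi> x) * complex_of_real (gs x) = (\<Prod>b\<in>Basis. F b (x \<bullet> b))" for x
    unfolding F_def by (subst euclidean_inner, subst gs_prod) (simp add: ee_sum prod.distrib)
  have [measurable]: "F b \<in> borel_measurable borel" for b unfolding F_def by measurable
  have intF: "integrable lborel (F b)" for b
    by (rule Bochner_Integration.integrable_bound[OF integrable_gs_real]) (auto simp: F_def norm_mult)
  have "fourier (\<lambda>x. complex_of_real (gs x)) \<xi> = (\<integral>x. (\<Prod>b\<in>Basis. F b (x \<bullet> b)) \<partial>(lborel::'v measure))"
    unfolding fourier_def F ..
  also have "\<dots> = (\<integral>f. (\<Prod>b\<in>Basis. F b ((\<Sum>c\<in>Basis. f c *\<^sub>R c) \<bullet> b)) \<partial>(\<Pi>\<^sub>M b\<in>(Basis::'v set). lborel))"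
    by (subst lborel_eq, subst integral_distr) auto
  also have "\<dots> = (\<integral>f. (\<Prod>b\<in>Basis. F b (f b)) \<partial>(\<Pi>\<^sub>M b\<in>(Basis::'v set). lborel))"
    by (intro Bochner_Integration.integral_cong prod.cong) (auto simp: inner_sum_left_Basis)
  also have "\<dots> = (\<Prod>b\<in>(Basis::'v set). \<integral>t. F b t \<partial>lborel)"
    by (rule P.product_integral_prod) (auto intro: intF)
  also have "\<dots> = (\<Prod>b\<in>(Basis::'v set). complex_of_real (gs (\<xi> \<bullet> b)))"
    by (simp add: F_def fourier_gs_real)
  also have "\<dots> = complex_of_real (gs \<xi>)" by (subst (2) gs_prod) simp
  finally show ?thesis .
qed

lemma integral_gs: "(\<integral>x. gs (x::'v::euclidean_space) \<partial>lborel) = 1"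
proof -
  have "complex_of_real (\<integral>x. gs (x::'v) \<partial>lborel) = fourier (\<lambda>x. complex_of_real (gs x)) (0::'v)"
    by (simp add: fourier_def)
  also have "\<dots> = 1" by (simp add: fourier_gs) (simp add: gs_def)
  finally show ?thesis by simp
qed

lemma borel_measurable_fourier [measurable]:
  assumes [measurable]: "f \<in> borel_measurable borel"
  shows "fourier f \<in> borel_measurable borel"
  unfolding fourier_def by measurable

lemma norm_fourier_le:
  assumes "integrable lborel f"
  shows "cmod (fourier f \<xi>) \<le> (\<integral>x. cmod (f x) \<partial>lborel)"
proof -
  have "cmod (fourier f \<xi>) \<le> (\<integral>x. cmod (ee (inner \<xi> x) * f x) \<partial>lborel)"
    unfolding fourier_def by (rule integral_norm_bound)
  then show ?thesis by (simp add: norm_mult)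
qed

lemma integrable_ee_mult:
  assumes "integrable lborel (f :: 'v::euclidean_space \<Rightarrow> complex)" "u \<in> borel_measurable borel"
  shows "integrable lborel (\<lambda>x. ee (u x) * f x)"
  by (rule Bochner_Integration.integrable_bound[OF assms(1)])
    (use assms in \<open>auto simp: norm_mult\<close>)

text \<open>As s tends to 0 these transforms form an approximate identity: total mass 1,
  concentrated at the origin.\<close>

lemma fourier_gs_scaled:
  fixes z :: "'v::euclidean_space"
  assumes s: "s > 0"
  shows "(\<integral>\<xi>. ee (inner \<xi> z) * complex_of_real (gs (s *\<^sub>R \<xi>)) \<partial>lborel)
    = complex_of_real ((1 / s ^ DIM('v)) * gs ((1/s) *\<^sub>R z))"
proof -
  define F where "F \<eta> = ee (inner ((1/s) *\<^sub>R z) \<eta>) * complex_of_real (gs \<eta>)" for \<eta>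
  have [measurable]: "F \<in> borel_measurable borel" unfolding F_def by measurable
  have "F (s *\<^sub>R \<xi>) = ee (inner \<xi> z) * complex_of_real (gs (s *\<^sub>R \<xi>))" for \<xi>
    using s by (simp add: F_def inner_commute)
  then have "(\<integral>\<xi>. ee (inner \<xi> z) * complex_of_real (gs (s *\<^sub>R \<xi>)) \<partial>lborel) = (\<integral>\<xi>. F (s *\<^sub>R \<xi>) \<partial>lborel)" by simp
  also have "\<dots> = (1 / s ^ DIM('v)) *\<^sub>R (\<integral>\<xi>. F \<xi> \<partial>lborel)"
    by (rule integral_similarity[OF linear_scale_self]) (use s in auto)
  also have "(\<integral>\<xi>. F \<xi> \<partial>lborel) = complex_of_real (gs ((1/s) *\<^sub>R z))"
    using fourier_gs[of "(1/s) *\<^sub>R z"] by (simp add: F_def fourier_def)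
  finally show ?thesis by (simp add: scaleR_conv_of_real)
qed

text \<open>The Gaussian factor makes the double integral absolutely convergent although
  \<open>fourier f\<close> need not be integrable. After Fubini the inner integral is a Gaussian of
  width s around x.\<close>

lemma fourier_gaussian_mollifier:
  fixes f :: "'v::euclidean_space \<Rightarrow> complex"
  assumes f: "integrable lborel f" and s: "s > 0"
  shows "(\<integral>\<xi>. ee (- inner \<xi> x) * (fourier f \<xi> * complex_of_real (gs (s *\<^sub>R \<xi>))) \<partial>lborel)
    = (\<integral>u. f (x + s *\<^sub>R u) * complex_of_real (gs u) \<partial>lborel)"
proof -
  have [measurable]: "f \<in> borel_measurable borel" using f by auto
  have gss: "integrable lborel (\<lambda>\<xi>::'v. gs (s *\<^sub>R \<xi>))"
    using integrable_gs by (subst integrable_similarity[OF linear_scale_self]) (use s in auto)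
  define h where "h \<xi> y = ee (inner \<xi> (y - x)) * complex_of_real (gs (s *\<^sub>R \<xi>)) * f y" for \<xi> y
  have h: "ee (- inner \<xi> x) * (ee (inner \<xi> y) * f y * complex_of_real (gs (s *\<^sub>R \<xi>))) = h \<xi> y" for \<xi> y
    by (simp add: h_def inner_diff_right ee_diff mult_ac)
  have hm[measurable]: "case_prod h \<in> borel_measurable (borel \<Otimes>\<^sub>M borel)" unfolding h_def by measurable
  have "integrable (lborel \<Otimes>\<^sub>M lborel) (case_prod h)"
    by (rule lborel_pair.integrable_pair_bound[OF gss integrable_norm[OF f]])
      (auto simp: h_def norm_mult less_imp_le[OF gs_pos] cong: measurable_cong_sets)
  note Fub = lborel_pair.Fubini_integral[OF this]
  have "(\<integral>\<xi>. ee (- inner \<xi> x) * (fourier f \<xi> * complex_of_real (gs (s *\<^sub>R \<xi>))) \<partial>lborel)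
    = (\<integral>\<xi>. (\<integral>y. h \<xi> y \<partial>lborel) \<partial>lborel)"
    unfolding fourier_def h[symmetric] by simp
  also have "\<dots> = (\<integral>y. (\<integral>\<xi>. h \<xi> y \<partial>lborel) \<partial>lborel)" by (rule Fub[symmetric])
  also have "\<dots> = (\<integral>y. (1 / s ^ DIM('v)) *\<^sub>R (f y * complex_of_real (gs ((1/s) *\<^sub>R (y - x)))) \<partial>lborel)"
  proof (rule Bochner_Integration.integral_cong[OF refl])
    fix y
    have "(\<integral>\<xi>. h \<xi> y \<partial>lborel) = (\<integral>\<xi>. ee (inner \<xi> (y - x)) * complex_of_real (gs (s *\<^sub>R \<xi>)) \<partial>lborel) * f y"
      unfolding h_def by simp
    then show "(\<integral>\<xi>. h \<xi> y \<partial>lborel) = (1 / s ^ DIM('v)) *\<^sub>R (f y * complex_of_real (gs ((1/s) *\<^sub>R (y - x))))"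
      by (simp only: fourier_gs_scaled[OF s]) (simp add: scaleR_conv_of_real)
  qed
  also have "\<dots> = (1 / s ^ DIM('v)) *\<^sub>R (\<integral>y. f y * complex_of_real (gs ((1/s) *\<^sub>R (y - x))) \<partial>lborel)"
    by simp
  also have "(\<integral>y. f y * complex_of_real (gs ((1/s) *\<^sub>R (y - x))) \<partial>lborel)
    = (\<integral>y. f (x + y) * complex_of_real (gs ((1/s) *\<^sub>R y)) \<partial>lborel)"
    by (subst integral_lborel_shift[symmetric, of _ x]) auto
  also have "\<dots> = s ^ DIM('v) *\<^sub>R (\<integral>y. f (x + s *\<^sub>R y) * complex_of_real (gs y) \<partial>lborel)"
  proof -
    define G where "G u = f (x + s *\<^sub>R u) * complex_of_real (gs u)" for u
    have [measurable]: "G \<in> borel_measurable borel" unfolding G_def by measurable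
    have "(\<integral>y. G ((1/s) *\<^sub>R y) \<partial>lborel) = (1 / (1/s) ^ DIM('v)) *\<^sub>R (\<integral>u. G u \<partial>lborel)"
      by (rule integral_similarity[OF linear_scale_self]) (use s in auto)
    then show ?thesis using s by (simp add: G_def power_one_over)
  qed
  finally show ?thesis using s by simp
qed

lemma gaussian_mollifier_tendsto:
  fixes f :: "'v::euclidean_space \<Rightarrow> complex"
  assumes c: "continuous_on UNIV f" and B: "\<And>x. cmod (f x) \<le> B" and s: "s \<longlonglongrightarrow> 0"
  shows "(\<lambda>n. \<integral>u. f (x + s n *\<^sub>R u) * complex_of_real (gs u) \<partial>lborel) \<longlonglongrightarrow> f x"
proof -
  have [measurable]: "f \<in> borel_measurable borel" by (rule borel_measurable_continuous_onI[OF c])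
  have "(\<lambda>n. \<integral>u. f (x + s n *\<^sub>R u) * complex_of_real (gs u) \<partial>lborel) \<longlonglongrightarrow> (\<integral>u. f x * complex_of_real (gs (u::'v)) \<partial>lborel)"
  proof (rule integral_dominated_convergence[where w="\<lambda>u. B * gs u"])
    show "integrable lborel (\<lambda>u::'v. B * gs u)" by (intro integrable_mult_right integrable_gs)
    show "AE u in lborel. (\<lambda>n. f (x + s n *\<^sub>R u) * complex_of_real (gs u)) \<longlonglongrightarrow> f x * complex_of_real (gs u)"
    proof (rule AE_I2)
      fix u :: 'v
      have "(\<lambda>n. x + s n *\<^sub>R u) \<longlonglongrightarrow> x + 0 *\<^sub>R u" by (intro tendsto_intros s)
      then have "(\<lambda>n. f (x + s n *\<^sub>R u)) \<longlonglongrightarrow> f x"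
        using c by (intro continuous_on_tendsto_compose[OF c]) auto
      then show "(\<lambda>n. f (x + s n *\<^sub>R u) * complex_of_real (gs u)) \<longlonglongrightarrow> f x * complex_of_real (gs u)"
        by (intro tendsto_intros)
    qed
    show "AE u in lborel. cmod (f (x + s n *\<^sub>R u) * complex_of_real (gs u)) \<le> B * gs u" for n
      using B by (intro AE_I2) (auto simp: norm_mult less_imp_le[OF gs_pos] intro!: mult_right_mono)
  qed measurable
  also have "(\<integral>u. f x * complex_of_real (gs (u::'v)) \<partial>lborel) = f x * complex_of_real (\<integral>u. gs (u::'v) \<partial>lborel)"
    by simp
  finally show ?thesis by (simp add: integral_gs)
qed

text \<open>The two sides are limits of the two sides of the mollified identity as s tends to 0:
  \<open>fourier f\<close> itself dominates the first, and boundedness with continuity of f gives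
  the second.\<close>

theorem fourier_inversion:
  fixes f :: "'v::euclidean_space \<Rightarrow> complex"
  assumes c: "continuous_on UNIV f" and B: "\<And>x. cmod (f x) \<le> B"
    and f: "integrable lborel f" and f': "integrable lborel (fourier f)"
  shows "(\<integral>\<xi>. ee (- inner \<xi> x) * fourier f \<xi> \<partial>lborel) = f x"
proof -
  have [measurable]: "f \<in> borel_measurable borel" by (rule borel_measurable_continuous_onI[OF c])
  define s where "s n = 1 / real (Suc n)" for n
  have s: "s n > 0" for n by (simp add: s_def)
  have s0: "s \<longlonglongrightarrow> 0" unfolding s_def using LIMSEQ_Suc[OF lim_1_over_n] by simp
  have "(\<lambda>n. \<integral>\<xi>. ee (- inner \<xi> x) * (fourier f \<xi> * complex_of_real (gs (s n *\<^sub>R \<xi>))) \<partial>lborel)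
    \<longlonglongrightarrow> (\<integral>\<xi>. ee (- inner \<xi> x) * fourier f \<xi> \<partial>lborel)"
  proof (rule integral_dominated_convergence[where w="\<lambda>\<xi>. cmod (fourier f \<xi>)"])
    show "integrable lborel (\<lambda>\<xi>. cmod (fourier f \<xi>))" using f' by simp
    show "AE \<xi> in lborel. (\<lambda>n. ee (- inner \<xi> x) * (fourier f \<xi> * complex_of_real (gs (s n *\<^sub>R \<xi>)))) \<longlonglongrightarrow> ee (- inner \<xi> x) * fourier f \<xi>"
    proof (rule AE_I2)
      fix \<xi> :: 'v
      have "(\<lambda>n. exp (- pi * (norm (s n *\<^sub>R \<xi>))\<^sup>2)) \<longlonglongrightarrow> exp (- pi * (norm (0 *\<^sub>R \<xi>))\<^sup>2)" by (intro tendsto_intros s0)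
      then have g: "(\<lambda>n. gs (s n *\<^sub>R \<xi>)) \<longlonglongrightarrow> 1" by (simp add: gs_def)
      have "(\<lambda>n. ee (- inner \<xi> x) * (fourier f \<xi> * complex_of_real (gs (s n *\<^sub>R \<xi>)))) \<longlonglongrightarrow> ee (- inner \<xi> x) * (fourier f \<xi> * complex_of_real 1)"
        by (intro tendsto_intros g)
      then show "(\<lambda>n. ee (- inner \<xi> x) * (fourier f \<xi> * complex_of_real (gs (s n *\<^sub>R \<xi>)))) \<longlonglongrightarrow> ee (- inner \<xi> x) * fourier f \<xi>"
        by simp
    qed
    show "AE \<xi> in lborel. cmod (ee (- inner \<xi> x) * (fourier f \<xi> * complex_of_real (gs (s n *\<^sub>R \<xi>)))) \<le> cmod (fourier f \<xi>)" for n
      by (intro AE_I2) (auto simp: norm_mult less_imp_le[OF gs_pos] intro!: mult_left_le gs_le_1)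
  qed measurable
  moreover have "(\<lambda>n. \<integral>\<xi>. ee (- inner \<xi> x) * (fourier f \<xi> * complex_of_real (gs (s n *\<^sub>R \<xi>))) \<partial>lborel) \<longlonglongrightarrow> f x"
    unfolding fourier_gaussian_mollifier[OF f s] by (rule gaussian_mollifier_tendsto[OF c B s0])
  ultimately show ?thesis by (rule LIMSEQ_unique)
qed

section \<open>Schwartz functions\<close>

definition dd :: "'v::euclidean_space \<Rightarrow> ('v \<Rightarrow> complex) \<Rightarrow> ('v \<Rightarrow> complex)"
  where "dd b f = (\<lambda>x. frechet_derivative f (at x) b)"

lemma partials_Nil: "partials [] f = f"
  by (simp add: partials_def)

lemma partials_Cons: "partials (b # bs) f = dd b (partials bs f)"
  by (simp add: partials_def dd_def)

text \<open>\<open>foldr\<close> applies the last entry of the list first, so a derivative taken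
  beforehand is appended at the end.\<close>

lemma partials_snoc: "partials (bs @ [b]) f = partials bs (dd b f)"
  by (simp add: partials_def dd_def)

text \<open>Conditions on all iterated partials reduce to conditions on single functions once the
  set A is closed under one partial derivative.\<close>

lemma schwartz_coinduct [consumes 1, case_names diff dd decay]:
  assumes f: "f \<in> A"
    and diff: "\<And>f x. f \<in> A \<Longrightarrow> f differentiable at x"
    and dd: "\<And>f b. f \<in> A \<Longrightarrow> b \<in> Basis \<Longrightarrow> dd b f \<in> A"
    and decay: "\<And>f k. f \<in> A \<Longrightarrow> \<exists>C. \<forall>x. norm x ^ k * cmod (f x) \<le> C"
  shows "f \<in> schwartz"
proof -
  have A: "partials bs f \<in> A" if "bs \<in> lists Basis" for bs
    using that by (induction bs) (auto simp: partials_Nil partials_Cons f dd)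
  show ?thesis
    unfolding schwartz_def
  proof (intro CollectI ballI conjI allI)
    fix bs :: "'a list" and k :: nat assume bs: "bs \<in> lists Basis"
    show "partials bs f differentiable at x" for x using A[OF bs] by (rule diff)
    obtain C where "\<forall>x. norm x ^ k * cmod (partials bs f x) \<le> C" using decay[OF A[OF bs]] by blast
    then show "bounded (range (\<lambda>x. norm x ^ k *\<^sub>R partials bs f x))"
      unfolding bounded_iff by (intro exI[of _ C]) auto
  qed
qed

lemma schwartz_differentiable: "f \<in> schwartz \<Longrightarrow> f differentiable at x"
  unfolding schwartz_def using partials_Nil[of f] by (metis (mono_tags, lifting) lists.Nil mem_Collect_eq)

lemma schwartz_dd:
  assumes f: "f \<in> schwartz" and b: "b \<in> Basis"
  shows "dd b f \<in> schwartz"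
  unfolding schwartz_def
proof (intro CollectI ballI)
  fix bs :: "'a list" assume "bs \<in> lists Basis"
  then have "bs @ [b] \<in> lists Basis" using b by auto
  then show "(\<forall>x. partials bs (dd b f) differentiable at x) \<and>
    (\<forall>k. bounded (range (\<lambda>x. norm x ^ k *\<^sub>R partials bs (dd b f) x)))"
    using f unfolding schwartz_def partials_snoc[symmetric] by blast
qed

lemma schwartz_decay:
  assumes "f \<in> schwartz"
  shows "\<exists>C. \<forall>x. norm x ^ k * cmod (f x) \<le> C"
proof -
  have "bounded (range (\<lambda>x. norm x ^ k *\<^sub>R partials [] f x))"
    using assms by (simp add: schwartz_def)
  then show ?thesis unfolding bounded_iff partials_Nil by auto
qed

lemma schwartz_continuous: "f \<in> schwartz \<Longrightarrow> continuous_on UNIV f"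
  by (meson continuous_at_imp_continuous_on differentiable_imp_continuous_within schwartz_differentiable)

lemma schwartz_has_derivative: "f \<in> schwartz \<Longrightarrow> (f has_derivative frechet_derivative f (at x)) (at x)"
  using schwartz_differentiable frechet_derivative_works by blast

lemma frechet_derivative_dd:
  fixes f :: "'v::euclidean_space \<Rightarrow> complex"
  assumes "f differentiable at x"
  shows "frechet_derivative f (at x) v = (\<Sum>b\<in>Basis. complex_of_real (v \<bullet> b) * dd b f x)"
proof -
  have l: "linear (frechet_derivative f (at x))" using assms by (rule linear_frechet_derivative)
  have "frechet_derivative f (at x) v = frechet_derivative f (at x) (\<Sum>b\<in>Basis. (v \<bullet> b) *\<^sub>R b)"
    by (simp add: euclidean_representation)
  also have "\<dots> = (\<Sum>b\<in>Basis. (v \<bullet> b) *\<^sub>R dd b f x)"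
    by (simp add: linear_sum[OF l] linear_cmul[OF l] dd_def)
  finally show ?thesis by (simp add: scaleR_conv_of_real)
qed

lemma dd_eq: "(f has_derivative f') (at x) \<Longrightarrow> dd b f x = f' b"
  unfolding dd_def using frechet_derivative_at by metis

text \<open>Differentiating a Gaussian, a composite or a product leaves the set of generators only
  by sums, constants and coordinate factors. Closing under these operations leaves only the
  generators to be checked.\<close>

inductive_set schwartz_span :: "('v::euclidean_space \<Rightarrow> complex) set \<Rightarrow> ('v \<Rightarrow> complex) set"
  for S :: "('v \<Rightarrow> complex) set"
where
  base: "f \<in> S \<Longrightarrow> f \<in> schwartz_span S"
| add: "f \<in> schwartz_span S \<Longrightarrow> g \<in> schwartz_span S \<Longrightarrow> (\<lambda>x. f x + g x) \<in> schwartz_span S"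
| cmult: "f \<in> schwartz_span S \<Longrightarrow> (\<lambda>x. c * f x) \<in> schwartz_span S"
| coord: "f \<in> schwartz_span S \<Longrightarrow> b \<in> Basis \<Longrightarrow> (\<lambda>x. complex_of_real (x \<bullet> b) * f x) \<in> schwartz_span S"

lemma schwartz_span_sum:
  assumes "S \<noteq> {}" "\<And>i. i \<in> I \<Longrightarrow> f i \<in> schwartz_span S"
  shows "(\<lambda>x. \<Sum>i\<in>I. f i x) \<in> schwartz_span S"
proof -
  obtain g where "g \<in> S" using assms(1) by blast
  then have "(\<lambda>x. 0 * g x) \<in> schwartz_span S" by (intro schwartz_span.intros)
  then have z: "(\<lambda>x. 0) \<in> schwartz_span S" by simp
  show ?thesis
    using assms(2) by (induction I rule: infinite_finite_induct) (auto simp: z intro: schwartz_span.add)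
qed

text \<open>By the Leibniz rule the derivative of a coordinate multiple is a sum of two members of
  the span, and a coordinate factor costs one power of the norm in the decay.\<close>

lemma schwartz_span_subset:
  assumes diff: "\<And>f x. f \<in> S \<Longrightarrow> f differentiable at x"
    and dd: "\<And>f b. f \<in> S \<Longrightarrow> b \<in> Basis \<Longrightarrow> dd b f \<in> schwartz_span S"
    and decay: "\<And>f k. f \<in> S \<Longrightarrow> \<exists>C. \<forall>x. norm x ^ k * cmod (f x) \<le> C"
  shows "schwartz_span S \<subseteq> schwartz"
proof
  have D: "f differentiable at x" if "f \<in> schwartz_span S" for f x
    using that
  proof induction
    case (coord f b)
    have "(\<lambda>x. complex_of_real (x \<bullet> b)) differentiable at x"
      unfolding differentiable_def by (intro exI[of _ "\<lambda>h. complex_of_real (h \<bullet> b)"] derivative_intros)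
    then show ?case using coord by (intro differentiable_mult)
  qed (auto intro: diff)
  have H: "(f has_derivative frechet_derivative f (at x)) (at x)" if "f \<in> schwartz_span S" for f x
    using D[OF that] frechet_derivative_works by blast
  fix f assume "f \<in> schwartz_span S"
  then show "f \<in> schwartz"
  proof (induction rule: schwartz_coinduct)
    case (diff f x) then show ?case by (rule D)
  next
    case (dd f b)
    from dd(1) show ?case
    proof induction
      case (base f) then show ?case by (rule assms(2)) (rule dd(2))
    next
      case (add f g)
      have "dd b (\<lambda>x. f x + g x) = (\<lambda>x. dd b f x + dd b g x)"
      proof
        fix x show "dd b (\<lambda>x. f x + g x) x = dd b f x + dd b g x"
          unfolding dd_eq[OF has_derivative_add[OF H[OF add(1)] H[OF add(2)]]] by (simp add: dd_def)
      qed
      then show ?case using add by (auto intro: schwartz_span.intros)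
    next
      case (cmult f c)
      have "dd b (\<lambda>x. c * f x) = (\<lambda>x. c * dd b f x)"
      proof
        fix x show "dd b (\<lambda>x. c * f x) x = c * dd b f x"
          unfolding dd_eq[OF has_derivative_mult_right[OF H[OF cmult(1)]]] by (simp add: dd_def)
      qed
      then show ?case using cmult by (auto intro: schwartz_span.intros)
    next
      case (coord f e)
      have "dd b (\<lambda>x. complex_of_real (x \<bullet> e) * f x) = (\<lambda>x. complex_of_real (x \<bullet> e) * dd b f x + complex_of_real (b \<bullet> e) * f x)"
      proof
        fix x
        have 1: "((\<lambda>x. complex_of_real (x \<bullet> e)) has_derivative (\<lambda>h. complex_of_real (h \<bullet> e))) (at x)"
          by (intro derivative_intros)
        show "dd b (\<lambda>x. complex_of_real (x \<bullet> e) * f x) x = complex_of_real (x \<bullet> e) * dd b f x + complex_of_real (b \<bullet> e) * f x"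
          unfolding dd_eq[OF has_derivative_mult[OF 1 H[OF coord(1)]]] by (simp add: dd_def)
      qed
      then show ?case using coord by (auto intro: schwartz_span.intros)
    qed
  next
    case (decay f k)
    then show ?case
    proof (induction arbitrary: k)
      case (base f) then show ?case by (rule assms(3))
    next
      case (add f g)
      obtain C D where C: "\<forall>x. norm x ^ k * cmod (f x) \<le> C" and D: "\<forall>x. norm x ^ k * cmod (g x) \<le> D"
        using add.IH by meson
      have "norm x ^ k * cmod (f x + g x) \<le> C + D" for x
      proof -
        have "norm x ^ k * cmod (f x + g x) \<le> norm x ^ k * (cmod (f x) + cmod (g x))"
          by (intro mult_left_mono norm_triangle_ineq) auto
        then show ?thesis using C[rule_format, of x] D[rule_format, of x] by (simp add: distrib_left)
      qed
      then show ?case by blast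
    next
      case (cmult f c)
      obtain C where C: "\<forall>x. norm x ^ k * cmod (f x) \<le> C" using cmult.IH by meson
      have "norm x ^ k * cmod (c * f x) \<le> cmod c * C" for x
        using mult_left_mono[OF C[rule_format, of x], of "cmod c"] by (simp add: norm_mult mult_ac)
      then show ?case by blast
    next
      case (coord f e)
      obtain C where C: "\<forall>x. norm x ^ Suc k * cmod (f x) \<le> C" using coord.IH by meson
      have "norm x ^ k * cmod (complex_of_real (x \<bullet> e) * f x) \<le> C" for x
      proof -
        have "norm x ^ k * cmod (complex_of_real (x \<bullet> e) * f x) \<le> norm x ^ k * (norm x * cmod (f x))"
          using Basis_le_norm[OF coord(2), of x] by (auto simp: norm_mult intro!: mult_mono mult_left_mono)
        also have "\<dots> \<le> C" using C[rule_format, of x] by (simp add: mult_ac)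
        finally show ?thesis .
      qed
      then show ?case by blast
    qed
  qed
qed

lemma schwartz_span_schwartz: "schwartz_span schwartz = schwartz"
proof
  show "schwartz_span schwartz \<subseteq> (schwartz :: ('a \<Rightarrow> complex) set)"
    by (rule schwartz_span_subset) (auto intro: schwartz_differentiable schwartz_span.base schwartz_dd schwartz_decay)
qed (auto intro: schwartz_span.base)

lemma schwartz_add: "f \<in> schwartz \<Longrightarrow> g \<in> schwartz \<Longrightarrow> (\<lambda>x. f x + g x) \<in> schwartz"
  using schwartz_span.add[of f schwartz g] by (simp add: schwartz_span_schwartz)

lemma schwartz_cmult: "f \<in> schwartz \<Longrightarrow> (\<lambda>x. c * f x) \<in> schwartz"
  using schwartz_span.cmult[of f schwartz c] by (simp add: schwartz_span_schwartz)

lemma schwartz_coord: "f \<in> schwartz \<Longrightarrow> b \<in> Basis \<Longrightarrow> (\<lambda>x. complex_of_real (x \<bullet> b) * f x) \<in> schwartz"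
  using schwartz_span.coord[of f schwartz b] by (simp add: schwartz_span_schwartz)

text \<open>With y = |x|^2, the k-th term of the exponential series bounds y^k by k! exp(pi y),
  which gives \<open>fact k\<close>. The 1 accounts for |x| \<le> 1, where |x|^k need not be below
  y^k.\<close>

lemma norm_power_gs_le: "norm x ^ k * gs x \<le> 1 + fact k"
proof -
  define y where "y = (norm x)\<^sup>2"
  have y: "y \<ge> 0" by (simp add: y_def)
  have "(\<Sum>i\<in>{k}. (pi * y) ^ i /\<^sub>R fact i) \<le> exp (pi * y)"
    unfolding exp_def using y by (intro sum_le_suminf summable_exp_generic) auto
  then have "(pi * y) ^ k \<le> fact k * exp (pi * y)" by (simp add: field_simps)
  moreover have "y ^ k \<le> (pi * y) ^ k" using y pi_ge_two by (intro power_mono) (auto simp: mult_le_cancel_right1)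
  ultimately have "y ^ k \<le> fact k * exp (pi * y)" by linarith
  then have "y ^ k * gs x \<le> fact k"
    by (simp add: gs_def y_def[symmetric] exp_minus field_simps)
  moreover have "norm x ^ k \<le> 1 + y ^ k"
  proof (cases "norm x \<le> 1")
    case True
    then have "norm x ^ k \<le> 1" by (simp add: power_le_one)
    then show ?thesis using y by (simp add: add_increasing2)
  next
    case False
    then have "norm x ^ k \<le> norm x ^ (2 * k)" by (intro power_increasing) auto
    then show ?thesis by (simp add: y_def power_mult)
  qed
  then have "norm x ^ k * gs x \<le> (1 + y ^ k) * gs x"
    by (intro mult_right_mono) (auto simp: less_imp_le[OF gs_pos])
  ultimately show ?thesis using gs_le_1[of x] by (simp add: distrib_right)
qed

lemma zero_schwartz: "(\<lambda>x. 0) \<in> schwartz"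
  by (rule schwartz_coinduct[where A="{\<lambda>x. 0}"]) (auto simp: dd_def)

lemma gs_schwartz: "(\<lambda>x. complex_of_real (gs x)) \<in> schwartz"
proof -
  define g :: "'a \<Rightarrow> complex" where "g = (\<lambda>x. complex_of_real (gs x))"
  have D: "(g has_derivative (\<lambda>h. complex_of_real (- 2 * pi * (x \<bullet> h)) * g x)) (at x)" for x
  proof -
    have "((\<lambda>x. complex_of_real (exp (- pi * (x \<bullet> x)))) has_derivative
      (\<lambda>h. complex_of_real (exp (- pi * (x \<bullet> x)) * (- pi * (x \<bullet> h + h \<bullet> x))))) (at x)"
      by (rule derivative_eq_intros refl | simp add: fun_eq_iff algebra_simps)+
    then show ?thesis by (simp add: g_def gs_def power2_norm_eq_inner inner_commute mult_ac)
  qed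
  have "schwartz_span {g} \<subseteq> schwartz"
  proof (rule schwartz_span_subset)
    fix f :: "'a \<Rightarrow> complex" and b :: 'a assume "f \<in> {g}" and b: "b \<in> Basis"
    then have "f = g" by simp
    then have "dd b f = (\<lambda>x. complex_of_real (- 2 * pi) * (complex_of_real (x \<bullet> b) * g x))"
      using dd_eq[OF D] by (auto simp: mult_ac)
    then show "dd b f \<in> schwartz_span {g}"
      by (simp only:) (intro schwartz_span.cmult schwartz_span.coord schwartz_span.base b singletonI)
  next
    fix f k assume "f \<in> {g}"
    then show "\<exists>C. \<forall>x. norm x ^ k * cmod (f x) \<le> C"
      using norm_power_gs_le by (auto simp: g_def less_imp_le[OF gs_pos])
  qed (use D in \<open>auto simp: differentiable_def\<close>)
  then show ?thesis by (auto simp: g_def intro: schwartz_span.base)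
qed

text \<open>By the chain rule a partial of a composite is a combination, with constant coefficients,
  of composites of partials. Decay in T x is decay in x because the norm is scaled by r > 0.\<close>

lemma schwartz_similarity:
  fixes T :: "'v::euclidean_space \<Rightarrow> 'v"
  assumes f: "f \<in> schwartz" and lin: "linear T" and r: "r > 0" and nT: "\<And>x. norm (T x) = r * norm x"
  shows "(\<lambda>x. f (T x)) \<in> schwartz"
proof -
  define S where "S = (\<lambda>f x. f (T x)) ` schwartz"
  have bl: "bounded_linear T" using lin by (simp add: linear_conv_bounded_linear)
  have T: "(T has_derivative T) (at x)" for x by (rule bounded_linear_imp_has_derivative[OF bl])
  have D: "((\<lambda>x. f (T x)) has_derivative (\<lambda>h. frechet_derivative f (at (T x)) (T h))) (at x)" if "f \<in> schwartz" for f x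
    using has_derivative_compose[OF T schwartz_has_derivative[OF that]] .
  have "schwartz_span S \<subseteq> schwartz"
  proof (rule schwartz_span_subset)
    fix h x assume "h \<in> S" then show "h differentiable at x" using D by (auto simp: S_def differentiable_def)
  next
    fix h and b :: 'v assume "h \<in> S" and b: "b \<in> Basis"
    then obtain f where h: "h = (\<lambda>x. f (T x))" and f: "f \<in> schwartz" by (auto simp: S_def)
    have "dd b h = (\<lambda>x. \<Sum>c\<in>Basis. complex_of_real (T b \<bullet> c) * dd c f (T x))"
      unfolding h using dd_eq[OF D[OF f]] frechet_derivative_dd[OF schwartz_differentiable[OF f]] by auto
    also have "\<dots> \<in> schwartz_span S"
      using f by (intro schwartz_span_sum schwartz_span.cmult schwartz_span.base) (auto simp: S_def schwartz_dd)
    finally show "dd b h \<in> schwartz_span S" .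
  next
    fix h k assume "h \<in> S"
    then obtain f where h: "h = (\<lambda>x. f (T x))" and f: "f \<in> schwartz" by (auto simp: S_def)
    obtain C where C: "\<forall>x. norm x ^ k * cmod (f x) \<le> C" using schwartz_decay[OF f] by blast
    have "norm x ^ k * cmod (h x) \<le> C / r ^ k" for x
      using C[rule_format, of "T x"] r by (simp add: h nT power_mult_distrib field_simps)
    then show "\<exists>C. \<forall>x. norm x ^ k * cmod (h x) \<le> C" by blast
  qed
  then show ?thesis using f by (auto simp: S_def intro: schwartz_span.base)
qed

text \<open>Decay without smoothness: the class contains Schwartz functions and continuous functions
  of compact support alike, and decay alone makes the transform differentiable.\<close>

definition rapid :: "('v::euclidean_space \<Rightarrow> complex) set"
  where "rapid = {f \<in> borel_measurable borel. \<forall>M. \<exists>C. \<forall>x. cmod (f x) \<le> C * wt M x}"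

lemma wt_ge_norm_power: "norm x ^ k * wt M x \<le> wt (M - k) x" if "k \<le> M"
proof -
  define y where "y = 1 + (norm x)\<^sup>2"
  have y: "y > 0" by (simp add: y_def add_pos_nonneg)
  have "norm x \<le> y"
    using zero_le_power2[of "norm x - 1/2"] unfolding y_def by (simp add: power2_diff power_divide)
  then have "norm x ^ k \<le> y ^ k" by (intro power_mono) auto
  then have "norm x ^ k * (1 / y ^ M) \<le> y ^ k * (1 / y ^ M)" using y by (intro mult_right_mono) auto
  also have "\<dots> = 1 / y ^ (M - k)" using y that by (simp add: power_diff)
  finally show ?thesis by (simp add: wt_def y_def)
qed

lemma schwartz_imp_rapid: "f \<in> schwartz \<Longrightarrow> f \<in> rapid"
  unfolding rapid_def
proof (intro CollectI conjI allI)
  assume f: "f \<in> schwartz"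
  show "f \<in> borel_measurable borel" by (intro borel_measurable_continuous_onI schwartz_continuous f)
  fix M
  obtain C where C: "\<forall>x. norm x ^ (2 * M) * cmod (f x) \<le> C" using schwartz_decay[OF f] by blast
  obtain D where D: "\<forall>x. norm x ^ 0 * cmod (f x) \<le> D" using schwartz_decay[OF f] by blast
  have "cmod (f x) \<le> 2 ^ M * (C + D) * wt M x" for x
  proof -
    have "(1 + (norm x)\<^sup>2) ^ M \<le> (2 * max 1 ((norm x)\<^sup>2)) ^ M" by (intro power_mono) auto
    also have "\<dots> = 2 ^ M * max 1 ((norm x)\<^sup>2) ^ M" by (simp add: power_mult_distrib)
    also have "max 1 ((norm x)\<^sup>2) ^ M \<le> 1 + norm x ^ (2 * M)" by (auto simp: max_def power_mult)
    finally have "(1 + (norm x)\<^sup>2) ^ M \<le> 2 ^ M * (1 + norm x ^ (2 * M))" by simp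
    then have "(1 + (norm x)\<^sup>2) ^ M * cmod (f x) \<le> 2 ^ M * (1 + norm x ^ (2 * M)) * cmod (f x)"
      by (rule mult_right_mono) simp
    also have "\<dots> = 2 ^ M * (norm x ^ (2 * M) * cmod (f x) + norm x ^ 0 * cmod (f x))" by (simp add: algebra_simps)
    also have "\<dots> \<le> 2 ^ M * (C + D)" using C D by (intro mult_left_mono add_mono) auto
    finally show ?thesis by (simp add: wt_def field_simps add_pos_nonneg)
  qed
  then show "\<exists>C. \<forall>x. cmod (f x) \<le> C * wt M x" by blast
qed

lemma rapid_measurable: "f \<in> rapid \<Longrightarrow> f \<in> borel_measurable borel"
  by (simp add: rapid_def)

lemma rapid_bound: "f \<in> rapid \<Longrightarrow> \<exists>C\<ge>0. \<forall>x. cmod (f x) \<le> C * wt M x"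
proof -
  assume "f \<in> rapid"
  then obtain C where C: "\<forall>x. cmod (f x) \<le> C * wt M x" by (auto simp: rapid_def)
  have "cmod (f 0) \<le> C" using C[rule_format, of 0] by (simp add: wt_def)
  then have "C \<ge> 0" using norm_ge_zero order_trans by blast
  then show ?thesis using C by blast
qed

lemma rapid_norm_power: 
  assumes f: "f \<in> rapid"
  shows "integrable lborel (\<lambda>x. norm x ^ k * cmod (f x))"
proof -
  obtain C where C: "C \<ge> 0" "\<forall>x. cmod (f x) \<le> C * wt (DIM('a) + k) x" using rapid_bound[OF f] by blast
  have [measurable]: "f \<in> borel_measurable borel" using f by (rule rapid_measurable)
  show ?thesis
  proof (rule integrable_if_le_wt[where M="DIM('a)" and C=C])
    fix x :: 'a
    have "norm x ^ k * cmod (f x) \<le> norm x ^ k * (C * wt (DIM('a) + k) x)"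
      using C by (intro mult_left_mono) auto
    also have "\<dots> \<le> C * wt (DIM('a)) x"
      using mult_left_mono[OF wt_ge_norm_power[of k "DIM('a) + k" x], of C] C(1) by (simp add: mult_ac)
    finally show "norm (norm x ^ k * cmod (f x)) \<le> C * wt (DIM('a)) x" by simp
  qed auto
qed

lemma rapid_integrable: "f \<in> rapid \<Longrightarrow> integrable lborel f"
  using rapid_norm_power[of f 0] rapid_measurable[of f] integrable_norm_iff[of f lborel] by simp

lemma rapid_coord:
  assumes f: "f \<in> rapid" and b: "b \<in> Basis"
  shows "(\<lambda>x. c * (complex_of_real (x \<bullet> b) * f x)) \<in> rapid"
  unfolding rapid_def
proof (intro CollectI conjI allI)
  have [measurable]: "f \<in> borel_measurable borel" using f by (rule rapid_measurable)
  show "(\<lambda>x. c * (complex_of_real (x \<bullet> b) * f x)) \<in> borel_measurable borel" by measurable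
  fix M
  obtain C where C: "C \<ge> 0" "\<forall>x. cmod (f x) \<le> C * wt (Suc M) x" using rapid_bound[OF f] by blast
  have "cmod (c * (complex_of_real (x \<bullet> b) * f x)) \<le> cmod c * C * wt M x" for x
  proof -
    have "cmod (complex_of_real (x \<bullet> b) * f x) \<le> norm x * (C * wt (Suc M) x)"
      using Basis_le_norm[OF b, of x] C by (auto simp: norm_mult intro!: mult_mono)
    also have "\<dots> \<le> C * wt M x"
      using mult_left_mono[OF wt_ge_norm_power[of 1 "Suc M" x], of C] C(1) by (simp add: mult_ac)
    finally show ?thesis by (simp add: norm_mult mult_left_mono mult.assoc)
  qed
  then show "\<exists>C. \<forall>x. cmod (c * (complex_of_real (x \<bullet> b) * f x)) \<le> C * wt M x" by blast
qed

text \<open>The bound is the second-order remainder (2 pi t)^2 / 2 of the exponential.\<close>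

lemma norm_ee_taylor: "cmod (ee t - 1 + 2 * \<i> * complex_of_real (pi * t)) \<le> 2 * pi\<^sup>2 * t\<^sup>2"
proof -
  have "{..1::nat} = {0,1}" by auto
  then have "cmod (iexp (- 2 * pi * t) - (1 + \<i> * complex_of_real (- 2 * pi * t))) \<le> (2 * pi * t)\<^sup>2 / 2"
    using iexp_approx1[of "- 2 * pi * t" 1] by (simp add: power2_eq_square)
  moreover have "iexp (- 2 * pi * t) - (1 + \<i> * complex_of_real (- 2 * pi * t)) = ee t - 1 + 2 * \<i> * complex_of_real (pi * t)"
    by (simp add: ee_def mult_ac algebra_simps)
  ultimately show ?thesis by (simp only:) (simp add: power_mult_distrib)
qed

text \<open>Differentiation under the integral: the Taylor remainder bounds the error by a multiple
  of |h|^2 times the second absolute moment of f, which is finite by rapid decay.\<close>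

lemma fourier_has_derivative:
  fixes f :: "'v::euclidean_space \<Rightarrow> complex"
  assumes f: "f \<in> rapid"
  shows "(fourier f has_derivative (\<lambda>h. \<integral>x. (- 2 * \<i> * complex_of_real (pi * (inner h x))) * (ee (inner \<xi> x) * f x) \<partial>lborel)) (at \<xi>)"
    (is "(_ has_derivative ?L) _")
proof -
  have [measurable]: "f \<in> borel_measurable borel" using f by (rule rapid_measurable)
  have intL: "integrable lborel (\<lambda>x. (- 2 * \<i> * complex_of_real (pi * (inner h x))) * (ee (inner \<xi> x) * f x))" for h
  proof (rule Bochner_Integration.integrable_bound)
    show "integrable lborel (\<lambda>x. (2 * pi * norm h) * (norm x ^ 1 * cmod (f x)))"
      by (intro integrable_mult_right rapid_norm_power f)
    show "AE x in lborel. norm ((- 2 * \<i> * complex_of_real (pi * (inner h x))) * (ee (inner \<xi> x) * f x)) \<le> norm ((2 * pi * norm h) * (norm x ^ 1 * cmod (f x)))"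
      using Cauchy_Schwarz_ineq2[of h] by (intro AE_I2) (auto simp: norm_mult abs_mult mult.assoc[symmetric] intro!: mult_right_mono)
  qed measurable
  have linL: "bounded_linear ?L"
    unfolding linear_conv_bounded_linear[symmetric]
  proof (rule linearI)
    fix a b :: 'v and r :: real
    show "?L (a + b) = ?L a + ?L b"
      unfolding Bochner_Integration.integral_add[OF intL intL, symmetric]
      by (intro Bochner_Integration.integral_cong) (auto simp: inner_add_left algebra_simps)
    show "?L (r *\<^sub>R a) = r *\<^sub>R ?L a"
      unfolding integral_scaleR_right[symmetric]
      by (intro Bochner_Integration.integral_cong) (auto simp: scaleR_conv_of_real mult_ac)
  qed
  define K where "K = 2 * pi\<^sup>2 * (\<integral>x. norm x ^ 2 * cmod (f x) \<partial>lborel)"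
  have K: "K \<ge> 0" by (simp add: K_def integral_nonneg_AE)
  have bound: "cmod (fourier f (\<xi> + h) - fourier f \<xi> - ?L h) \<le> K * (norm h)\<^sup>2" for h
  proof -
    have i1: "integrable lborel (\<lambda>x. ee (inner \<eta> x) * f x)" for \<eta>
      by (intro integrable_ee_mult rapid_integrable f) measurable
    have "fourier f (\<xi> + h) - fourier f \<xi> - ?L h =
      (\<integral>x. ee (inner (\<xi> + h) x) * f x - ee (inner \<xi> x) * f x - (- 2 * \<i> * complex_of_real (pi * (inner h x))) * (ee (inner \<xi> x) * f x) \<partial>lborel)"
      unfolding fourier_def using i1 intL by simp
    also have "\<dots> = (\<integral>x. (ee (inner h x) - 1 + 2 * \<i> * complex_of_real (pi * inner h x)) * (ee (inner \<xi> x) * f x) \<partial>lborel)"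
      by (intro Bochner_Integration.integral_cong) (auto simp: inner_add_left ee_add algebra_simps)
    also have "cmod \<dots> \<le> (\<integral>x. (2 * pi\<^sup>2 * (norm h)\<^sup>2) * (norm x ^ 2 * cmod (f x)) \<partial>lborel)"
    proof (rule Bochner_Integration.integral_norm_bound_integral)
      show "integrable lborel (\<lambda>x. (2 * pi\<^sup>2 * (norm h)\<^sup>2) * (norm x ^ 2 * cmod (f x)))"
        by (intro integrable_mult_right rapid_norm_power f)
      show "integrable lborel (\<lambda>x. (ee (inner h x) - 1 + 2 * \<i> * complex_of_real (pi * inner h x)) * (ee (inner \<xi> x) * f x))"
      proof -
        have "integrable lborel (\<lambda>x. ee (inner (\<xi> + h) x) * f x - ee (inner \<xi> x) * f x - (- 2 * \<i> * complex_of_real (pi * (inner h x))) * (ee (inner \<xi> x) * f x))"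
          using i1 intL by (intro Bochner_Integration.integrable_diff)
        then show ?thesis by (simp add: inner_add_left ee_add algebra_simps)
      qed
      fix x
      have "(inner h x)\<^sup>2 \<le> (norm h * norm x)\<^sup>2"
          using power_mono[OF Cauchy_Schwarz_ineq2[of h x], of 2] by simp
      then have "cmod (ee (inner h x) - 1 + 2 * \<i> * complex_of_real (pi * inner h x)) \<le> 2 * pi\<^sup>2 * (norm h * norm x)\<^sup>2"
        by (intro order_trans[OF norm_ee_taylor] mult_left_mono) auto
      then show "cmod ((ee (inner h x) - 1 + 2 * \<i> * complex_of_real (pi * inner h x)) * (ee (inner \<xi> x) * f x)) \<le> (2 * pi\<^sup>2 * (norm h)\<^sup>2) * (norm x ^ 2 * cmod (f x))"
        unfolding norm_mult norm_ee mult_1 by (auto simp: power_mult_distrib mult.assoc[symmetric] intro!: mult_right_mono)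
    qed
    also have "\<dots> = K * (norm h)\<^sup>2"
      by (subst integral_mult_right_zero) (simp add: K_def mult_ac)
    finally show ?thesis .
  qed
  show ?thesis
    unfolding has_derivative_at
  proof (intro conjI linL)
    have "(\<lambda>h::'v. K * norm h) \<midarrow>0\<rightarrow> K * norm (0::'v)"
      by (rule tendsto_mult[OF tendsto_const tendsto_norm[OF tendsto_ident_at]])
    then have lim: "(\<lambda>h. K * norm (h::'v)) \<midarrow>0\<rightarrow> 0" by simp
    show "(\<lambda>h. norm (fourier f (\<xi> + h) - fourier f \<xi> - ?L h) / norm h) \<midarrow>0\<rightarrow> 0"
    proof (rule tendsto_sandwich[OF _ _ tendsto_const lim])
      show "\<forall>\<^sub>F h in at 0. norm (fourier f (\<xi> + h) - fourier f \<xi> - ?L h) / norm h \<le> K * norm h"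
        unfolding eventually_at_filter
      proof (rule always_eventually, intro allI impI)
        fix h :: 'v assume "h \<noteq> 0"
        then show "norm (fourier f (\<xi> + h) - fourier f \<xi> - ?L h) / norm h \<le> K * norm h"
          using bound[of h] by (simp add: divide_le_eq power2_eq_square mult_ac)
      qed
    qed auto
  qed
qed

lemma dd_fourier:
  assumes f: "f \<in> rapid"
  shows "dd b (fourier f) = fourier (\<lambda>x. (- 2 * \<i> * complex_of_real pi) * (complex_of_real (x \<bullet> b) * f x))"
  using dd_eq[OF fourier_has_derivative[OF f]] by (auto simp: fourier_def fun_eq_iff inner_commute mult_ac)

lemma fourier_differentiable: "f \<in> rapid \<Longrightarrow> fourier f differentiable at x"
  using fourier_has_derivative unfolding differentiable_def by blast

text \<open>All decay comes from h. A derivative of the transform multiplies f by a coordinate and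
  keeps it rapid, so partials of such products are sums of such products. This makes Gaussian
  averages of merely continuous functions Schwartz.\<close>

lemma fourier_mult_schwartz:
  assumes f: "f \<in> rapid" and h: "h \<in> schwartz"
  shows "(\<lambda>x. fourier f x * h x) \<in> schwartz"
proof -
  define S :: "('a \<Rightarrow> complex) set" where "S = {\<lambda>x. fourier f x * h x | f h. f \<in> rapid \<and> h \<in> schwartz}"
  have "schwartz_span S \<subseteq> schwartz"
  proof (rule schwartz_span_subset)
    fix u x assume "u \<in> S"
    then obtain f h where u: "u = (\<lambda>x. fourier f x * h x)" and fh: "f \<in> rapid" "h \<in> schwartz" by (auto simp: S_def)
    show "u differentiable at x"
      unfolding u using fh by (intro differentiable_mult fourier_differentiable schwartz_differentiable)
  next
    fix u and b :: 'a assume "u \<in> S" and b: "b \<in> Basis"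
    then obtain f h where u: "u = (\<lambda>x. fourier f x * h x)" and fh: "f \<in> rapid" "h \<in> schwartz" by (auto simp: S_def)
    have "dd b u = (\<lambda>x. fourier f x * dd b h x + fourier (\<lambda>x. (- 2 * \<i> * complex_of_real pi) * (complex_of_real (x \<bullet> b) * f x)) x * h x)"
    proof
      fix x
      have D: "(fourier f has_derivative frechet_derivative (fourier f) (at x)) (at x)"
        using fourier_differentiable[OF fh(1)] frechet_derivative_works by blast
      show "dd b u x = fourier f x * dd b h x + fourier (\<lambda>x. (- 2 * \<i> * complex_of_real pi) * (complex_of_real (x \<bullet> b) * f x)) x * h x"
        unfolding u dd_eq[OF has_derivative_mult[OF D schwartz_has_derivative[OF fh(2)]]]
        using dd_fourier[OF fh(1), of b] by (simp add: dd_def fun_eq_iff)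
    qed
    also have "\<dots> \<in> schwartz_span S"
    proof (intro schwartz_span.add schwartz_span.base)
      show "(\<lambda>x. fourier f x * dd b h x) \<in> S"
        unfolding S_def using fh(1) schwartz_dd[OF fh(2) b] by blast
      show "(\<lambda>x. fourier (\<lambda>x. (- 2 * \<i> * complex_of_real pi) * (complex_of_real (x \<bullet> b) * f x)) x * h x) \<in> S"
        unfolding S_def using rapid_coord[OF fh(1) b] fh(2) by blast
    qed
    finally show "dd b u \<in> schwartz_span S" .
  next
    fix u k assume "u \<in> S"
    then obtain f h where u: "u = (\<lambda>x. fourier f x * h x)" and fh: "f \<in> rapid" "h \<in> schwartz" by (auto simp: S_def)
    obtain C where C: "\<forall>x. norm x ^ k * cmod (h x) \<le> C" using schwartz_decay[OF fh(2)] by blast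
    define B where "B = (\<integral>x. cmod (f x) \<partial>lborel)"
    have B: "cmod (fourier f x) \<le> B" for x unfolding B_def by (intro norm_fourier_le rapid_integrable fh)
    have "norm x ^ k * cmod (u x) \<le> B * C" for x
    proof -
      have "norm x ^ k * cmod (u x) = cmod (fourier f x) * (norm x ^ k * cmod (h x))" by (simp add: u norm_mult)
      also have "\<dots> \<le> B * C" using B[of x] C norm_ge_zero[THEN order_trans, OF B[of x]] by (intro mult_mono) auto
      finally show ?thesis .
    qed
    then show "\<exists>C. \<forall>x. norm x ^ k * cmod (u x) \<le> C" by blast
  qed
  then show ?thesis using assms by (auto simp: S_def intro!: schwartz_span.base)
qed


text \<open>Peetre's inequality 1 + |x|^2 \<le> 2 (1 + |u|^2)(1 + |x + u|^2): a translate is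
  dominated by the untranslated weight.\<close>

lemma wt_shift: "wt M (x + u) \<le> 2 ^ M * (1 + (norm u)\<^sup>2) ^ M * wt M (x::'a::real_normed_vector)"
proof -
  define p q r where "p = 1 + (norm (x + u))\<^sup>2" and "q = 1 + (norm u)\<^sup>2" and "r = 1 + (norm x)\<^sup>2"
  have pos: "p > 0" "q > 0" "r > 0" by (simp_all add: p_def q_def r_def add_pos_nonneg)
  have "norm x \<le> norm (x + u) + norm u" using norm_triangle_ineq4[of "x + u" u] by simp
  then have "(norm x)\<^sup>2 \<le> (norm (x + u) + norm u)\<^sup>2" by (intro power_mono) auto
  also have "\<dots> \<le> 2 * (norm (x + u))\<^sup>2 + 2 * (norm u)\<^sup>2"
    using zero_le_power2[of "norm (x + u) - norm u"] by (simp add: power2_eq_square algebra_simps)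
  finally have "r \<le> 2 * q * p" 
    using zero_le_power2[of "norm (x + u) * norm u"]
    by (simp add: p_def q_def r_def algebra_simps power_mult_distrib) (smt (verit) zero_le_power2 mult_nonneg_nonneg)
  then have "r ^ M \<le> (2 * q * p) ^ M" using pos by (intro power_mono) auto
  then have "1 / p ^ M \<le> 2 ^ M * q ^ M * (1 / r ^ M)"
    using pos by (simp add: power_mult_distrib field_simps)
  then show ?thesis by (simp add: wt_def p_def q_def r_def)
qed

lemma integral_lborel_shift_right:
  fixes f :: "'a::euclidean_space \<Rightarrow> 'b::{banach,second_countable_topology}"
  assumes "f \<in> borel_measurable borel"
  shows "(\<integral>x. f (x + c) \<partial>lborel) = (\<integral>x. f x \<partial>lborel)"
  using integral_lborel_shift[OF assms, of c] by (simp add: add.commute)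

lemma has_vector_derivative_quotient:
  fixes g :: "real \<Rightarrow> 'a::real_normed_vector"
  assumes "(g has_vector_derivative D) (at 0)"
  shows "((\<lambda>s. (g s - g 0) /\<^sub>R s) \<longlongrightarrow> D) (at 0)"
proof -
  have "(\<lambda>h. norm (g (0 + h) - g 0 - h *\<^sub>R D) / norm h) \<midarrow>0\<rightarrow> 0"
    using assms by (simp add: has_vector_derivative_def has_derivative_at)
  then have "(\<lambda>h. norm ((g h - g 0) /\<^sub>R h - D)) \<midarrow>0\<rightarrow> 0"
  proof (rule Lim_transform_eventually)
    show "\<forall>\<^sub>F h in at 0. norm (g (0 + h) - g 0 - h *\<^sub>R D) / norm h = norm ((g h - g 0) /\<^sub>R h - D)"
      unfolding eventually_at_filter
    proof (rule always_eventually, intro allI impI)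
      fix h :: real assume h: "h \<noteq> 0"
      then have "(g h - g 0) /\<^sub>R h - D = (g h - g 0 - h *\<^sub>R D) /\<^sub>R h" by (simp add: scaleR_diff_right)
      then show "norm (g (0 + h) - g 0 - h *\<^sub>R D) / norm h = norm ((g h - g 0) /\<^sub>R h - D)"
        by (simp add: divide_inverse mult.commute)
    qed
  qed
  then show ?thesis by (simp add: tendsto_norm_zero_iff LIM_zero_iff)
qed

text \<open>Integration by parts, obtained by differentiating \<open>t \<mapsto> \<integral> ee(\<xi>\<cdot>x) f(x + tb) dx = ee(-t \<xi>\<cdot>b) (fourier f)(\<xi>)\<close>.\<close>

lemma fourier_dd:
  fixes f :: "'v::euclidean_space \<Rightarrow> complex"
  assumes f: "f \<in> schwartz" and b: "b \<in> Basis"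
  shows "fourier (dd b f) \<xi> = 2 * \<i> * complex_of_real (pi * (\<xi> \<bullet> b)) * fourier f \<xi>"
proof -
  have [measurable]: "f \<in> borel_measurable borel" "dd b f \<in> borel_measurable borel"
    using f schwartz_dd[OF f b] by (auto intro: rapid_measurable schwartz_imp_rapid)
  define t where "t n = 1 / real (Suc n)" for n
  have t: "0 < t n" "t n \<le> 1" for n by (simp_all add: t_def)
  have t0: "t \<longlonglongrightarrow> 0" unfolding t_def using LIMSEQ_Suc[OF lim_1_over_n] by simp
  have tat: "filterlim t (at 0) sequentially"
    unfolding filterlim_at using t t0 by (auto intro!: always_eventually simp: less_imp_neq[symmetric] dest: less_imp_neq)
  have i: "integrable lborel (\<lambda>x. ee (inner \<xi> x) * f (x + c))" for c
  proof -
    have "integrable lborel (\<lambda>x. f (x + c))"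
    proof -
      have "integrable (distr lborel borel ((+) c)) f" using rapid_integrable[OF schwartz_imp_rapid[OF f]] by (simp add: lborel_distr_plus)
      then show ?thesis by (subst (asm) integrable_distr_eq) (auto simp: add.commute)
    qed
    then show ?thesis by (rule integrable_ee_mult) measurable
  qed
  have shift: "(\<integral>x. ee (inner \<xi> x) * f (x + c) \<partial>lborel) = ee (- inner \<xi> c) * fourier f \<xi>" for c
  proof -
    have "(\<integral>x. ee (inner \<xi> x) * f (x + c) \<partial>lborel) = (\<integral>x. ee (inner \<xi> (x + c - c)) * f (x + c) \<partial>lborel)" by simp
    also have "\<dots> = (\<integral>x. ee (inner \<xi> (x - c)) * f x \<partial>lborel)"
      by (rule integral_lborel_shift_right) measurable
    also have "\<dots> = (\<integral>x. ee (- inner \<xi> c) * (ee (inner \<xi> x) * f x) \<partial>lborel)"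
      by (simp add: inner_diff_right ee_diff mult_ac)
    finally show ?thesis by (simp add: fourier_def)
  qed
  have line: "((\<lambda>s. f (x + s *\<^sub>R b)) has_vector_derivative dd b f (x + s *\<^sub>R b)) (at s)" for x s
  proof -
    have "((\<lambda>s. f (x + s *\<^sub>R b)) has_derivative (\<lambda>h. frechet_derivative f (at (x + s *\<^sub>R b)) (h *\<^sub>R b))) (at s)"
      by (rule has_derivative_compose[where f="\<lambda>s. x + s *\<^sub>R b" and g=f])
        (use schwartz_has_derivative[OF f] in \<open>auto intro!: derivative_eq_intros\<close>)
    then show ?thesis
      unfolding has_vector_derivative_def
      using linear_cmul[OF linear_frechet_derivative[OF schwartz_differentiable[OF f]]] by (simp add: dd_def)
  qed
  \<comment> \<open>Difference quotients along b with steps t n \<le> 1; their integrals are known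
    exactly from the translation formula \<open>shift\<close>.\<close>
  define Q where "Q n x = ee (inner \<xi> x) * ((f (x + t n *\<^sub>R b) - f x) /\<^sub>R t n)" for n x
  have Qn: "(\<integral>x. Q n x \<partial>lborel) = (ee (- (\<xi> \<bullet> b) * t n) - 1) /\<^sub>R t n * fourier f \<xi>" for n
  proof -
    have "(\<integral>x. Q n x \<partial>lborel) = (\<integral>x. (ee (inner \<xi> x) * f (x + t n *\<^sub>R b) - ee (inner \<xi> x) * f (x + 0)) /\<^sub>R t n \<partial>lborel)"
      unfolding Q_def by (simp add: scaleR_conv_of_real algebra_simps)
    also have "\<dots> = (ee (- inner \<xi> (t n *\<^sub>R b)) * fourier f \<xi> - ee (- inner \<xi> 0) * fourier f \<xi>) /\<^sub>R t n"
      using i by (simp only: integral_scaleR_right Bochner_Integration.integral_diff shift)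
    finally show ?thesis by (simp add: scaleR_conv_of_real algebra_simps)
  qed
  obtain C where C: "C \<ge> 0" "\<forall>x. cmod (dd b f x) \<le> C * wt (DIM('v)) x"
    using rapid_bound[OF schwartz_imp_rapid[OF schwartz_dd[OF f b]]] by blast
  \<comment> \<open>One power of 2 is the constant of \<open>wt_shift\<close>; the other bounds the
    power of 1 + |s b|^2 for 0 \<le> s \<le> 1.\<close>
  define C' where "C' = C * (2 ^ DIM('v) * 2 ^ DIM('v))"
  have "(\<lambda>n. \<integral>x. Q n x \<partial>lborel) \<longlonglongrightarrow> (\<integral>x. ee (inner \<xi> x) * dd b f x \<partial>lborel)"
  proof (rule integral_dominated_convergence[where w="\<lambda>x. C' * wt (DIM('v)) x"])
    show "integrable lborel (\<lambda>x::'v. C' * wt (DIM('v)) x)" by (intro integrable_mult_right integrable_wt) simp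
    have [measurable]: "(\<lambda>x. x + t n *\<^sub>R b) \<in> borel_measurable borel" for n by measurable
    show "Q n \<in> borel_measurable lborel" for n unfolding Q_def by measurable
    show "AE x in lborel. (\<lambda>n. Q n x) \<longlonglongrightarrow> ee (inner \<xi> x) * dd b f x"
    proof (rule AE_I2)
      fix x
      from filterlim_compose[OF has_vector_derivative_quotient[OF line[of x 0, simplified]] tat]
      have "(\<lambda>n. (f (x + t n *\<^sub>R b) - f x) /\<^sub>R t n) \<longlonglongrightarrow> dd b f x" by simp
      then show "(\<lambda>n. Q n x) \<longlonglongrightarrow> ee (inner \<xi> x) * dd b f x"
        unfolding Q_def by (intro tendsto_intros)
    qed
    show "AE x in lborel. cmod (Q n x) \<le> C' * wt (DIM('v)) x" for n
    proof (rule AE_I2)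
      fix x
      have "norm (f (x + t n *\<^sub>R b) - f (x + 0 *\<^sub>R b)) \<le> (C' * wt (DIM('v)) x) * norm (t n - 0)"
      proof (rule differentiable_bound[where S="{0..t n}" and f="\<lambda>s. f (x + s *\<^sub>R b)" and f'="\<lambda>s h. h *\<^sub>R dd b f (x + s *\<^sub>R b)"])
        fix s assume s: "s \<in> {0..t n}"
        show "((\<lambda>s. f (x + s *\<^sub>R b)) has_derivative (\<lambda>h. h *\<^sub>R dd b f (x + s *\<^sub>R b))) (at s within {0..t n})"
          using line[of x s] unfolding has_vector_derivative_def by (rule has_derivative_at_withinI)
        have "cmod (dd b f (x + s *\<^sub>R b)) \<le> C * wt (DIM('v)) (x + s *\<^sub>R b)" using C by blast
        also have "\<dots> \<le> C * (2 ^ DIM('v) * (1 + (norm (s *\<^sub>R b))\<^sup>2) ^ DIM('v) * wt (DIM('v)) x)"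
          by (intro mult_left_mono wt_shift C)
        also have "\<dots> \<le> C * (2 ^ DIM('v) * 2 ^ DIM('v) * wt (DIM('v)) x)"
        proof -
          have "s\<^sup>2 \<le> 1" using s t(2)[of n] by (auto intro!: power_le_one)
          then show ?thesis using b C
            by (intro mult_left_mono mult_right_mono power_mono) auto
        qed
        finally have *: "cmod (dd b f (x + s *\<^sub>R b)) \<le> C' * wt (DIM('v)) x" by (simp add: C'_def mult.assoc)
        show "onorm (\<lambda>h. h *\<^sub>R dd b f (x + s *\<^sub>R b)) \<le> C' * wt (DIM('v)) x"
          using C mult_left_mono[OF *] by (intro onorm_bound) (auto simp: C'_def mult.commute)
      qed (use t(1)[of n] in auto)
      then show "cmod (Q n x) \<le> C' * wt (DIM('v)) x"
        using t(1)[of n] by (simp add: Q_def norm_mult inverse_eq_divide pos_divide_le_eq mult_ac)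
    qed
  qed measurable
  moreover have "(\<lambda>n. \<integral>x. Q n x \<partial>lborel) \<longlonglongrightarrow> (2 * \<i> * complex_of_real (pi * (\<xi> \<bullet> b))) * fourier f \<xi>"
    unfolding Qn
  proof (rule tendsto_mult_right)
    have "((\<lambda>s. ee (- (\<xi> \<bullet> b) * s)) has_vector_derivative 2 * \<i> * complex_of_real (pi * (\<xi> \<bullet> b))) (at 0)"
    proof -
      define A where "A = 2 * \<i> * complex_of_real (pi * (\<xi> \<bullet> b))"
      have "ee (- (\<xi> \<bullet> b) * s) = exp (s *\<^sub>R A)" for s
        by (simp add: ee_def A_def scaleR_conv_of_real mult_ac)
      then show ?thesis
        using exp_scaleR_has_vector_derivative_right[of A 0 UNIV] by (simp add: A_def)
    qed
    from filterlim_compose[OF has_vector_derivative_quotient[OF this] tat]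
    show "(\<lambda>n. (ee (- (\<xi> \<bullet> b) * t n) - 1) /\<^sub>R t n) \<longlonglongrightarrow> 2 * \<i> * complex_of_real (pi * (\<xi> \<bullet> b))" by simp
  qed
  ultimately show ?thesis unfolding fourier_def using LIMSEQ_unique by blast
qed


text \<open>The norm is at most DIM times the largest coordinate, whose power is one term of the
  sum.\<close>

lemma norm_power_le_sum_coords:
  "norm (x::'v::euclidean_space) ^ k \<le> real DIM('v) ^ k * (\<Sum>b\<in>Basis. \<bar>x \<bullet> b\<bar> ^ k)"
proof -
  define m where "m = Max ((\<lambda>b. \<bar>x \<bullet> b\<bar>) ` (Basis::'v set))"
  have "m \<in> (\<lambda>b. \<bar>x \<bullet> b\<bar>) ` (Basis::'v set)" unfolding m_def by (rule Max_in) auto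
  then obtain c where c: "c \<in> Basis" "m = \<bar>x \<bullet> c\<bar>" by blast
  have le: "\<bar>x \<bullet> b\<bar> \<le> m" if "b \<in> Basis" for b :: 'v
    unfolding m_def using that by (intro Max_ge) auto
  have "norm x \<le> (\<Sum>b\<in>Basis. \<bar>x \<bullet> b\<bar>)" by (rule norm_le_l1)
  also have "\<dots> \<le> (\<Sum>b\<in>(Basis::'v set). m)" by (intro sum_mono le)
  finally have "norm x \<le> real DIM('v) * m" by simp
  then have "norm x ^ k \<le> (real DIM('v) * m) ^ k" by (intro power_mono) auto
  also have "\<dots> = real DIM('v) ^ k * \<bar>x \<bullet> c\<bar> ^ k" by (simp add: c power_mult_distrib)
  also have "\<dots> \<le> real DIM('v) ^ k * (\<Sum>b\<in>Basis. \<bar>x \<bullet> b\<bar> ^ k)"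
    using c(1) by (intro mult_left_mono member_le_sum) auto
  finally show ?thesis .
qed

text \<open>Each coordinate factor is exchanged for a derivative of f by \<open>fourier_dd\<close>,
  at the price of 1/(2 pi), until only the sup bound of a transform is left.\<close>

lemma fourier_coord_decay:
  assumes "f \<in> schwartz" and b: "b \<in> Basis"
  shows "\<exists>C. \<forall>\<xi>. \<bar>\<xi> \<bullet> b\<bar> ^ k * cmod (fourier f \<xi>) \<le> C"
  using assms(1)
proof (induction k arbitrary: f)
  case 0
  then show ?case using norm_fourier_le[OF rapid_integrable[OF schwartz_imp_rapid]] by auto
next
  case (Suc k)
  obtain C where C: "\<forall>\<xi>. \<bar>\<xi> \<bullet> b\<bar> ^ k * cmod (fourier (dd b f) \<xi>) \<le> C"
    using Suc.IH[OF schwartz_dd[OF Suc.prems b]] by blast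
  have "\<bar>\<xi> \<bullet> b\<bar> ^ Suc k * cmod (fourier f \<xi>) \<le> C / (2 * pi)" for \<xi>
    using C[rule_format, of \<xi>] by (simp add: fourier_dd[OF Suc.prems b] norm_mult abs_mult field_simps)
  then show ?case by blast
qed

text \<open>Transforms of Schwartz functions are closed under derivatives, since the derivative of a
  transform is the transform of a coordinate multiple. Decay is tested one coordinate at a
  time.\<close>

lemma fourier_schwartz:
  assumes "f \<in> schwartz"
  shows "fourier f \<in> schwartz"
proof (rule schwartz_coinduct[where A="fourier ` schwartz"])
  show "fourier f \<in> fourier ` schwartz" using assms by blast
  fix g :: "'a \<Rightarrow> complex" assume "g \<in> fourier ` schwartz"
  then obtain f where g: "g = fourier f" and f: "f \<in> schwartz" by blast
  show "g differentiable at x" for x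
    unfolding g by (intro fourier_differentiable schwartz_imp_rapid f)
  show "dd b g \<in> fourier ` schwartz" if "b \<in> Basis" for b
    unfolding g dd_fourier[OF schwartz_imp_rapid[OF f]]
    by (intro imageI schwartz_cmult schwartz_coord f that)
  fix k
  have "\<forall>b\<in>Basis. \<exists>C. \<forall>\<xi>. \<bar>\<xi> \<bullet> b\<bar> ^ k * cmod (fourier f \<xi>) \<le> C"
    using fourier_coord_decay[OF f] by blast
  then obtain C where C: "\<And>b \<xi>. b \<in> Basis \<Longrightarrow> \<bar>\<xi> \<bullet> b\<bar> ^ k * cmod (fourier f \<xi>) \<le> C b" by metis
  have "norm \<xi> ^ k * cmod (g \<xi>) \<le> real DIM('a) ^ k * (\<Sum>b\<in>Basis. C b)" for \<xi>
  proof -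
    have "norm \<xi> ^ k * cmod (g \<xi>) \<le> (real DIM('a) ^ k * (\<Sum>b\<in>Basis. \<bar>\<xi> \<bullet> b\<bar> ^ k)) * cmod (g \<xi>)"
      by (intro mult_right_mono norm_power_le_sum_coords) auto
    also have "\<dots> = real DIM('a) ^ k * (\<Sum>b\<in>Basis. \<bar>\<xi> \<bullet> b\<bar> ^ k * cmod (fourier f \<xi>))"
      by (simp add: g sum_distrib_right mult.assoc)
    also have "\<dots> \<le> real DIM('a) ^ k * (\<Sum>b\<in>Basis. C b)"
      by (intro mult_left_mono sum_mono C) auto
    finally show ?thesis .
  qed
  then show "\<exists>C. \<forall>\<xi>. norm \<xi> ^ k * cmod (g \<xi>) \<le> C" by blast
qed

section \<open>The conjugation and the symplectic Fourier transform\<close>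

text \<open>The second class axiom makes conjugation the reflection that fixes the real line.
  Linearity, isometry and involutivity follow from this without a case distinction over F.\<close>

lemma cjg_eq: "cjg (x::'f::rch) = (2 * inner 1 x) *\<^sub>R 1 - x"
  using add_cjg[of x] by (metis add_diff_cancel_left')

lemma linear_cjg: "linear (cjg :: 'f::rch \<Rightarrow> 'f)"
  by (rule linearI) (simp_all add: cjg_eq inner_add_right algebra_simps)

lemma norm_cjg [simp]: "norm (cjg (x::'f::rch)) = norm x"
proof -
  have 1: "inner (1::'f) 1 = 1" using power2_norm_eq_inner[of "1::'f"] by simp
  have "inner (cjg x) (cjg x) = inner x x"
    by (simp add: cjg_eq inner_diff_left inner_diff_right 1 inner_commute power2_eq_square algebra_simps)
  then show ?thesis by (simp add: norm_eq_sqrt_inner)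
qed

lemma cjg_cjg [simp]: "cjg (cjg (x::'f::rch)) = x"
proof -
  have 1: "inner (1::'f) 1 = 1" using power2_norm_eq_inner[of "1::'f"] by simp
  show ?thesis by (simp add: cjg_eq inner_diff_right 1 scaleR_left_diff_distrib)
qed

lemma continuous_on_cjg [continuous_intros]:
  "continuous_on S f \<Longrightarrow> continuous_on S (\<lambda>x. cjg (f x :: 'f::rch))"
  unfolding cjg_eq by (intro continuous_intros)

lemma borel_measurable_cjg [measurable]: "(cjg :: 'f::rch \<Rightarrow> 'f) \<in> borel_measurable borel"
  by (intro borel_measurable_continuous_onI continuous_intros)

text \<open>Polarization of the multiplicativity of the norm.\<close>

lemma inner_mult_left_norm: "inner (t * a) (t * b) = (norm t)\<^sup>2 * inner a (b::'f::rch)"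
proof -
  have p: "inner x y = ((norm (x + y))\<^sup>2 - (norm x)\<^sup>2 - (norm y)\<^sup>2) / 2" for x y :: 'f
    by (simp add: power2_norm_eq_inner inner_add_left inner_add_right inner_commute)
  show ?thesis unfolding p distrib_left[symmetric] norm_mult power_mult_distrib by (simp add: algebra_simps)
qed

text \<open>Multiplication by \<open>cjg t\<close> scales inner products by |t|^2, and
  \<open>cjg t * t\<close> is the scalar |t|^2; the factor cancels for t nonzero.\<close>

lemma re_mult: "re (t * u) = inner (cjg t) (u::'f::rch)"
proof (cases "t = 0")
  case True
  then show ?thesis by (simp add: re_def cjg_eq)
next
  case False
  have "(norm t)\<^sup>2 * inner (cjg t) u = inner (cjg t) (cjg t * (t * u))"
    by (simp add: mult.assoc[symmetric] cjg_mult_self)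
  also have "\<dots> = inner (cjg t * 1) (cjg t * (t * u))" by simp
  also have "\<dots> = (norm t)\<^sup>2 * re (t * u)" by (subst inner_mult_left_norm) (simp add: re_def)
  finally show ?thesis using False by simp
qed

lemma inner_cjg_commute: "inner (cjg a) b = inner (cjg b) (a::'f::rch)"
  by (simp add: cjg_eq inner_diff_left inner_commute[of b a])

lemma borel_measurable_cnj [measurable]: "cnj \<in> borel_measurable borel"
  by (intro borel_measurable_continuous_onI continuous_intros)

lemma re_add: "re (x + y) = re x + re y" and re_diff: "re (x - y) = re x - re y"
  and re_minus: "re (- x) = - re x"
  by (simp_all add: re_def inner_add_right inner_diff_right)

definition kk :: "'f::rch^2 \<Rightarrow> 'f^2"
  where "kk x = vec2 (cjg (x$2)) (- cjg (x$1))"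

lemma inner_vec_2: "inner (x::'f::real_inner^2) y = inner (x$1) (y$1) + inner (x$2) (y$2)"
  by (simp add: inner_vec_def sum_2)

lemma inner_kk: "inner (kk x) y = re (x$2 * y$1) - re (x$1 * y$2)"
  by (simp add: inner_vec_2 kk_def re_mult)

lemma inner_kk_antisym: "inner (kk x) y = - inner (kk y) x"
  by (simp add: inner_vec_2 kk_def inner_cjg_commute[of "x$2"] inner_cjg_commute[of "x$1"])

lemma linear_kk: "linear kk"
  by (rule linearI) (simp_all add: kk_def vec_eq_iff forall_2 linear_add[OF linear_cjg] linear_cmul[OF linear_cjg])

lemma norm_kk [simp]: "norm (kk x) = norm x"
  by (simp add: norm_vec_2 kk_def add.commute)

lemma continuous_on_kk [continuous_intros]: "continuous_on S f \<Longrightarrow> continuous_on S (\<lambda>x. kk (f x))"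
  unfolding kk_def by (intro continuous_intros)

lemma borel_measurable_kk [measurable]: "kk \<in> borel_measurable borel"
  by (intro borel_measurable_continuous_onI continuous_intros)

lemma weyl_eq: "weyl = mat2 0 (-1) 1 0"
  by (simp add: weyl_def mat2_eq_iff)

lemma re_hip_weyl: "re (hip (weyl *v y) (vcjg x)) = inner (kk x) y"
proof -
  have "re (cjg a * cjg b) = inner a (cjg b)" for a b :: 'a by (simp add: re_mult)
  then show ?thesis
    by (simp add: hip_def vcjg_def weyl_eq matrix_vector_2 inner_vec_2 kk_def re_def inner_add_right)
       (simp add: inner_commute)
qed

lemma fourier_w_eq: "fourier_w f x = fourier f (kk x)"
  by (simp add: fourier_w_def fourier_def re_hip_weyl ee_def)

lemma fourier_w_schwartz: "f \<in> schwartz \<Longrightarrow> fourier_w f \<in> schwartz"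
  using schwartz_similarity[OF fourier_schwartz linear_kk, of f 1] by (simp add: fourier_w_eq[abs_def])

lemma fourier_w_fourier_w:
  assumes f: "f \<in> schwartz"
  shows "fourier_w (fourier_w f) = f"
proof
  fix x
  have [measurable]: "fourier f \<in> borel_measurable borel" 
    by (intro rapid_measurable schwartz_imp_rapid fourier_schwartz f)
  obtain B where B: "\<forall>x. norm x ^ 0 * cmod (f x) \<le> B" using schwartz_decay[OF f] by blast
  \<comment> \<open>Antisymmetry of the form turns the outer transform into an inverse transform in
    the variable \<open>kk y\<close>.\<close>
  have "fourier_w (fourier_w f) x = (\<integral>y. ee (- inner (kk y) x) * fourier f (kk y) \<partial>lborel)"
    unfolding fourier_w_eq fourier_def[of "fourier_w f"] by (subst inner_kk_antisym) simp
  also have "\<dots> = (\<integral>z. ee (- inner z x) * fourier f z \<partial>lborel)"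
    by (subst integral_similarity[OF linear_kk, of 1]) auto
  also have "\<dots> = f x"
  proof (rule fourier_inversion)
    show "cmod (f y) \<le> B" for y using B by simp
  qed (auto intro: schwartz_continuous rapid_integrable schwartz_imp_rapid fourier_schwartz f)
  finally show "fourier_w (fourier_w f) x = f x" .
qed

lemma fourier_w_add: "integrable lborel f \<Longrightarrow> integrable lborel g \<Longrightarrow>
    fourier_w (\<lambda>x. f x + g x) = (\<lambda>x. fourier_w f x + fourier_w g x)"
  by (simp add: fourier_w_eq[abs_def] fourier_def distrib_left integrable_ee_mult)

lemma fourier_w_cmult: "fourier_w (\<lambda>x. c * f x) = (\<lambda>x. c * fourier_w f x)"
  by (simp add: fourier_w_eq[abs_def] fourier_def mult.left_commute)

text \<open>Fubini moves the transform from f onto \<open>fourier_w k\<close>, and transforming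
  twice returns k. Keeping f merely integrable allows it to be a translate under SL(2,F)
  later.\<close>

lemma plancherel_w:
  assumes f: "integrable lborel f" and k: "k \<in> schwartz"
  shows "(\<integral>x. cnj (fourier_w f x) * fourier_w k x \<partial>lborel) = (\<integral>x. cnj (f x) * k x \<partial>lborel)"
proof -
  have [measurable]: "f \<in> borel_measurable borel" "k \<in> borel_measurable borel" "fourier_w k \<in> borel_measurable borel"
    using f k by (auto intro: rapid_measurable schwartz_imp_rapid fourier_w_schwartz)
  have Fk: "integrable lborel (fourier_w k)" by (intro rapid_integrable schwartz_imp_rapid fourier_w_schwartz k)
  define h where "h x y = cnj (f y) * (ee (inner (kk y) x) * fourier_w k x)" for x y
  have hm: "case_prod h \<in> borel_measurable (lborel \<Otimes>\<^sub>M lborel)" unfolding h_def by measurable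
  have "integrable (lborel \<Otimes>\<^sub>M lborel) (case_prod h)"
    by (rule lborel_pair.integrable_pair_bound[OF integrable_norm[OF Fk] integrable_norm[OF f]])
      (auto simp: hm, simp add: h_def norm_mult)
  note Fub = lborel_pair.Fubini_integral[OF this]
  have "(\<integral>x. cnj (fourier_w f x) * fourier_w k x \<partial>lborel) = (\<integral>x. (\<integral>y. h x y \<partial>lborel) \<partial>lborel)"
  proof (rule Bochner_Integration.integral_cong[OF refl])
    fix x
    have "cnj (fourier_w f x) = (\<integral>y. cnj (ee (inner (kk x) y) * f y) \<partial>lborel)"
      unfolding fourier_w_eq fourier_def by (rule Bochner_Integration.integral_cnj[symmetric])
    also have "\<dots> = (\<integral>y. ee (inner (kk y) x) * cnj (f y) \<partial>lborel)"
      using inner_kk_antisym[of x] by simp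
    finally have "cnj (fourier_w f x) * fourier_w k x = (\<integral>y. ee (inner (kk y) x) * cnj (f y) \<partial>lborel) * fourier_w k x" by simp
    also have "\<dots> = (\<integral>y. ee (inner (kk y) x) * cnj (f y) * fourier_w k x \<partial>lborel)" by simp
    finally show "cnj (fourier_w f x) * fourier_w k x = (\<integral>y. h x y \<partial>lborel)"
      by (simp add: h_def mult_ac)
  qed
  also have "\<dots> = (\<integral>y. (\<integral>x. h x y \<partial>lborel) \<partial>lborel)" by (rule Fub[symmetric])
  also have "\<dots> = (\<integral>y. cnj (f y) * fourier_w (fourier_w k) y \<partial>lborel)"
    by (simp add: h_def fourier_w_eq[of "fourier_w k"] fourier_def)
  finally show ?thesis by (simp add: fourier_w_fourier_w[OF k])
qed

section \<open>Dilations and their effect on the pairing\<close>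

lemma linear_rsmult: "linear (\<lambda>x::'f::rch^2. rsmult x \<alpha>)"
  by (rule linearI) (simp_all add: rsmult_def vec_eq_iff distrib_right)

lemma norm_rsmult: "norm (rsmult x \<alpha>) = norm \<alpha> * norm (x::'f::rch^2)"
  unfolding norm_vec_2 rsmult_def
  by (simp add: norm_mult power_mult_distrib distrib_left[symmetric] real_sqrt_mult mult.commute)

lemma rsmult_rsmult: "rsmult (rsmult x a) b = rsmult x (a * b)"
  by (simp add: rsmult_def mult.assoc)

lemma rsmult_1 [simp]: "rsmult x 1 = x"
  by (simp add: rsmult_def)

lemma rsmult_nth [simp]: "rsmult x a $ i = x $ i * a"
  by (simp add: rsmult_def)

lemma continuous_on_rsmult [continuous_intros]:
  fixes f :: "'a::topological_space \<Rightarrow> 'f::rch^2"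
  assumes "continuous_on S f" "continuous_on S g"
  shows "continuous_on S (\<lambda>x. rsmult (f x) (g x))"
  unfolding rsmult_def using assms by (intro continuous_on_vec_lambda continuous_intros)

lemma borel_measurable_rsmult [measurable (raw)]:
  fixes f :: "'a \<Rightarrow> 'f::rch^2"
  assumes "f \<in> borel_measurable M" "g \<in> borel_measurable M"
  shows "(\<lambda>x. rsmult (f x) (g x)) \<in> borel_measurable M"
  by (rule borel_measurable_continuous_Pair[OF assms, of rsmult]) (auto intro!: continuous_intros simp: split_beta)

lemma schwartz_rsmult: "f \<in> schwartz \<Longrightarrow> \<alpha> \<noteq> 0 \<Longrightarrow> (\<lambda>x. f (rsmult x \<alpha>)) \<in> schwartz"
  by (rule schwartz_similarity[OF _ linear_rsmult, of f "norm \<alpha>"]) (auto simp: norm_rsmult)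

text \<open>Commutativity moves \<alpha> across the form. The exponent is the real dimension 2d of
  F^2, from the substitution of y\<alpha> for y.\<close>

lemma fourier_w_rsmult:
  fixes k :: "'f::rch^2 \<Rightarrow> complex"
  assumes comm: "\<And>x y::'f. x * y = y * x" and [measurable]: "k \<in> borel_measurable borel" and a: "\<alpha> \<noteq> 0"
  shows "fourier_w k (rsmult x \<alpha>) = complex_of_real (1 / norm \<alpha> ^ (2 * DIM('f))) * fourier_w (\<lambda>y. k (rsmult y (inverse \<alpha>))) x"
proof -
  define G where "G y = ee (inner (kk x) y) * k (rsmult y (inverse \<alpha>))" for y
  have [measurable]: "G \<in> borel_measurable borel" unfolding G_def by measurable
  have B: "inner (kk (rsmult x \<alpha>)) y = inner (kk x) (rsmult y \<alpha>)" for y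
    unfolding inner_kk by (simp add: mult.assoc comm[of \<alpha>])
  have "fourier_w k (rsmult x \<alpha>) = (\<integral>y. G (rsmult y \<alpha>) \<partial>lborel)"
    unfolding fourier_w_eq fourier_def G_def using a by (simp add: B rsmult_rsmult)
  also have "\<dots> = (1 / norm \<alpha> ^ DIM('f^2)) *\<^sub>R (\<integral>y. G y \<partial>lborel)"
    by (rule integral_similarity[OF linear_rsmult]) (use a in \<open>auto simp: norm_rsmult\<close>)
  finally show ?thesis
    by (simp add: G_def fourier_w_eq fourier_def scaleR_conv_of_real)
qed

lemma pairing_fourier_w:
  fixes f k :: "'f::rch^2 \<Rightarrow> complex"
  assumes comm: "\<And>x y::'f. x * y = y * x"
    and f: "integrable lborel f" and k: "k \<in> schwartz" and a: "\<alpha> \<noteq> 0"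
  shows "pairing (fourier_w f) (fourier_w k) \<alpha> = pairing f k (inverse \<alpha>)"
proof -
  define k' where "k' y = k (rsmult y (inverse \<alpha>))" for y
  have k': "k' \<in> schwartz" unfolding k'_def by (rule schwartz_rsmult) (use k a in auto)
  have [measurable]: "k \<in> borel_measurable borel" by (intro rapid_measurable schwartz_imp_rapid k)
  have "pairing (fourier_w f) (fourier_w k) \<alpha> = norm \<alpha> ^ DIM('f) * (\<integral>x. complex_of_real (1 / norm \<alpha> ^ (2 * DIM('f))) * (cnj (fourier_w f x) * fourier_w k' x) \<partial>lborel)"
    unfolding pairing_def k'_def by (subst fourier_w_rsmult[OF comm _ a]) (auto simp: mult_ac)
  also have "\<dots> = norm \<alpha> ^ DIM('f) * (complex_of_real (1 / norm \<alpha> ^ (2 * DIM('f))) * (\<integral>x. cnj (f x) * k' x \<partial>lborel))"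
    by (subst integral_mult_right_zero, subst plancherel_w[OF f k']) simp
  also have "\<dots> = complex_of_real (norm \<alpha> ^ DIM('f) * (1 / norm \<alpha> ^ (2 * DIM('f)))) * (\<integral>x. cnj (f x) * k' x \<partial>lborel)"
    by simp
  \<comment> \<open>The factor |\<alpha>|^d of the pairing meets the Jacobian |\<alpha>|^(-2d); what
    is left is |\<alpha>^-1|^d, the factor of the pairing at the inverse.\<close>
  also have "norm \<alpha> ^ DIM('f) * (1 / norm \<alpha> ^ (2 * DIM('f))) = norm (inverse \<alpha>) ^ DIM('f)"
    using a by (simp only: norm_inverse) (simp add: power_add[symmetric] mult_2_right power_inverse field_simps)
  finally show ?thesis by (simp add: pairing_def k'_def)
qed

text \<open>On SL(2,F) with F commutative this is the inverse. While \<open>matrix_inv\<close> is a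
  choice, this is linear in the entries, hence continuous and measurable on all matrices.\<close>

definition adj2 :: "'f::ring_1^2^2 \<Rightarrow> 'f^2^2"
  where "adj2 g = mat2 (g$2$2) (- g$1$2) (- g$2$1) (g$1$1)"

lemma adj2_nth [simp]:
  "adj2 g $ 1 $ 1 = g$2$2" "adj2 g $ 1 $ 2 = - g$1$2" "adj2 g $ 2 $ 1 = - g$2$1" "adj2 g $ 2 $ 2 = g$1$1"
  by (simp_all add: adj2_def)

lemma adj2_adj2 [simp]: "adj2 (adj2 g) = g"
  by (simp add: mat2_eq_iff)

lemma continuous_on_adj2 [continuous_intros]:
  fixes f :: "'a::topological_space \<Rightarrow> 'f::{euclidean_space,real_normed_algebra_1}^2^2"
  assumes "continuous_on S f"
  shows "continuous_on S (\<lambda>x. adj2 (f x))"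
  unfolding adj2_def mat2_def using assms by (intro continuous_intros)

lemma borel_measurable_adj2 [measurable]:
  "(adj2 :: 'f::{euclidean_space,real_normed_algebra_1}^2^2 \<Rightarrow> _) \<in> borel_measurable borel"
  by (intro borel_measurable_continuous_onI continuous_intros)

context
  assumes comm: "\<And>x y::'f::rch. x * y = y * x"
begin

lemma mem_SL2_iff: "(g::'f^2^2) \<in> SL2 \<longleftrightarrow> g$1$1 * g$2$2 - g$1$2 * g$2$1 = 1"
  using comm by (simp add: SL2_def det2_def)

lemma adj2_SL2: "(g::'f^2^2) \<in> SL2 \<Longrightarrow> adj2 g \<in> SL2"
  by (simp add: mem_SL2_iff comm[of "g$2$2" "g$1$1"])

lemma adj2_mult_SL2:
  assumes "(g::'f^2^2) \<in> SL2"
  shows "adj2 g ** g = mat 1" "g ** adj2 g = mat 1"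
proof -
  have "g$1$1 * g$2$2 - g$1$2 * g$2$1 = 1" using assms by (simp add: mem_SL2_iff)
  then show "adj2 g ** g = mat 1" "g ** adj2 g = mat 1"
    unfolding mat2_eq_iff matrix_matrix_2
    by (simp_all add: mat_def comm[of "g$2$2" "g$1$1"] comm[of "g$2$2" "g$1$2"] comm[of "g$2$2" "g$2$1"]
        comm[of "g$2$1" "g$1$2"] comm[of "g$2$1" "g$1$1"] comm[of "g$1$2" "g$1$1"])
qed

lemma matrix_inv_SL2:
  assumes "(g::'f^2^2) \<in> SL2"
  shows "matrix_inv g = adj2 g"
proof -
  have "g ** matrix_inv g = mat 1 \<and> matrix_inv g ** g = mat 1"
    unfolding matrix_inv_def by (rule someI[of _ "adj2 g"]) (simp add: adj2_mult_SL2[OF assms])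
  then show ?thesis
    by (metis adj2_mult_SL2(1)[OF assms] matrix_mul_assoc matrix_mul_lid matrix_mul_rid)
qed

lemma adj2_mv_SL2:
  assumes "(g::'f^2^2) \<in> SL2"
  shows "adj2 g *v (g *v x) = x" "g *v (adj2 g *v x) = x"
  by (simp_all add: matrix_vector_mul_assoc adj2_mult_SL2[OF assms])

lemma preserves_lborel_SL2: "(g::'f^2^2) \<in> SL2 \<Longrightarrow> preserves_lborel g"
  by (rule preserves_lborel_det_1[OF comm]) (simp add: mem_SL2_iff)

text \<open>The adjugate is the adjoint of g for the symplectic form, whatever the determinant. For
  determinant one this is invariance of the form.\<close>

lemma inner_kk_adj2: "inner (kk (adj2 g *v x)) y = inner (kk x) ((g::'f^2^2) *v y)"
proof -
  have e: "a * b * c = b * (a * c)" for a b c :: 'f by (metis comm mult.assoc)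
  show ?thesis
    unfolding inner_kk matrix_vector_2 
    by (simp add: distrib_left distrib_right left_diff_distrib re_add re_diff re_minus
        e[of "g$1$1"] e[of "g$1$2"] e[of "g$2$1"] e[of "g$2$2"])
qed

lemma fourier_w_adj2:
  fixes f :: "'f^2 \<Rightarrow> complex"
  assumes g: "g \<in> SL2" and [measurable]: "f \<in> borel_measurable borel"
  shows "fourier_w (\<lambda>x. f (adj2 g *v x)) x = fourier_w f (adj2 g *v x)"
proof -
  define H where "H y = ee (inner (kk x) y) * f (adj2 g *v y)" for y
  have [measurable]: "H \<in> borel_measurable borel" unfolding H_def by measurable
  have "fourier_w (\<lambda>x. f (adj2 g *v x)) x = (\<integral>y. H y \<partial>lborel)"
    by (simp add: fourier_w_eq fourier_def H_def)
  also have "\<dots> = (\<integral>y. H (g *v y) \<partial>lborel)"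
    by (rule integral_preserves_lborel[OF preserves_lborel_SL2[OF g], symmetric]) measurable
  also have "\<dots> = fourier_w f (adj2 g *v x)"
    by (simp add: H_def fourier_w_eq fourier_def inner_kk_adj2 adj2_mv_SL2[OF g])
  finally show ?thesis .
qed

end

section \<open>Functions with compact support\<close>

text \<open>S and the complement of the compact support are open and cover the space.\<close>

lemma Cc_continuous:
  fixes f :: "'x::t2_space \<Rightarrow> complex"
  assumes f: "f \<in> Cc S" and S: "open S"
  shows "continuous_on UNIV f"
proof -
  obtain K where K: "K \<subseteq> S" "compact K" "\<And>x. x \<notin> K \<Longrightarrow> f x = 0" and c: "continuous_on S f"
    using f by (auto simp: Cc_def)
  have "continuous_on (- K) f \<longleftrightarrow> continuous_on (- K) (\<lambda>_. 0 :: complex)" by (rule continuous_on_cong) (use K in auto)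
  then have "continuous_on (- K) f" by simp
  then have "continuous_on (S \<union> - K) f"
    using c S compact_imp_closed[OF K(2)] by (intro continuous_on_open_Un) auto
  moreover have "S \<union> - K = UNIV" using K(1) by blast
  ultimately show ?thesis by simp
qed

lemma Cc_rapid:
  fixes f :: "'v::euclidean_space \<Rightarrow> complex"
  assumes f: "f \<in> Cc S" and S: "open S"
  shows "f \<in> rapid"
  unfolding rapid_def
proof (intro CollectI conjI allI)
  have c: "continuous_on UNIV f" using f S by (rule Cc_continuous)
  then show "f \<in> borel_measurable borel" by (rule borel_measurable_continuous_onI)
  fix M
  obtain K where K: "compact K" "\<And>x. x \<notin> K \<Longrightarrow> f x = 0" using f by (auto simp: Cc_def)
  have "continuous_on K (\<lambda>x. cmod (f x) * (1 + (norm x)\<^sup>2) ^ M)"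
    by (intro continuous_intros continuous_on_subset[OF c]) auto
  then have "bounded ((\<lambda>x. cmod (f x) * (1 + (norm x)\<^sup>2) ^ M) ` K)"
    using K(1) by (intro compact_imp_bounded compact_continuous_image)
  then obtain B where B: "\<And>x. x \<in> K \<Longrightarrow> cmod (f x) * (1 + (norm x)\<^sup>2) ^ M \<le> B"
    unfolding bounded_iff by fastforce
  have "cmod (f x) \<le> max B 0 * wt M x" for x
  proof (cases "x \<in> K")
    case True
    have "(1 + (norm x)\<^sup>2) ^ M > 0" by (simp add: add_pos_nonneg)
    then show ?thesis using B[OF True] by (simp add: wt_def pos_le_divide_eq)
  qed (use K in simp)
  then show "\<exists>C. \<forall>x. cmod (f x) \<le> C * wt M x" by blast
qed

text \<open>|x| + 1/|x| is continuous and proper on the complement of 0, so these functions have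
  compact support there and increase to 1. Continuity is all that \<open>CcV\<close> and
  \<open>CcL\<close> ask for.\<close>

definition cutoff :: "nat \<Rightarrow> 'a::real_normed_vector \<Rightarrow> real"
  where "cutoff n x = (if x = 0 then 0 else max 0 (min 1 (real n - (norm x + 1 / norm x))))"

lemma cutoff_nonneg [simp]: "0 \<le> cutoff n x" and cutoff_le_1: "cutoff n x \<le> 1"
  by (simp_all add: cutoff_def)

lemma cutoff_tendsto: "x \<noteq> 0 \<Longrightarrow> (\<lambda>n. cutoff n x) \<longlonglongrightarrow> 1"
proof (rule tendsto_eventually)
  assume x: "x \<noteq> 0"
  obtain N where N: "real N \<ge> norm x + 1 / norm x + 1" using real_arch_simple by blast
  show "\<forall>\<^sub>F n in sequentially. cutoff n x = 1"
    using eventually_ge_at_top[of N] by eventually_elim (use N x in \<open>auto simp: cutoff_def min_def max_def\<close>)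
qed

lemma cutoff_Cc:
  fixes f :: "'v::euclidean_space \<Rightarrow> complex"
  assumes f: "continuous_on (- {0}) f"
  shows "(\<lambda>x. complex_of_real (cutoff n x) * f x) \<in> Cc (- {0})"
  unfolding Cc_def
proof (intro CollectI conjI exI)
  have "continuous_on (- {0}) (\<lambda>x::'v. max 0 (min 1 (real n - (norm x + 1 / norm x))))"
    by (intro continuous_intros) auto
  then have "continuous_on (- {0}) (cutoff n :: 'v \<Rightarrow> real)"
    by (rule continuous_on_eq) (auto simp: cutoff_def)
  then show "continuous_on (- {0}) (\<lambda>x. complex_of_real (cutoff n x) * f x)"
    by (intro continuous_intros f)
  define K where "K = {x::'v. 1 / (real n + 1) \<le> norm x \<and> norm x \<le> real n + 1}"
  show "K \<subseteq> - {0}" by (auto simp: K_def)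
  have "closed K" unfolding K_def by (intro closed_Collect_conj closed_Collect_le continuous_intros)
  moreover have "bounded K" unfolding K_def bounded_iff by blast
  ultimately show "compact K" by (simp add: compact_eq_bounded_closed)
  show "\<forall>x. x \<notin> K \<longrightarrow> complex_of_real (cutoff n x) * f x = 0"
  proof (intro allI impI)
    fix x assume x: "x \<notin> K"
    have "norm x + 1 / norm x \<ge> real n" if "x \<noteq> 0"
    proof (cases "norm x \<le> real n + 1")
      case True
      then have "norm x < 1 / (real n + 1)" using x by (auto simp: K_def)
      then have "1 / norm x > real n + 1" using that by (simp add: field_simps)
      then show ?thesis using norm_ge_zero[of x] by linarith
    next
      case False
      moreover have "0 \<le> 1 / norm x" by simp
      ultimately show ?thesis by linarith
    qed
    then show "complex_of_real (cutoff n x) * f x = 0" by (auto simp: cutoff_def)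
  qed
qed

lemma CcL_L1L: "CcL \<subseteq> (L1L :: ('f::rch \<Rightarrow> complex) set)"
proof
  fix \<phi> :: "'f \<Rightarrow> complex" assume phi: "\<phi> \<in> CcL"
  have "(\<lambda>x. (1 / norm x ^ DIM('f)) *\<^sub>R \<phi> x) \<in> CcL"
    using phi unfolding Cc_def
  proof safe
    fix K assume c: "continuous_on (- {0}) \<phi>" and K: "K \<subseteq> - {0}" "compact K" "\<forall>x. x \<notin> K \<longrightarrow> \<phi> x = 0"
    show "continuous_on (- {0}) (\<lambda>x. (1 / norm x ^ DIM('f)) *\<^sub>R \<phi> x)"
      by (intro continuous_intros c) auto
    show "\<exists>K\<subseteq>- {0}. compact K \<and> (\<forall>x. x \<notin> K \<longrightarrow> (1 / norm x ^ DIM('f)) *\<^sub>R \<phi> x = 0)"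
      using K by (intro exI[of _ K]) auto
  qed
  then have "integrable lborel (\<lambda>x. (1 / norm x ^ DIM('f)) *\<^sub>R \<phi> x)"
    by (intro rapid_integrable Cc_rapid[of _ "- {0}"]) auto
  moreover have "\<phi> \<in> borel_measurable borel" 
    using Cc_rapid[OF phi] by (intro rapid_measurable) auto
  ultimately show "\<phi> \<in> L1L" by (simp add: L1L_def integrable_haarL)
qed

section \<open>Estimates for the pairing\<close>

definition W2 :: "'f::rch^2 \<Rightarrow> real"
  where "W2 = wt DIM('f^2)"

lemma W2_nonneg [simp]: "0 \<le> W2 x" and W2_le_1: "W2 x \<le> 1"
  by (simp_all only: W2_def wt_nonneg wt_le_1)

lemma borel_measurable_W2 [measurable]: "W2 \<in> borel_measurable borel"
  unfolding W2_def by measurable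

text \<open>For \<open>|\<alpha>| \<le> 1\<close> the second factor is bounded by \<open>1\<close>; for \<open>|\<alpha>| > 1\<close> the first one is, and the
  substitution \<open>x \<mapsto> x\<alpha>\<close> produces the integrable factor \<open>|\<alpha>|\<^sup>-\<^sup>2\<^sup>d\<close>.\<close>

lemma wt_pair_integrable:
  "integrable (lborel \<Otimes>\<^sub>M lborel) (\<lambda>(\<alpha>, x::'f::rch^2). W2 x * W2 (rsmult x \<alpha>))"
  unfolding W2_def
proof (rule integrableI_nonneg)
  define M where "M = DIM('f^2)"
  define I where "I = (\<integral>\<^sup>+x. ennreal (wt M (x::'f^2)) \<partial>lborel)"
  have I: "I < \<infinity>" unfolding I_def by (rule nn_integral_wt_finite) (simp add: M_def)
  have [measurable]: "cball (0::'f) 1 \<in> sets borel" by simp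
  have m[measurable]: "(\<lambda>(\<alpha>, x::'f^2). wt M x * wt M (rsmult x \<alpha>)) \<in> borel_measurable (lborel \<Otimes>\<^sub>M lborel)"
    by measurable
  then show "(\<lambda>(\<alpha>, x::'f^2). wt DIM('f^2) x * wt DIM('f^2) (rsmult x \<alpha>)) \<in> borel_measurable (lborel \<Otimes>\<^sub>M lborel)"
    by (simp add: M_def)
  have inner: "(\<integral>\<^sup>+x. ennreal (wt M (x::'f^2) * wt M (rsmult x \<alpha>)) \<partial>lborel)
    \<le> indicator (cball 0 1) \<alpha> * I + ennreal (2 ^ DIM('f) * wt DIM('f) \<alpha>) * I" for \<alpha> :: 'f
  proof (cases "norm \<alpha> \<le> 1")
    case True
    have "(\<integral>\<^sup>+x. ennreal (wt M (x::'f^2) * wt M (rsmult x \<alpha>)) \<partial>lborel) \<le> I"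
      unfolding I_def by (intro nn_integral_mono ennreal_leI mult_left_le wt_le_1) simp
    then show ?thesis using True by (simp add: add_increasing2)
  next
    case False
    then have a: "norm \<alpha> > 1" by simp
    have "(\<integral>\<^sup>+x. ennreal (wt M (x::'f^2) * wt M (rsmult x \<alpha>)) \<partial>lborel) \<le> (\<integral>\<^sup>+x. ennreal (wt M (rsmult x \<alpha>)) \<partial>(lborel::('f^2) measure))"
      by (intro nn_integral_mono ennreal_leI mult_left_le_one_le wt_le_1) simp_all
    also have "\<dots> = ennreal (1 / norm \<alpha> ^ DIM('f^2)) * I"
      unfolding I_def by (rule nn_integral_similarity[OF linear_rsmult]) (use a in \<open>auto simp: norm_rsmult\<close>)
    also have "\<dots> \<le> ennreal (2 ^ DIM('f) * wt DIM('f) \<alpha>) * I"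
    proof (intro mult_right_mono ennreal_leI)
      have "1 \<le> (norm \<alpha>)\<^sup>2" using a by simp
      then have "(1 + (norm \<alpha>)\<^sup>2) ^ DIM('f) \<le> (2 * (norm \<alpha>)\<^sup>2) ^ DIM('f)" by (intro power_mono) auto
      also have "\<dots> = 2 ^ DIM('f) * norm \<alpha> ^ DIM('f^2)" by (simp add: power_mult_distrib power_mult[symmetric])
      finally have le: "(1 + (norm \<alpha>)\<^sup>2) ^ DIM('f) \<le> 2 ^ DIM('f) * norm \<alpha> ^ DIM('f^2)" .
      show "1 / norm \<alpha> ^ DIM('f^2) \<le> 2 ^ DIM('f) * wt DIM('f) \<alpha>"
      proof -
        have frac: "1 / X \<le> c * (1 / Y)" if "Y \<le> c * X" "X > 0" "Y > 0" for X Y c :: real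
          using that by (simp add: field_simps)
        show "1 / norm \<alpha> ^ DIM('f^2) \<le> 2 ^ DIM('f) * wt DIM('f) \<alpha>"
          unfolding wt_def by (rule frac[OF le]) (use a in \<open>auto intro!: zero_less_power simp: add_pos_nonneg\<close>)
      qed
    qed simp
    finally show ?thesis by (rule order_trans) simp
  qed
  have "(\<integral>\<^sup>+y. ennreal (case y of (\<alpha>, x::'f^2) \<Rightarrow> wt M x * wt M (rsmult x \<alpha>)) \<partial>(lborel \<Otimes>\<^sub>M lborel))
    = (\<integral>\<^sup>+\<alpha>. (\<integral>\<^sup>+x. ennreal (wt M (x::'f^2) * wt M (rsmult x \<alpha>)) \<partial>lborel) \<partial>lborel)"
    by (subst lborel.nn_integral_fst[symmetric]) auto
  also have "\<dots> \<le> (\<integral>\<^sup>+\<alpha>. indicator (cball 0 1) (\<alpha>::'f) * I + ennreal (2 ^ DIM('f) * wt DIM('f) \<alpha>) * I \<partial>lborel)"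
    by (intro nn_integral_mono inner)
  also have "\<dots> = emeasure lborel (cball (0::'f) 1) * I + (\<integral>\<^sup>+\<alpha>. ennreal (2 ^ DIM('f) * wt DIM('f) (\<alpha>::'f)) \<partial>lborel) * I"
    by (subst nn_integral_add) (auto simp: nn_integral_multc)
  also have "\<dots> < \<infinity>"
  proof -
    have "integrable lborel (\<lambda>\<alpha>::'f. 2 ^ DIM('f) * wt DIM('f) \<alpha>)" by (intro integrable_mult_right integrable_wt) simp
    then have "(\<integral>\<^sup>+\<alpha>. ennreal (2 ^ DIM('f) * wt DIM('f) (\<alpha>::'f)) \<partial>lborel) < \<infinity>"
      by (subst nn_integral_eq_integral) auto
    then show ?thesis using I emeasure_lborel_cball_finite[of "0::'f" 1] by (simp add: ennreal_mult_less_top)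
  qed
  finally show "(\<integral>\<^sup>+y. ennreal (case y of (\<alpha>, x::'f^2) \<Rightarrow> wt DIM('f^2) x * wt DIM('f^2) (rsmult x \<alpha>)) \<partial>(lborel \<Otimes>\<^sub>M lborel)) < \<infinity>"
    by (simp add: M_def)
qed auto

text \<open>The constant is explicit so that all members of a sequence can share one dominating
  function.\<close>

definition wdom :: "real \<Rightarrow> ('f::rch^2 \<Rightarrow> complex) set"
  where "wdom C = {f \<in> borel_measurable borel. \<forall>x. cmod (f x) \<le> C * W2 x}"

lemma wdomD: "f \<in> wdom C \<Longrightarrow> cmod (f x) \<le> C * W2 (x::'f::rch^2)"
  and wdom_measurable: "f \<in> wdom C \<Longrightarrow> f \<in> borel_measurable borel"
  by (auto simp: wdom_def)

lemma wdom_nonneg: "f \<in> wdom C \<Longrightarrow> C \<ge> 0"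
  using wdomD[of f C 0] norm_ge_zero[of "f 0"] by (simp add: W2_def wt_def del: norm_ge_zero)

lemma wdom_bounded: "f \<in> wdom C \<Longrightarrow> cmod (f x) \<le> C"
  using wdomD[of f C x] wdom_nonneg[of f C] W2_le_1[of x]
  by (meson mult_left_le order_trans)

lemma wdom_integrable: "f \<in> wdom C \<Longrightarrow> integrable lborel f"
  by (rule integrable_if_le_wt[OF order_refl]) (auto simp: wdom_def W2_def)

lemma rapid_wdom: "f \<in> rapid \<Longrightarrow> \<exists>C. f \<in> wdom C"
  using rapid_measurable rapid_bound[of f] unfolding wdom_def W2_def by blast

lemma wdom_add: "f \<in> wdom C \<Longrightarrow> g \<in> wdom D \<Longrightarrow> (\<lambda>x. f x + g x) \<in> wdom (C + D)"
  unfolding wdom_def by (auto simp: distrib_right intro!: order_trans[OF norm_triangle_ineq] add_mono)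

lemma wdom_diff: "f \<in> wdom C \<Longrightarrow> g \<in> wdom D \<Longrightarrow> (\<lambda>x. f x - g x) \<in> wdom (C + D)"
  unfolding wdom_def by (auto simp: distrib_right intro!: order_trans[OF norm_triangle_ineq4] add_mono)

lemma modfunsE:
  assumes "f \<in> modfuns"
  obtains g h where "g \<in> CcV" "h \<in> schwartz" "f = (\<lambda>x. g x + h x)"
  using assms unfolding modfuns_def by blast

lemma modfunsI: "g \<in> CcV \<Longrightarrow> h \<in> schwartz \<Longrightarrow> f = (\<lambda>x. g x + h x) \<Longrightarrow> f \<in> modfuns"
  unfolding modfuns_def by blast

lemma modfuns_wdom: "f \<in> modfuns \<Longrightarrow> \<exists>C. f \<in> wdom C"
proof -
  assume "f \<in> modfuns"
  then obtain g h where gh: "g \<in> CcV" "h \<in> schwartz" and f: "f = (\<lambda>x. g x + h x)" by (rule modfunsE)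
  obtain C where C: "g \<in> wdom C" using rapid_wdom[OF Cc_rapid[OF gh(1)]] by auto
  obtain D where D: "h \<in> wdom D" using rapid_wdom[OF schwartz_imp_rapid[OF gh(2)]] by auto
  show ?thesis unfolding f using wdom_add[OF C D] by blast
qed

lemma modfuns_continuous: "f \<in> modfuns \<Longrightarrow> continuous_on UNIV f"
  by (elim modfunsE) (auto intro!: continuous_on_add intro: schwartz_continuous Cc_continuous[of _ "- {0}"])

lemma zero_Cc: "(\<lambda>x. 0) \<in> Cc S"
  unfolding Cc_def by (auto intro!: exI[of _ "{}"])

lemma CcV_modfuns: "f \<in> CcV \<Longrightarrow> f \<in> modfuns"
  by (rule modfunsI[OF _ zero_schwartz]) auto

lemma schwartz_modfuns: "f \<in> schwartz \<Longrightarrow> f \<in> modfuns"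
  by (rule modfunsI[OF zero_Cc]) auto

lemma Cc_add:
  assumes "f \<in> Cc S" "g \<in> Cc S" shows "(\<lambda>x. f x + g x) \<in> Cc S"
proof -
  obtain K K' where "K \<subseteq> S" "compact K" "\<forall>x. x \<notin> K \<longrightarrow> f x = 0" "K' \<subseteq> S" "compact K'" "\<forall>x. x \<notin> K' \<longrightarrow> g x = 0"
    using assms by (auto simp: Cc_def)
  then show ?thesis using assms
    by (auto simp: Cc_def intro!: continuous_intros exI[of _ "K \<union> K'"])
qed

lemma Cc_cmult: "f \<in> Cc S \<Longrightarrow> (\<lambda>x. c * f x) \<in> Cc S"
  unfolding Cc_def by (auto intro!: continuous_intros)

lemma modfuns_add:
  assumes "f \<in> modfuns" "g \<in> modfuns" shows "(\<lambda>x. f x + g x) \<in> modfuns"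
proof -
  obtain u v u' v' where *: "u \<in> CcV" "v \<in> schwartz" "f = (\<lambda>x. u x + v x)" "u' \<in> CcV" "v' \<in> schwartz" "g = (\<lambda>x. u' x + v' x)"
    using assms by (elim modfunsE) blast
  have "(\<lambda>x. f x + g x) = (\<lambda>x. (u x + u' x) + (v x + v' x))" using * by auto
  then show ?thesis by (rule modfunsI[OF Cc_add[OF *(1,4)] schwartz_add[OF *(2,5)]])
qed

lemma modfuns_cmult: "f \<in> modfuns \<Longrightarrow> (\<lambda>x. c * f x) \<in> modfuns"
proof -
  assume "f \<in> modfuns"
  then obtain u v where *: "u \<in> CcV" "v \<in> schwartz" "f = (\<lambda>x. u x + v x)"
    by (rule modfunsE)
  have "(\<lambda>x. c * f x) = (\<lambda>x. c * u x + c * v x)" using * by (auto simp: distrib_left)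
  then show ?thesis by (rule modfunsI[OF Cc_cmult[OF *(1)] schwartz_cmult[OF *(2)]])
qed

lemma modfuns_diff: "f \<in> modfuns \<Longrightarrow> g \<in> modfuns \<Longrightarrow> (\<lambda>x. f x - g x) \<in> modfuns"
  using modfuns_add[OF _ modfuns_cmult[of g "-1"], of f] by simp

lemma pair_bound:
  fixes f g :: "'f::rch^2 \<Rightarrow> complex"
  assumes "f \<in> wdom C" "g \<in> wdom D"
  shows "cmod (f x) * cmod (g (rsmult x \<alpha>)) \<le> C * D * (W2 x * W2 (rsmult x \<alpha>))"
proof -
  have "cmod (f x) * cmod (g (rsmult x \<alpha>)) \<le> (C * W2 x) * (D * W2 (rsmult x \<alpha>))"
    using assms wdom_nonneg[OF assms(1)] by (intro mult_mono wdomD mult_nonneg_nonneg) auto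
  then show ?thesis by (simp add: mult_ac)
qed

lemma pairing_integrand_integrable:
  fixes f g :: "'f::rch^2 \<Rightarrow> complex"
  assumes f: "f \<in> wdom C" and g: "g \<in> wdom D"
  shows "integrable (lborel \<Otimes>\<^sub>M lborel) (\<lambda>(\<alpha>, x). cnj (f x) * g (rsmult x \<alpha>))"
proof -
  note [measurable] = wdom_measurable[OF f] wdom_measurable[OF g]
  show ?thesis
  proof (rule Bochner_Integration.integrable_bound)
    show "integrable (lborel \<Otimes>\<^sub>M lborel) (\<lambda>y. C * D * (case y of (\<alpha>, x::'f^2) \<Rightarrow> W2 x * W2 (rsmult x \<alpha>)))"
      by (intro integrable_mult_right wt_pair_integrable)
    show "AE y in lborel \<Otimes>\<^sub>M lborel. norm (case y of (\<alpha>, x) \<Rightarrow> cnj (f x) * g (rsmult x \<alpha>)) \<le> norm (C * D * (case y of (\<alpha>, x::'f^2) \<Rightarrow> W2 x * W2 (rsmult x \<alpha>)))"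
      by (intro AE_I2) (auto simp: norm_mult intro!: order_trans[OF pair_bound[OF f g] abs_ge_self[THEN order_trans]] simp: abs_mult)
  qed measurable
qed

lemma pairing_measurable:
  fixes f g :: "'f::rch^2 \<Rightarrow> complex"
  assumes [measurable]: "f \<in> borel_measurable borel" "g \<in> borel_measurable borel"
  shows "pairing f g \<in> borel_measurable borel"
  unfolding pairing_def by measurable

text \<open>The factor |\<alpha>|^d of the pairing cancels the density of Haar measure, so the L^1
  norm is controlled by a Lebesgue integral over F \<times> F^2.\<close>

lemma pairing_L1L:
  fixes f g :: "'f::rch^2 \<Rightarrow> complex"
  assumes f: "f \<in> wdom C" and g: "g \<in> wdom D"
  shows "pairing f g \<in> L1L"
    and "(\<integral>l. cmod (pairing f g l) \<partial>haarL) \<le> (\<integral>(\<alpha>, x). cmod (f x) * cmod (g (rsmult x \<alpha>)) \<partial>(lborel \<Otimes>\<^sub>M lborel))"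
proof -
  note [measurable] = wdom_measurable[OF f] wdom_measurable[OF g]
  define P where "P \<alpha> = (\<integral>x. cnj (f x) * g (rsmult x \<alpha>) \<partial>lborel)" for \<alpha>
  have [measurable]: "pairing f g \<in> borel_measurable borel" by (rule pairing_measurable) measurable
  have P: "AE \<alpha> in lborel. (1 / norm \<alpha> ^ DIM('f)) *\<^sub>R pairing f g \<alpha> = P \<alpha>"
    using AE_lborel_singleton[of 0] by eventually_elim (simp add: pairing_def P_def scaleR_conv_of_real)
  have [measurable]: "P \<in> borel_measurable borel" unfolding P_def by measurable
  note i = pairing_integrand_integrable[OF f g]
  have iP: "integrable lborel P"
    using lborel_pair.integrable_fst'[OF i] by (simp add: P_def[abs_def])
  have "integrable lborel (\<lambda>\<alpha>. (1 / norm \<alpha> ^ DIM('f)) *\<^sub>R pairing f g \<alpha>)"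
    by (rule integrable_cong_AE_imp[OF iP]) (use P in \<open>auto elim: eventually_mono\<close>)
  then show "pairing f g \<in> L1L" by (simp add: L1L_def integrable_haarL)
  have "(\<integral>l. cmod (pairing f g l) \<partial>haarL) = (\<integral>\<alpha>. cmod ((1 / norm \<alpha> ^ DIM('f)) *\<^sub>R pairing f g \<alpha>) \<partial>lborel)"
    by (subst integral_haarL) auto
  also have "\<dots> = (\<integral>\<alpha>. cmod (P \<alpha>) \<partial>lborel)"
  proof (rule integral_cong_AE)
    show "AE \<alpha> in lborel. cmod ((1 / norm \<alpha> ^ DIM('f)) *\<^sub>R pairing f g \<alpha>) = cmod (P \<alpha>)"
      using P by eventually_elim (rule arg_cong)
  qed measurable
  also have "\<dots> \<le> (\<integral>\<alpha>. (\<integral>x. cmod (cnj (f x) * g (rsmult x \<alpha>)) \<partial>lborel) \<partial>lborel)"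
  proof (rule integral_mono)
    show "integrable lborel (\<lambda>\<alpha>. cmod (P \<alpha>))" using iP by simp
    show "integrable lborel (\<lambda>\<alpha>. \<integral>x. cmod (cnj (f x) * g (rsmult x \<alpha>)) \<partial>lborel)"
      using lborel_pair.integrable_fst'[OF integrable_norm[OF i]] by simp
  qed (simp add: P_def integral_norm_bound)
  also have "\<dots> = (\<integral>(\<alpha>, x). cmod (cnj (f x) * g (rsmult x \<alpha>)) \<partial>(lborel \<Otimes>\<^sub>M lborel))"
    using lborel_pair.integral_fst'[OF integrable_norm[OF i]] by (simp add: case_prod_unfold)
  finally show "(\<integral>l. cmod (pairing f g l) \<partial>haarL) \<le> (\<integral>(\<alpha>, x). cmod (f x) * cmod (g (rsmult x \<alpha>)) \<partial>(lborel \<Otimes>\<^sub>M lborel))"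
    by (simp add: norm_mult)
qed

text \<open>Convergence is asked for off the origin only, because the cutoffs vanish at 0. The
  second sequence has to stay under a common weight but need not converge.\<close>

lemma pairing_L1_tendsto_0:
  fixes f g :: "nat \<Rightarrow> 'f::rch^2 \<Rightarrow> complex"
  assumes f: "\<And>n. f n \<in> wdom C" and g: "\<And>n. g n \<in> wdom D"
    and lim: "\<And>x. x \<noteq> 0 \<Longrightarrow> (\<lambda>n. f n x) \<longlonglongrightarrow> 0"
  shows "(\<lambda>n. \<integral>l. cmod (pairing (f n) (g n) l) \<partial>haarL) \<longlonglongrightarrow> 0"
proof -
  note [measurable] = wdom_measurable[OF f] wdom_measurable[OF g]
  have "(\<lambda>n. \<integral>(\<alpha>, x). cmod (f n x) * cmod (g n (rsmult x \<alpha>)) \<partial>(lborel \<Otimes>\<^sub>M lborel)) \<longlonglongrightarrow> (\<integral>(\<alpha>::'f, x::'f^2). 0 \<partial>(lborel \<Otimes>\<^sub>M lborel))"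
  proof (rule integral_dominated_convergence)
    show "integrable (lborel \<Otimes>\<^sub>M lborel) (\<lambda>y. C * D * (case y of (\<alpha>, x::'f^2) \<Rightarrow> W2 x * W2 (rsmult x \<alpha>)))"
      by (intro integrable_mult_right wt_pair_integrable)
    show "AE y in lborel \<Otimes>\<^sub>M lborel. norm (case y of (\<alpha>, x) \<Rightarrow> cmod (f n x) * cmod (g n (rsmult x \<alpha>))) \<le> C * D * (case y of (\<alpha>, x::'f^2) \<Rightarrow> W2 x * W2 (rsmult x \<alpha>))" for n
      by (intro AE_I2) (auto intro!: pair_bound[OF f g])
    have "AE y in (lborel :: 'f measure) \<Otimes>\<^sub>M (lborel :: ('f^2) measure). snd y \<noteq> 0"
    proof (rule lborel_pair.AE_pair_measure)
      show "{y \<in> space ((lborel :: 'f measure) \<Otimes>\<^sub>M (lborel :: ('f^2) measure)). snd y \<noteq> 0} \<in> sets (lborel \<Otimes>\<^sub>M lborel)"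
        by measurable
      show "AE x in lborel :: 'f measure. AE y in lborel. snd (x, y :: 'f^2) \<noteq> 0"
        using AE_lborel_singleton[of "0::'f^2"] by simp
    qed
    then show "AE y in lborel \<Otimes>\<^sub>M lborel. (\<lambda>n. case y of (\<alpha>, x) \<Rightarrow> cmod (f n x) * cmod (g n (rsmult x \<alpha>))) \<longlonglongrightarrow> (case y of (\<alpha>::'f, x::'f^2) \<Rightarrow> 0)"
    proof eventually_elim
      fix y :: "'f \<times> ('f^2)" assume "snd y \<noteq> 0"
      moreover obtain \<alpha> x where y: "y = (\<alpha>, x)" by (cases y)
      ultimately have x: "(\<lambda>n. cmod (f n x) * D) \<longlonglongrightarrow> 0 * D" by (intro tendsto_mult tendsto_const tendsto_norm_zero lim) simp
      show "(\<lambda>n. case y of (\<alpha>, x) \<Rightarrow> cmod (f n x) * cmod (g n (rsmult x \<alpha>))) \<longlonglongrightarrow> (case y of (\<alpha>::'f, x::'f^2) \<Rightarrow> 0)"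
        unfolding y prod.case
        by (rule tendsto_sandwich[OF _ _ tendsto_const x[simplified]])
          (auto intro!: always_eventually mult_left_mono wdom_bounded[OF g])
    qed
  qed measurable
  then have lim0: "(\<lambda>n. \<integral>(\<alpha>, x). cmod (f n x) * cmod (g n (rsmult x \<alpha>)) \<partial>(lborel \<Otimes>\<^sub>M lborel)) \<longlonglongrightarrow> 0"
    by (simp add: case_prod_unfold)
  show ?thesis
    by (rule tendsto_sandwich[OF _ _ tendsto_const lim0])
      (auto intro!: always_eventually pairing_L1L(2)[OF f g] integral_nonneg_AE)
qed

text \<open>Continuity is wanted because the twist is prescribed on continuous functions and is
  extended by \<open>tw_j_L1L\<close> to those continuous off 0.\<close>

lemma pairing_continuous:
  fixes f k :: "'f::rch^2 \<Rightarrow> complex"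
  assumes f: "integrable lborel f" and k: "continuous_on UNIV k" and B: "\<And>x. cmod (k x) \<le> B"
  shows "continuous_on UNIV (pairing f k)"
proof -
  have [measurable]: "f \<in> borel_measurable borel" "k \<in> borel_measurable borel"
    using f k by (auto intro: borel_measurable_continuous_onI)
  have "continuous_on UNIV (\<lambda>\<alpha>. \<integral>x. cnj (f x) * k (rsmult x \<alpha>) \<partial>lborel)"
    unfolding continuous_on_sequentially
  proof (intro allI ballI impI, elim conjE)
    fix u :: "nat \<Rightarrow> 'f" and a assume u: "u \<longlonglongrightarrow> a"
    show "((\<lambda>\<alpha>. \<integral>x. cnj (f x) * k (rsmult x \<alpha>) \<partial>lborel) \<circ> u) \<longlonglongrightarrow> (\<integral>x. cnj (f x) * k (rsmult x a) \<partial>lborel)"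
      unfolding o_def
    proof (rule integral_dominated_convergence[where w="\<lambda>x. B * cmod (f x)"])
      show "integrable lborel (\<lambda>x. B * cmod (f x))" using f by simp
      show "AE x in lborel. (\<lambda>n. cnj (f x) * k (rsmult x (u n))) \<longlonglongrightarrow> cnj (f x) * k (rsmult x a)"
      proof (rule AE_I2)
        fix x
        have "continuous_on UNIV (\<lambda>\<alpha>. k (rsmult x \<alpha>))"
          by (rule continuous_on_compose2[OF k]) (auto intro!: continuous_intros)
        then have "(\<lambda>n. k (rsmult x (u n))) \<longlonglongrightarrow> k (rsmult x a)"
          by (rule continuous_on_tendsto_compose[OF _ u]) auto
        then show "(\<lambda>n. cnj (f x) * k (rsmult x (u n))) \<longlonglongrightarrow> cnj (f x) * k (rsmult x a)" by (intro tendsto_intros)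
      qed
      show "AE x in lborel. cmod (cnj (f x) * k (rsmult x (u n))) \<le> B * cmod (f x)" for n
        using B by (intro AE_I2) (auto simp: norm_mult mult.commute[of B] intro!: mult_left_mono)
    qed measurable
  qed
  then show ?thesis unfolding pairing_def by (intro continuous_intros)
qed

section \<open>The norm of the group algebra of \<open>L\<close>\<close>

lemma L1L_measurable: "\<phi> \<in> L1L \<Longrightarrow> \<phi> \<in> borel_measurable borel"
  by (auto simp: L1L_def)

lemma L1L_cmult: "\<phi> \<in> L1L \<Longrightarrow> (\<lambda>x. c * \<phi> x) \<in> L1L"
  and L1L_diff: "\<phi> \<in> L1L \<Longrightarrow> \<psi> \<in> L1L \<Longrightarrow> (\<lambda>x. \<phi> x - \<psi> x) \<in> L1L"
  by (auto simp: L1L_def)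

text \<open>Ensures that the supremum defining \<open>cstar_normL\<close> is over a nonempty
  set.\<close>

lemma zero_cstar_seminormsL: "(\<lambda>_. 0) \<in> cstar_seminormsL"
  unfolding cstar_seminormsL_def by (auto intro!: integral_nonneg_AE)

lemma cstar_normL_le: "\<phi> \<in> L1L \<Longrightarrow> cstar_normL \<phi> \<le> (\<integral>l. cmod (\<phi> l) \<partial>haarL)"
  unfolding cstar_normL_def using zero_cstar_seminormsL
  by (intro cSUP_least) (auto simp: cstar_seminormsL_def)

lemma cstar_normL_ge: "\<phi> \<in> L1L \<Longrightarrow> q \<in> cstar_seminormsL \<Longrightarrow> q \<phi> \<le> cstar_normL \<phi>"
  unfolding cstar_normL_def
  by (intro cSUP_upper bdd_aboveI2[where M="\<integral>l. cmod (\<phi> l) \<partial>haarL"]) (auto simp: cstar_seminormsL_def)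

lemma scaleC_minus1: "(- 1) *\<^sub>C x = - (x::'a::complex_banach)"
  using scaleC_of_real[of "-1" x] by simp

context cstar_completion
begin

lemma j_diff: "\<phi> \<in> D \<Longrightarrow> \<psi> \<in> D \<Longrightarrow> (\<lambda>x. (- 1) * \<psi> x) \<in> D \<Longrightarrow> j (\<lambda>x. \<phi> x - \<psi> x) = j \<phi> - j \<psi>"
  using j_add[of \<phi> "\<lambda>x. (- 1) * \<psi> x"] j_scale[of \<psi> "-1"] by (simp add: scaleC_minus1)

end

lemma is_cstarL_norm_diff_le:
  assumes "is_cstarL j" and p: "\<phi> \<in> L1L" "\<psi> \<in> L1L"
  shows "norm (j \<phi> - j \<psi>) \<le> (\<integral>l. cmod (\<phi> l - \<psi> l) \<partial>haarL)"
proof -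
  interpret cstar_completion L1L convL starL cstar_normL j by fact
  have "norm (j \<phi> - j \<psi>) = cstar_normL (\<lambda>x. \<phi> x - \<psi> x)"
    using j_diff[OF p L1L_cmult[OF p(2)]] j_norm[OF L1L_diff[OF p]] by simp
  also have "\<dots> \<le> (\<integral>l. cmod (\<phi> l - \<psi> l) \<partial>haarL)" by (intro cstar_normL_le L1L_diff p)
  finally show ?thesis .
qed

lemma is_cstarL_tendsto:
  assumes j: "is_cstarL j" and p: "\<And>n. \<phi> n \<in> L1L" "\<psi> \<in> L1L"
    and lim: "(\<lambda>n. \<integral>l. cmod (\<phi> n l - \<psi> l) \<partial>haarL) \<longlonglongrightarrow> 0"
  shows "(\<lambda>n. j (\<phi> n)) \<longlonglongrightarrow> j \<psi>"
proof -
  have "(\<lambda>n. norm (j (\<phi> n) - j \<psi>)) \<longlonglongrightarrow> 0"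
    by (rule tendsto_sandwich[OF _ _ tendsto_const lim])
      (auto intro!: always_eventually is_cstarL_norm_diff_le[OF j] p)
  then show ?thesis by (simp add: tendsto_norm_zero_iff LIM_zero_iff)
qed

lemma cutoff_measurable [measurable]: "(cutoff n :: 'v::euclidean_space \<Rightarrow> real) \<in> borel_measurable borel"
  unfolding cutoff_def by measurable

text \<open>General in c, since it is applied to the cutoffs and also to their composites with
  inversion.\<close>

lemma cutoff_L1_tendsto:
  assumes p: "\<phi> \<in> (L1L :: ('f::rch \<Rightarrow> complex) set)"
    and c: "\<And>n. c n \<in> borel_measurable borel" "\<And>n x. 0 \<le> c n x" "\<And>n x. c n x \<le> (1::real)" "\<And>x. x \<noteq> 0 \<Longrightarrow> (\<lambda>n. c n x) \<longlonglongrightarrow> 1"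
  shows "(\<lambda>n. \<integral>l. cmod (complex_of_real (c n l) * \<phi> l - \<phi> l) \<partial>haarL) \<longlonglongrightarrow> 0"
    and "(\<lambda>l. complex_of_real (c n l) * \<phi> l) \<in> L1L"
proof -
  note [measurable] = L1L_measurable[OF p] c(1)
  have i: "integrable haarL (\<lambda>l. cmod (\<phi> l))" using p by (auto simp: L1L_def)
  have "(\<lambda>n. \<integral>l. cmod (complex_of_real (c n l) * \<phi> l - \<phi> l) \<partial>haarL) \<longlonglongrightarrow> (\<integral>(l::'f). 0 \<partial>haarL)"
  proof (rule integral_dominated_convergence[OF _ _ i])
    show "AE x in haarL. norm (cmod (complex_of_real (c n x) * \<phi> x - \<phi> x)) \<le> cmod (\<phi> x)" for n
    proof (rule AE_I2)
      fix x
      have "complex_of_real (c n x) * \<phi> x - \<phi> x = complex_of_real (c n x - 1) * \<phi> x" by (simp add: left_diff_distrib)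
      also have "cmod \<dots> = \<bar>c n x - 1\<bar> * cmod (\<phi> x)" by (simp only: norm_mult norm_of_real)
      also have "\<dots> \<le> 1 * cmod (\<phi> x)" using c(2,3)[of n x] by (intro mult_right_mono) auto
      finally show "norm (cmod (complex_of_real (c n x) * \<phi> x - \<phi> x)) \<le> cmod (\<phi> x)" by simp
    qed
    show "AE x in haarL. (\<lambda>n. cmod (complex_of_real (c n x) * \<phi> x - \<phi> x)) \<longlonglongrightarrow> 0"
      using AE_haarL_neq_0
    proof eventually_elim
      fix x :: 'f assume "x \<noteq> 0"
      then have "(\<lambda>n. complex_of_real (c n x) * \<phi> x - \<phi> x) \<longlonglongrightarrow> complex_of_real 1 * \<phi> x - \<phi> x"
        by (intro tendsto_intros c)
      then show "(\<lambda>n. cmod (complex_of_real (c n x) * \<phi> x - \<phi> x)) \<longlonglongrightarrow> 0"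
        by (simp add: tendsto_norm_zero)
    qed
  qed measurable
  then show "(\<lambda>n. \<integral>l. cmod (complex_of_real (c n l) * \<phi> l - \<phi> l) \<partial>haarL) \<longlonglongrightarrow> 0" by simp
  show "(\<lambda>l. complex_of_real (c n l) * \<phi> l) \<in> L1L"
    unfolding L1L_def mem_Collect_eq
    by (rule Bochner_Integration.integrable_bound[OF i])
      (use c(2,3) in \<open>auto simp: norm_mult intro!: mult_left_le_one_le\<close>)
qed

lemma L1L_inverse: "\<phi> \<in> L1L \<Longrightarrow> (\<lambda>l. \<phi> (inverse l)) \<in> L1L"
  using integrable_haarL_inverse[OF L1L_measurable[of \<phi>]] by (simp add: L1L_def)

lemma (in weyl_twist) tw_diff: "tw (a - b) = tw a - tw b"
  using tw_add[of a "- b"] tw_scaleC[of "-1" b] by (simp add: scaleC_minus1)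

lemma (in weyl_twist) tw_tendsto: "u \<longlonglongrightarrow> a \<Longrightarrow> (\<lambda>n. tw (u n)) \<longlonglongrightarrow> tw a"
proof -
  assume "u \<longlonglongrightarrow> a"
  then have "(\<lambda>n. norm (tw (u n) - tw a)) \<longlonglongrightarrow> 0"
    unfolding tw_diff[symmetric] tw_norm by (simp add: tendsto_norm_zero_iff LIM_zero_iff)
  then show ?thesis by (simp add: tendsto_norm_zero_iff LIM_zero_iff)
qed

text \<open>Cutoffs reach \<phi> from \<open>CcL\<close> in L^1 norm, hence in C*-norm. They do so
  after inversion as well, which preserves Haar measure, and the twist is isometric.\<close>

lemma (in weyl_twist) tw_j_L1L:
  assumes j: "is_cstarL j" and p: "\<phi> \<in> L1L" and c: "continuous_on (- {0}) \<phi>"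
  shows "tw (j \<phi>) = j (\<lambda>l. \<phi> (inverse l))"
proof -
  have "(\<lambda>n. j (\<lambda>l. complex_of_real (cutoff n l) * \<phi> l)) \<longlonglongrightarrow> j \<phi>"
    by (intro is_cstarL_tendsto[OF j] cutoff_L1_tendsto[OF p] p) (auto simp: cutoff_le_1 intro: cutoff_tendsto)
  then have "(\<lambda>n. tw (j (\<lambda>l. complex_of_real (cutoff n l) * \<phi> l))) \<longlonglongrightarrow> tw (j \<phi>)"
    by (rule tw_tendsto)
  moreover have "tw (j (\<lambda>l. complex_of_real (cutoff n l) * \<phi> l)) = j (\<lambda>l. complex_of_real (cutoff n (inverse l)) * \<phi> (inverse l))" for n
    using tw_j[OF cutoff_Cc[OF c, of n]] .
  moreover have "(\<lambda>n. j (\<lambda>l. complex_of_real (cutoff n (inverse l)) * \<phi> (inverse l))) \<longlonglongrightarrow> j (\<lambda>l. \<phi> (inverse l))"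
    by (intro is_cstarL_tendsto[OF j] cutoff_L1_tendsto[OF L1L_inverse[OF p]] L1L_inverse[OF p])
      (auto simp: cutoff_le_1 intro: cutoff_tendsto)
  ultimately show ?thesis using LIMSEQ_unique by simp
qed

section \<open>Approximation by Schwartz functions\<close>

lemma integrable_inverse_wt_gs: "integrable lborel (\<lambda>u::'v::euclidean_space. (1 + (norm u)\<^sup>2) ^ M * gs u)"
proof -
  obtain C where C: "C \<ge> 0" "\<And>u::'v. cmod (complex_of_real (gs u)) \<le> C * wt (M + DIM('v)) u"
    using rapid_bound[OF schwartz_imp_rapid[OF gs_schwartz]] by blast
  show ?thesis
  proof (rule integrable_if_le_wt[where M="DIM('v)" and C=C])
    fix u :: 'v
    have p: "(1 + (norm u)\<^sup>2) > 0" by (simp add: add_pos_nonneg)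
    have "norm ((1 + (norm u)\<^sup>2) ^ M * gs u) = (1 + (norm u)\<^sup>2) ^ M * gs u"
      using p gs_pos[of u] by (simp add: abs_mult)
    also have "\<dots> \<le> (1 + (norm u)\<^sup>2) ^ M * (C * wt (M + DIM('v)) u)"
      using C(2)[of u] p gs_pos[of u] by (intro mult_left_mono) auto
    also have "\<dots> = C * wt (DIM('v)) u" using p by (simp add: wt_def power_add)
    finally show "norm ((1 + (norm u)\<^sup>2) ^ M * gs u) \<le> C * wt (DIM('v)) u" .
  qed auto
qed

text \<open>The approximants are Gaussian averages of f, written as transforms of
  \<open>fourier f\<close> times a Gaussian so that their Schwartz regularity is visible. Peetre's
  inequality gives one weight bound for all of them.\<close>

lemma schwartz_approximation:
  fixes f :: "'f::rch^2 \<Rightarrow> complex"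
  assumes f: "f \<in> rapid" and c: "continuous_on UNIV f"
  obtains h C where "\<And>n. h n \<in> schwartz" "\<And>n. h n \<in> wdom C" "\<And>x. (\<lambda>n. h n x) \<longlonglongrightarrow> f x"
proof -
  have [measurable]: "f \<in> borel_measurable borel" using f by (rule rapid_measurable)
  have fi: "integrable lborel f" using f by (rule rapid_integrable)
  obtain C0 where C0: "f \<in> wdom C0" using rapid_wdom[OF f] by blast
  define s where "s n = 1 / real (Suc n)" for n
  have s: "s n > 0" "s n \<le> 1" for n by (simp_all add: s_def)
  have s0: "s \<longlonglongrightarrow> 0" unfolding s_def using LIMSEQ_Suc[OF lim_1_over_n] by simp
  define u where "u n \<xi> = fourier f \<xi> * complex_of_real (gs (s n *\<^sub>R \<xi>))" for n \<xi>
  \<comment> \<open>The sign of the argument turns the transform into an inverse transform.\<close>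
  define h where "h n x = fourier (u n) (- x)" for n x
  have h_eq: "h n x = (\<integral>v. f (x + s n *\<^sub>R v) * complex_of_real (gs v) \<partial>lborel)" for n x
    unfolding fourier_gaussian_mollifier[OF fi s(1), symmetric] h_def fourier_def[of "u n"] u_def
    by (simp add: inner_commute)
  define M where "M = DIM('f^2)"
  \<comment> \<open>This Gaussian moment absorbs the factor (1 + |v|^2)^M of
    \<open>wt_shift\<close>; s n \<le> 1 removes the dependence on n.\<close>
  define J where "J = (\<integral>v. (1 + (norm (v::'f^2))\<^sup>2) ^ M * gs v \<partial>lborel)"
  show ?thesis
  proof
    fix n
    have "(\<lambda>\<xi>. complex_of_real (gs (s n *\<^sub>R \<xi> :: 'f^2))) \<in> schwartz"
      by (rule schwartz_similarity[OF gs_schwartz linear_scale_self s(1)[of n]]) (use s[of n] in auto)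
    then have "u n \<in> schwartz" unfolding u_def by (rule fourier_mult_schwartz[OF f])
    then have "(\<lambda>x. fourier (u n) ((- 1) *\<^sub>R x)) \<in> schwartz"
      by (intro schwartz_similarity[OF fourier_schwartz linear_scale_self, of _ 1]) auto
    then show hs: "h n \<in> schwartz" by (simp add: h_def[abs_def])
    show "h n \<in> wdom (C0 * (2 ^ M * J))"
      unfolding wdom_def
    proof (intro CollectI conjI allI)
      show "h n \<in> borel_measurable borel" by (intro rapid_measurable schwartz_imp_rapid hs)
      fix x :: "'f^2"
      define B where "B v = C0 * (2 ^ M * W2 x) * ((1 + (norm (v::'f^2))\<^sup>2) ^ M * gs v)" for v
      have bound: "cmod (f (x + s n *\<^sub>R v) * complex_of_real (gs v)) \<le> B v" for v
      proof -
        have "cmod (f (x + s n *\<^sub>R v)) \<le> C0 * W2 (x + s n *\<^sub>R v)" by (rule wdomD[OF C0])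
        also have "\<dots> \<le> C0 * (2 ^ M * (1 + (norm (s n *\<^sub>R v))\<^sup>2) ^ M * W2 x)"
          unfolding W2_def M_def by (intro mult_left_mono wt_shift wdom_nonneg[OF C0])
        also have "\<dots> \<le> C0 * (2 ^ M * (1 + (norm v)\<^sup>2) ^ M * W2 x)"
        proof (intro mult_left_mono mult_right_mono power_mono add_left_mono wdom_nonneg[OF C0])
          show "norm (s n *\<^sub>R v) \<le> norm v" using s[of n] by (simp add: mult_left_le_one_le)
        qed auto
        finally have "cmod (f (x + s n *\<^sub>R v)) * gs v \<le> C0 * (2 ^ M * (1 + (norm v)\<^sup>2) ^ M * W2 x) * gs v"
          by (rule mult_right_mono) (simp add: less_imp_le[OF gs_pos])
        then show ?thesis by (simp add: B_def norm_mult less_imp_le[OF gs_pos] mult_ac)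
      qed
      have iB: "integrable lborel B" unfolding B_def by (intro integrable_mult_right integrable_inverse_wt_gs)
      have "cmod (h n x) \<le> (\<integral>v. B v \<partial>lborel)"
        unfolding h_eq
      proof (rule Bochner_Integration.integral_norm_bound_integral[OF _ iB bound])
        show "integrable lborel (\<lambda>v. f (x + s n *\<^sub>R v) * complex_of_real (gs v))"
          by (rule Bochner_Integration.integrable_bound[OF iB])
            (auto intro!: AE_I2 order_trans[OF bound abs_ge_self])
      qed
      also have "\<dots> = C0 * (2 ^ M * J) * W2 x" unfolding B_def J_def by (subst integral_mult_right_zero) simp
      finally show "cmod (h n x) \<le> C0 * (2 ^ M * J) * W2 x" .
    qed
  next
    fix x show "(\<lambda>n. h n x) \<longlonglongrightarrow> f x"
      unfolding h_eq by (rule gaussian_mollifier_tendsto[OF c wdom_bounded[OF C0] s0])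
  qed
qed

section \<open>Hilbert modules\<close>

context hilbert_module
begin

lemma ip_add_left: "ip (x + y) z = ip x z + ip y z"
proof -
  have "star (ip z (x + y)) = star (ip z x) + star (ip z y)" by (simp only: ip_add_right star_add)
  then show ?thesis by (simp only: star_ip)
qed

lemma ip_scaleC_left: "ip (c *\<^sub>C x) y = cnj c *\<^sub>C ip x y"
proof -
  have "star (ip y (c *\<^sub>C x)) = cnj c *\<^sub>C star (ip y x)" by (simp only: ip_scaleC_right star_scaleC)
  then show ?thesis by (simp only: star_ip)
qed

lemma ip_diff_right: "ip x (y - z) = ip x y - ip x z"
proof -
  have "ip x (y + (- 1) *\<^sub>C z) = ip x y + (- 1) *\<^sub>C ip x z" by (simp only: ip_add_right ip_scaleC_right)
  then show ?thesis by (simp add: scaleC_minus1)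
qed

lemma ip_diff_left: "ip (x - y) z = ip x z - ip y z"
proof -
  have "ip (x + (- 1) *\<^sub>C y) z = ip x z + cnj (- 1) *\<^sub>C ip y z" by (simp only: ip_add_left ip_scaleC_left)
  then show ?thesis by (simp add: scaleC_minus1)
qed

lemma ip_0_left [simp]: "ip 0 y = 0"
  using ip_diff_left[of 0 0 y] by simp

lemma ip_0_right [simp]: "ip x 0 = 0"
  using ip_diff_right[of x 0 0] by simp

text \<open>By polarization, from the norm axiom alone.\<close>

lemma norm_ip_le: "norm (ip x y) \<le> 4 * (norm x * norm y)"
proof -
  have unit: "norm (ip x y) \<le> 4" if n: "norm x \<le> 1" "norm y \<le> 1" for x y
  proof -
    have pol: "4 *\<^sub>C ip x y = ip (x + y) (x + y) - ip (x - y) (x - y)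
        - \<i> *\<^sub>C ip (x + \<i> *\<^sub>C y) (x + \<i> *\<^sub>C y) + \<i> *\<^sub>C ip (x - \<i> *\<^sub>C y) (x - \<i> *\<^sub>C y)"
    proof -
      have m: "- z = (- 1) *\<^sub>C z" for z :: 'a by (simp add: scaleC_minus1)
      have o: "z = 1 *\<^sub>C z" for z :: 'a using scaleC_of_real[of 1 z] by simp
      have four: "4 *\<^sub>C z = z + z + z + z" for z :: 'a
      proof -
        have "(1 + 1 + 1 + 1) *\<^sub>C z = z + z + z + z" by (simp only: scaleC_add_left o[symmetric])
        then show ?thesis by simp
      qed
      have d: "\<i> *\<^sub>C (a - b) = \<i> *\<^sub>C a - \<i> *\<^sub>C b" for a b :: 'a
        using scaleC_add_right[of \<i> a "- b"] scaleC_scaleC[of \<i> "- 1" b] scaleC_scaleC[of "- 1" \<i> b]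
        by (simp add: scaleC_minus1)
      show ?thesis
        unfolding four
        by (simp add: ip_add_left ip_add_right ip_diff_left ip_diff_right ip_scaleC_left ip_scaleC_right
            scaleC_add_right scaleC_scaleC d scaleC_minus1 o[symmetric])
    qed
    \<comment> \<open>All four arguments have norm at most 2, so each square contributes 4. Dividing
      the sum by 4 leaves the constant 4 in place of the 1 of Cauchy-Schwarz, which is enough for
      continuity.\<close>
    have q: "norm (ip z z) \<le> 4" if "norm z \<le> 2" for z
      using power_mono[OF that, of 2] by (simp add: norm_ip[symmetric])
    have iy: "norm (\<i> *\<^sub>C y) \<le> 1" using n by (simp add: norm_scaleC)
    have "4 * norm (ip x y) = norm (4 *\<^sub>C ip x y)" by (simp add: norm_scaleC)
    also have "\<dots> \<le> norm (ip (x + y) (x + y)) + norm (ip (x - y) (x - y))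
        + norm (\<i> *\<^sub>C ip (x + \<i> *\<^sub>C y) (x + \<i> *\<^sub>C y)) + norm (\<i> *\<^sub>C ip (x - \<i> *\<^sub>C y) (x - \<i> *\<^sub>C y))"
      unfolding pol by (intro order_trans[OF norm_triangle_ineq] order_trans[OF norm_triangle_ineq4] add_mono order_refl)
    also have "\<dots> \<le> 4 + 4 + 4 + 4"
      unfolding norm_scaleC using n iy
      by (intro add_mono) (auto intro!: q order_trans[OF norm_triangle_ineq] order_trans[OF norm_triangle_ineq4])
    finally show ?thesis by simp
  qed
  show ?thesis
  proof (cases "x = 0 \<or> y = 0")
    case False
    define x' y' where "x' = complex_of_real (1 / norm x) *\<^sub>C x" and "y' = complex_of_real (1 / norm y) *\<^sub>C y"
    have "norm (ip x' y') \<le> 4" by (rule unit) (use False in \<open>simp_all add: x'_def y'_def norm_scaleC norm_divide\<close>)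
    moreover have "norm (ip x' y') = (1 / norm x) * ((1 / norm y) * norm (ip x y))"
      by (simp add: x'_def y'_def ip_scaleC_left ip_scaleC_right norm_scaleC norm_divide mult_ac)
    ultimately show ?thesis using False by (simp add: field_simps)
  qed auto
qed

lemma ip_tendsto:
  assumes x: "x \<longlonglongrightarrow> a" and y: "y \<longlonglongrightarrow> b"
  shows "(\<lambda>n. ip (x n) (y n)) \<longlonglongrightarrow> ip a b"
proof -
  have "(\<lambda>n. 4 * (norm (x n) * norm (y n - b)) + 4 * (norm (x n - a) * norm b)) \<longlonglongrightarrow> 4 * (norm a * norm (b - b)) + 4 * (norm (a - a) * norm b)"
    by (intro tendsto_intros x y)
  then have lim: "(\<lambda>n. 4 * (norm (x n) * norm (y n - b)) + 4 * (norm (x n - a) * norm b)) \<longlonglongrightarrow> 0" by simp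
  have "(\<lambda>n. norm (ip (x n) (y n) - ip a b)) \<longlonglongrightarrow> 0"
  proof (rule tendsto_sandwich[OF _ _ tendsto_const lim])
    show "\<forall>\<^sub>F n in sequentially. norm (ip (x n) (y n) - ip a b) \<le> 4 * (norm (x n) * norm (y n - b)) + 4 * (norm (x n - a) * norm b)"
    proof (rule always_eventually, rule allI)
      fix n
      have "ip (x n) (y n) - ip a b = ip (x n) (y n - b) + ip (x n - a) b"
        by (simp add: ip_diff_left ip_diff_right)
      then show "norm (ip (x n) (y n) - ip a b) \<le> 4 * (norm (x n) * norm (y n - b)) + 4 * (norm (x n - a) * norm b)"
        using norm_triangle_ineq[of "ip (x n) (y n - b)" "ip (x n - a) b"] norm_ip_le[of "x n" "y n - b"] norm_ip_le[of "x n - a" b]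
        by simp
    qed
  qed auto
  then show ?thesis by (simp add: tendsto_norm_zero_iff LIM_zero_iff)
qed

lemma ip_self_eq_0: "ip x x = 0 \<Longrightarrow> x = 0"
  using norm_ip[of x] by simp

end

context ps_module
begin

lemma \<iota>_diff: "f \<in> modfuns \<Longrightarrow> g \<in> modfuns \<Longrightarrow> \<iota> (\<lambda>x. f x - g x) = \<iota> f - \<iota> g"
  using \<iota>_add[of f "\<lambda>x. (- 1) * g x"] \<iota>_scale[of g "-1"] modfuns_cmult[of g "-1"] by (simp add: scaleC_minus1)

lemma norm_\<iota>_le:
  assumes f: "f \<in> modfuns"
  shows "(norm (\<iota> f))\<^sup>2 \<le> (\<integral>l. cmod (pairing f f l) \<partial>haarL)"
proof -
  interpret C: cstar_completion L1L convL starL cstar_normL j by (rule cstarL)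
  obtain C where C: "f \<in> wdom C" using modfuns_wdom[OF f] by blast
  have "(norm (\<iota> f))\<^sup>2 = norm (j (pairing f f))" by (simp add: norm_ip \<iota>_ip f)
  also have "\<dots> = cstar_normL (pairing f f)" by (intro C.j_norm pairing_L1L[OF C C])
  also have "\<dots> \<le> (\<integral>l. cmod (pairing f f l) \<partial>haarL)" by (intro cstar_normL_le pairing_L1L[OF C C])
  finally show ?thesis .
qed

text \<open>The squared norm of a difference is at most the L^1 norm of its pairing with itself,
  which tends to 0 by dominated convergence under the common weight.\<close>

lemma \<iota>_tendsto:
  assumes h: "\<And>n. h n \<in> modfuns" "\<And>n. h n \<in> wdom C" and f: "f \<in> modfuns"
    and lim: "\<And>x. x \<noteq> 0 \<Longrightarrow> (\<lambda>n. h n x) \<longlonglongrightarrow> f x"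
  shows "(\<lambda>n. \<iota> (h n)) \<longlonglongrightarrow> \<iota> f"
proof -
  obtain D where D: "f \<in> wdom D" using modfuns_wdom[OF f] by blast
  define r where "r n x = h n x - f x" for n x
  have r: "r n \<in> modfuns" "r n \<in> wdom (C + D)" for n
    unfolding r_def by (intro modfuns_diff h f, intro wdom_diff h D)
  have r0: "(\<lambda>n. r n x) \<longlonglongrightarrow> 0" if "x \<noteq> 0" for x
    unfolding r_def using lim[OF that] by (simp add: LIM_zero_iff)
  have "(\<lambda>n. \<integral>l. cmod (pairing (r n) (r n) l) \<partial>haarL) \<longlonglongrightarrow> 0"
    by (rule pairing_L1_tendsto_0[OF r(2) r(2) r0])
  then have "(\<lambda>n. (norm (\<iota> (r n)))\<^sup>2) \<longlonglongrightarrow> 0"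
    by (rule tendsto_sandwich[OF _ _ tendsto_const, rotated 2])
      (auto intro!: always_eventually norm_\<iota>_le r)
  then have "(\<lambda>n. sqrt ((norm (\<iota> (r n)))\<^sup>2)) \<longlonglongrightarrow> sqrt 0" by (intro tendsto_intros)
  then have "(\<lambda>n. norm (\<iota> (h n) - \<iota> f)) \<longlonglongrightarrow> 0"
    using \<iota>_diff[OF h(1) f] by (simp add: r_def[abs_def])
  then show ?thesis by (simp add: tendsto_norm_zero_iff LIM_zero_iff)
qed

lemma schwartz_dense: "closure (\<iota> ` schwartz) = UNIV"
proof -
  have "\<iota> ` CcV \<subseteq> closure (\<iota> ` schwartz)"
  proof (rule image_subsetI)
    fix f :: "'f^2 \<Rightarrow> complex" assume f: "f \<in> CcV"
    have fr: "f \<in> rapid" by (rule Cc_rapid[OF f]) auto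
    have fc: "continuous_on UNIV f" by (rule Cc_continuous[OF f]) auto
    obtain h C where h: "\<And>n. h n \<in> schwartz" "\<And>n. h n \<in> wdom C" "\<And>x. (\<lambda>n. h n x) \<longlonglongrightarrow> f x"
      using schwartz_approximation[OF fr fc] by metis
    have "(\<lambda>n. \<iota> (h n)) \<longlonglongrightarrow> \<iota> f"
      by (rule \<iota>_tendsto[OF schwartz_modfuns[OF h(1)] h(2) CcV_modfuns[OF f] h(3)])
    then show "\<iota> f \<in> closure (\<iota> ` schwartz)"
      unfolding closure_sequential using h(1) by (intro exI[of _ "\<lambda>n. \<iota> (h n)"]) auto
  qed
  then have "closure (\<iota> ` CcV) \<subseteq> closure (\<iota> ` schwartz)" by (simp add: closure_minimal)
  then show ?thesis using \<iota>_dense by auto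
qed

lemma schwartz_sequence:
  obtains f where "\<And>n. f n \<in> schwartz" "(\<lambda>n. \<iota> (f n)) \<longlonglongrightarrow> x"
proof -
  have "x \<in> closure (\<iota> ` schwartz)" by (simp add: schwartz_dense)
  then obtain u where u: "\<And>n. u n \<in> \<iota> ` schwartz" "u \<longlonglongrightarrow> x" unfolding closure_sequential by blast
  then have "\<forall>n. \<exists>f. f \<in> schwartz \<and> u n = \<iota> f" by blast
  then obtain f where f: "\<And>n. f n \<in> schwartz \<and> u n = \<iota> (f n)" by metis
  then have "u = (\<lambda>n. \<iota> (f n))" by auto
  then show ?thesis using that f u(2) by blast
qed

text \<open>The action of the group algebra is prescribed on \<open>CcV\<close>. Cutoffs reach every
  function of \<open>modfuns\<close> from there, with the same weight constant.\<close>

lemma CcV_sequence: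
  assumes f: "f \<in> modfuns" and C: "f \<in> wdom C"
  obtains h where "\<And>n. h n \<in> CcV" "\<And>n. h n \<in> wdom C" "\<And>x. x \<noteq> 0 \<Longrightarrow> (\<lambda>n. h n x) \<longlonglongrightarrow> f x" "(\<lambda>n. \<iota> (h n)) \<longlonglongrightarrow> \<iota> f"
proof -
  define h where "h n x = complex_of_real (cutoff n x) * f x" for n x
  note [measurable] = wdom_measurable[OF C]
  have h1: "h n \<in> CcV" for n
    unfolding h_def by (rule cutoff_Cc) (use modfuns_continuous[OF f] continuous_on_subset in blast)
  have h2: "h n \<in> wdom C" for n
    unfolding wdom_def
  proof (intro CollectI conjI allI)
    show "h n \<in> borel_measurable borel" unfolding h_def by measurable
    fix x
    have "cmod (h n x) \<le> cmod (f x)"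
      by (simp add: h_def norm_mult mult_left_le_one_le cutoff_le_1)
    then show "cmod (h n x) \<le> C * W2 x" using wdomD[OF C, of x] by linarith
  qed
  have h3: "(\<lambda>n. h n x) \<longlonglongrightarrow> f x" if "x \<noteq> 0" for x
  proof -
    have "(\<lambda>n. complex_of_real (cutoff n x) * f x) \<longlonglongrightarrow> complex_of_real 1 * f x"
      by (intro tendsto_intros cutoff_tendsto that)
    then show ?thesis by (simp add: h_def)
  qed
  show ?thesis
    by (rule that[OF h1 h2 h3 \<iota>_tendsto[OF CcV_modfuns[OF h1] h2 f h3]])
qed

lemma ip_fourier_w:
  assumes comm: "\<And>x y::'f. x * y = y * x" and tw: "weyl_twist j tw"
    and f: "f \<in> schwartz" and g: "g \<in> schwartz"
  shows "ip (\<iota> (fourier_w f)) (\<iota> (fourier_w g)) = tw (ip (\<iota> f) (\<iota> g))"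
proof -
  interpret weyl_twist j tw by fact
  obtain C D where C: "f \<in> wdom C" and D: "g \<in> wdom D"
    using modfuns_wdom[OF schwartz_modfuns] f g by metis
  have "pairing (fourier_w f) (fourier_w g) \<alpha> = pairing f g (inverse \<alpha>)" for \<alpha>
  proof (cases "\<alpha> = 0")
    case False
    then show ?thesis by (intro pairing_fourier_w comm rapid_integrable schwartz_imp_rapid f g)
  \<comment> \<open>At \<alpha> = 0 both sides vanish, because \<open>inverse 0 = 0\<close> and the
    pairing carries the factor |\<alpha>|^d.\<close>
  qed (simp add: pairing_def)
  then have "pairing (fourier_w f) (fourier_w g) = (\<lambda>\<alpha>. pairing f g (inverse \<alpha>))" by (rule ext)
  then have "ip (\<iota> (fourier_w f)) (\<iota> (fourier_w g)) = j (\<lambda>\<alpha>. pairing f g (inverse \<alpha>))"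
    using \<iota>_ip[OF schwartz_modfuns schwartz_modfuns, OF fourier_w_schwartz[OF f] fourier_w_schwartz[OF g]] by (simp only:)
  also have "\<dots> = tw (j (pairing f g))"
    by (intro tw_j_L1L[OF cstarL, symmetric] pairing_L1L[OF C D] 
        continuous_on_subset[OF pairing_continuous[OF wdom_integrable[OF C] schwartz_continuous[OF g] wdom_bounded[OF D]]]) auto
  also have "\<dots> = tw (ip (\<iota> f) (\<iota> g))" using f g by (simp add: \<iota>_ip schwartz_modfuns)
  finally show ?thesis .
qed

lemma unitary_extension:
  assumes comm: "\<And>x y::'f. x * y = y * x" and tw: "weyl_twist j tw"
  obtains U where "\<And>f. f \<in> schwartz \<Longrightarrow> U (\<iota> f) = \<iota> (fourier_w f)"
    and "\<And>u x. u \<longlonglongrightarrow> x \<Longrightarrow> (\<lambda>n. U (u n)) \<longlonglongrightarrow> U x"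
    and "module_isometry (act_w tw act) (ip_w tw ip) act ip U"
    and "\<And>x. U (U x) = x"
proof -
  interpret weyl_twist j tw by fact
  have F_diff: "fourier_w (\<lambda>x. f x - g x) = (\<lambda>x. fourier_w f x - fourier_w g x)" 
    if "f \<in> schwartz" "g \<in> schwartz" for f g :: "'f^2 \<Rightarrow> complex"
    using that fourier_w_add[of f "\<lambda>x. (- 1) * g x"] fourier_w_cmult[of "-1" g]
    by (simp add: rapid_integrable schwartz_imp_rapid)
  have F_mod: "f \<in> modfuns" "fourier_w f \<in> modfuns" if "f \<in> schwartz" for f :: "'f^2 \<Rightarrow> complex"
    using that by (auto intro: schwartz_modfuns fourier_w_schwartz)
  have nF: "norm (\<iota> (fourier_w f)) = norm (\<iota> f)" if "f \<in> schwartz" for f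
  proof -
    have "(norm (\<iota> (fourier_w f)))\<^sup>2 = (norm (\<iota> f))\<^sup>2"
      unfolding norm_ip ip_fourier_w[OF comm tw that that] tw_norm ..
    then show ?thesis by simp
  qed
  have dF: "dist (\<iota> (fourier_w f)) (\<iota> (fourier_w g)) = dist (\<iota> f) (\<iota> g)" if "f \<in> schwartz" "g \<in> schwartz" for f g
  proof -
    have s: "(\<lambda>x. f x - g x) \<in> schwartz" using schwartz_add[OF that(1) schwartz_cmult[OF that(2), of "-1"]] by simp
    show ?thesis
      using nF[OF s] that by (simp add: F_diff dist_norm F_mod \<iota>_diff)
  qed
  \<comment> \<open>A choice of representative, as \<open>\<iota>\<close> is not assumed injective;
    the isometry \<open>dF\<close> makes the value independent of it.\<close>
  define U0 where "U0 x = \<iota> (fourier_w (SOME f. f \<in> schwartz \<and> \<iota> f = x))" for x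
  have U0: "U0 (\<iota> f) = \<iota> (fourier_w f)" if f: "f \<in> schwartz" for f
  proof -
    define g where "g = (SOME g. g \<in> schwartz \<and> \<iota> g = \<iota> f)"
    have g: "g \<in> schwartz \<and> \<iota> g = \<iota> f" unfolding g_def by (rule someI[of _ f]) (use f in auto)
    then have "dist (\<iota> (fourier_w g)) (\<iota> (fourier_w f)) = 0" using dF[of g f] f by simp
    then show ?thesis by (simp add: U0_def g_def)
  qed
  have "uniformly_continuous_on (\<iota> ` schwartz) U0"
    unfolding uniformly_continuous_on_def by (auto simp: U0 dF)
  then obtain U where U: "uniformly_continuous_on (closure (\<iota> ` schwartz)) U" "\<And>x. x \<in> \<iota> ` schwartz \<Longrightarrow> U0 x = U x"
    using uniformly_continuous_on_extension_on_closure by metis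
  have U\<iota>: "U (\<iota> f) = \<iota> (fourier_w f)" if "f \<in> schwartz" for f
    using U(2)[of "\<iota> f"] U0[OF that] that by simp
  have "continuous_on UNIV U" using U(1) uniformly_continuous_imp_continuous by (auto simp: schwartz_dense)
  then have U_lim: "(\<lambda>n. U (u n)) \<longlonglongrightarrow> U x" if "u \<longlonglongrightarrow> x" for u x
    by (rule continuous_on_tendsto_compose[OF _ that]) auto
  have add: "U (x + y) = U x + U y" for x y
  proof -
    obtain f where f: "\<And>n. f n \<in> schwartz" "(\<lambda>n. \<iota> (f n)) \<longlonglongrightarrow> x" using schwartz_sequence by metis
    obtain g where g: "\<And>n. g n \<in> schwartz" "(\<lambda>n. \<iota> (g n)) \<longlonglongrightarrow> y" using schwartz_sequence by metis
    have "U (\<iota> (f n) + \<iota> (g n)) = U (\<iota> (f n)) + U (\<iota> (g n))" for n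
      using U\<iota>[OF schwartz_add[OF f(1) g(1)]] f(1) g(1)
      by (simp add: \<iota>_add F_mod U\<iota> fourier_w_add rapid_integrable schwartz_imp_rapid)
    then show ?thesis
      using U_lim[OF tendsto_add[OF f(2) g(2)]] tendsto_add[OF U_lim[OF f(2)] U_lim[OF g(2)]] LIMSEQ_unique by simp
  qed
  have scl: "(\<lambda>n. c *\<^sub>C u n) \<longlonglongrightarrow> c *\<^sub>C x" if "u \<longlonglongrightarrow> x" for u :: "nat \<Rightarrow> 'e" and x c
  proof -
    have "(\<lambda>n. cmod c * norm (u n - x)) \<longlonglongrightarrow> cmod c * norm (x - x)" by (intro tendsto_intros that)
    moreover have "cmod c * norm (u n - x) = norm (c *\<^sub>C u n - c *\<^sub>C x)" for n
      using scaleC_add_right[of c "u n - x" x] by (simp add: norm_scaleC[symmetric] algebra_simps)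
    ultimately show ?thesis by (simp add: tendsto_norm_zero_iff LIM_zero_iff)
  qed
  have scale: "U (c *\<^sub>C x) = c *\<^sub>C U x" for c x
  proof -
    obtain f where f: "\<And>n. f n \<in> schwartz" "(\<lambda>n. \<iota> (f n)) \<longlonglongrightarrow> x" using schwartz_sequence by metis
    have "U (c *\<^sub>C \<iota> (f n)) = c *\<^sub>C U (\<iota> (f n))" for n
      using U\<iota>[OF schwartz_cmult[OF f(1)], of c n] f(1) by (simp add: \<iota>_scale F_mod U\<iota> fourier_w_cmult)
    then show ?thesis
      using U_lim[OF scl[OF f(2), of c]] scl[OF U_lim[OF f(2)], of c] LIMSEQ_unique by simp
  qed
  have ipU: "ip (U x) (U y) = tw (ip x y)" for x y
  proof -
    obtain f where f: "\<And>n. f n \<in> schwartz" "(\<lambda>n. \<iota> (f n)) \<longlonglongrightarrow> x" using schwartz_sequence by metis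
    obtain g where g: "\<And>n. g n \<in> schwartz" "(\<lambda>n. \<iota> (g n)) \<longlonglongrightarrow> y" using schwartz_sequence by metis
    have "ip (U (\<iota> (f n))) (U (\<iota> (g n))) = tw (ip (\<iota> (f n)) (\<iota> (g n)))" for n
      by (simp add: U\<iota> f(1) g(1) ip_fourier_w[OF comm tw])
    then show ?thesis
      using ip_tendsto[OF U_lim[OF f(2)] U_lim[OF g(2)]] tw_tendsto[OF ip_tendsto[OF f(2) g(2)]] LIMSEQ_unique by simp
  qed
  have UU: "U (U x) = x" for x
  proof -
    obtain f where f: "\<And>n. f n \<in> schwartz" "(\<lambda>n. \<iota> (f n)) \<longlonglongrightarrow> x" using schwartz_sequence by metis
    have "U (U (\<iota> (f n))) = \<iota> (f n)" for n
      by (simp add: U\<iota> f(1) fourier_w_schwartz fourier_w_fourier_w)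
    then show ?thesis
      using U_lim[OF U_lim[OF f(2)]] f(2) LIMSEQ_unique by simp
  qed
  have bij: "bij U" by (rule o_bij[of U]) (auto simp: fun_eq_iff UU)
  \<comment> \<open>Linearity over C*(L) is read off inner products: U intertwines them with the
    twist and is onto, and a vector orthogonal to everything is 0.\<close>
  have actU: "U (act x (tw a)) = act (U x) a" for x a
  proof -
    have "ip (U y) (U (act x (tw a))) = ip (U y) (act (U x) a)" for y
      by (simp add: ipU ip_act_right tw_mult tw_tw)
    then have "ip z (U (act x (tw a)) - act (U x) a) = 0" for z
      using UU[of z] by (metis ip_diff_right right_minus_eq)
    then show ?thesis using ip_self_eq_0 right_minus_eq by blast
  qed
  have "module_isometry (act_w tw act) (ip_w tw ip) act ip U"
    unfolding module_isometry_def act_w_def ip_w_def using add scale actU ipU bij by blast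
  then show ?thesis using that U\<iota> U_lim UU by blast
qed

end

section \<open>Commutation with the action of \<open>G\<close>\<close>

text \<open>An upper bound for the operator norm that is visibly continuous, hence bounded on
  compact sets of matrices.\<close>

definition entry_norm :: "'f::rch^2^2 \<Rightarrow> real"
  where "entry_norm g = norm (g$1$1) + norm (g$1$2) + norm (g$2$1) + norm (g$2$2)"

lemma norm_matrix_vector_le: "norm (g *v x) \<le> entry_norm g * norm (x::'f::rch^2)"
proof -
  have c: "norm (x$1) \<le> norm x" "norm (x$2) \<le> norm x" by (rule Finite_Cartesian_Product.norm_nth_le)+
  have e: "norm (a * x$1 + b * x$2) \<le> norm a * norm x + norm b * norm x" for a b
    using c by (intro order_trans[OF norm_triangle_ineq] add_mono) (auto simp: norm_mult intro!: mult_left_mono)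
  have "norm (g *v x) \<le> norm (g$1$1 * x$1 + g$1$2 * x$2) + norm (g$2$1 * x$1 + g$2$2 * x$2)"
    unfolding matrix_vector_2 norm_vec_2 by (simp add: sqrt_sum_squares_le_sum)
  also have "\<dots> \<le> entry_norm g * norm x"
    using e[of "g$1$1" "g$1$2"] e[of "g$2$1" "g$2$2"] by (simp add: entry_norm_def distrib_right)
  finally show ?thesis .
qed

lemma W2_le_scaled:
  fixes x y :: "'f::rch^2"
  assumes R: "R \<ge> 1" and xy: "norm x \<le> R * norm y"
  shows "W2 y \<le> (R\<^sup>2) ^ DIM('f^2) * W2 x"
proof -
  have p: "1 + (norm x)\<^sup>2 > 0" "1 + (norm y)\<^sup>2 > 0" by (simp_all add: add_pos_nonneg)
  have "(norm x)\<^sup>2 \<le> (R * norm y)\<^sup>2" using xy by (intro power_mono) auto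
  moreover have "1 \<le> R\<^sup>2" using R by simp
  ultimately have "1 + (norm x)\<^sup>2 \<le> R\<^sup>2 * (1 + (norm y)\<^sup>2)" by (simp add: power_mult_distrib distrib_left)
  then have "(1 + (norm x)\<^sup>2) ^ DIM('f^2) \<le> (R\<^sup>2 * (1 + (norm y)\<^sup>2)) ^ DIM('f^2)"
    using p by (intro power_mono) auto
  then have le: "(1 + (norm x)\<^sup>2) ^ DIM('f^2) \<le> (R\<^sup>2) ^ DIM('f^2) * (1 + (norm y)\<^sup>2) ^ DIM('f^2)"
    by (simp only: power_mult_distrib)
  have frac: "1 / Y \<le> c * (1 / X)" if "X \<le> c * Y" "X > 0" "Y > 0" for X Y c :: real
    using that by (simp add: field_simps)
  show ?thesis unfolding W2_def wt_def by (rule frac[OF le]) (use p in auto)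
qed

lemma pairing_diff_left:
  fixes f g k :: "'f::rch^2 \<Rightarrow> complex"
  assumes f: "f \<in> wdom C" and g: "g \<in> wdom D" and k: "k \<in> wdom E"
  shows "pairing (\<lambda>x. f x - g x) k \<alpha> = pairing f k \<alpha> - pairing g k \<alpha>"
proof -
  note [measurable] = wdom_measurable[OF f] wdom_measurable[OF g] wdom_measurable[OF k]
  have i: "integrable lborel (\<lambda>x. cnj (u x) * k (rsmult x \<alpha>))" if u: "integrable lborel u" for u
  proof (rule Bochner_Integration.integrable_bound)
    show "integrable lborel (\<lambda>x. E * cmod (u x))" using u by simp
    have [measurable]: "u \<in> borel_measurable borel" using u by auto
    show "(\<lambda>x. cnj (u x) * k (rsmult x \<alpha>)) \<in> borel_measurable lborel" by measurable
    show "AE x in lborel. norm (cnj (u x) * k (rsmult x \<alpha>)) \<le> norm (E * cmod (u x))"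
      using wdom_bounded[OF k] wdom_nonneg[OF k] by (intro AE_I2) (auto simp: norm_mult mult.commute[of E] intro!: mult_left_mono)
  qed
  show ?thesis
    unfolding pairing_def using i[OF wdom_integrable[OF f]] i[OF wdom_integrable[OF g]]
    by (simp add: left_diff_distrib right_diff_distrib)
qed

section \<open>Averaging over SL(2,F) against a function of compact support\<close>

locale comm_G_integral =
  fixes \<mu> :: "('f::rch^2^2) measure" and \<phi> :: "'f^2^2 \<Rightarrow> complex" and K :: "('f^2^2) set"
  assumes comm: "\<And>x y::'f. x * y = y * x"
    and haar: "is_haarG \<mu>"
    and K: "compact K" "K \<subseteq> SL2" and \<phi>_cont: "continuous_on SL2 \<phi>" and \<phi>_0: "\<And>g. g \<notin> K \<Longrightarrow> \<phi> g = 0"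
begin

text \<open>Restricted to the compact set K the Haar measure is finite: constants become integrable,
  and Fubini with Lebesgue measure applies directly.\<close>

definition \<nu> :: "('f^2^2) measure"
  where "\<nu> = density \<mu> (indicator K)"

lemma sets_\<mu> [measurable_cong]: "sets \<mu> = sets borel"
  using haar by (simp add: is_haarG_def)

lemma space_\<mu> [simp]: "space \<mu> = UNIV"
  using sets_eq_imp_space_eq[OF sets_\<mu>] by simp

lemma sets_\<nu> [simp, measurable_cong]: "sets \<nu> = sets borel"
  by (simp add: \<nu>_def sets_\<mu>)

lemma space_\<nu> [simp]: "space \<nu> = UNIV"
  using sets_eq_imp_space_eq[OF sets_\<nu>] by simp

lemma K_measurable [measurable]: "K \<in> sets borel"
  using K(1) by (simp add: borel_closed compact_imp_closed)

lemma finite_\<nu>: "finite_measure \<nu>"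
proof
  have "emeasure \<nu> (space \<nu>) = emeasure \<mu> K"
    unfolding \<nu>_def by (subst emeasure_density) (auto simp: sets_\<mu>)
  also have "\<dots> < \<infinity>" using haar K by (auto simp: is_haarG_def)
  finally show "emeasure \<nu> (space \<nu>) \<noteq> \<infinity>" by simp
qed

sublocale finite_measure \<nu> by (rule finite_\<nu>)

lemma \<phi>_measurable [measurable]: "\<phi> \<in> borel_measurable borel"
proof -
  have "(\<lambda>g. indicator K g *\<^sub>R \<phi> g) \<in> borel_measurable borel"
    by (rule borel_measurable_continuous_on_indicator) (use K \<phi>_cont in \<open>auto intro: continuous_on_subset\<close>)
  also have "(\<lambda>g. indicator K g *\<^sub>R \<phi> g) = \<phi>" using \<phi>_0 by (auto simp: indicator_def fun_eq_iff)
  finally show ?thesis .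
qed

lemma \<phi>_bounded: "\<exists>B\<ge>0. \<forall>g. cmod (\<phi> g) \<le> B"
proof -
  have "bounded (\<phi> ` K)"
    using K \<phi>_cont by (intro compact_imp_bounded compact_continuous_image) (auto intro: continuous_on_subset)
  then obtain B where "\<And>g. g \<in> K \<Longrightarrow> cmod (\<phi> g) \<le> B" unfolding bounded_iff by fastforce
  then have "\<forall>g. cmod (\<phi> g) \<le> max B 0" using \<phi>_0 by (metis max.coboundedI1 max.coboundedI2 norm_zero order_refl)
  then show ?thesis by (intro exI[of _ "max B 0"]) auto
qed

lemma \<phi>_integrable: "integrable \<nu> \<phi>"
proof -
  obtain B where "\<forall>g. cmod (\<phi> g) \<le> B" using \<phi>_bounded by blast
  then show ?thesis by (intro integrable_const_bound[where B=B]) auto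
qed

lemma integral_\<nu>:
  fixes h :: "'f^2^2 \<Rightarrow> complex"
  assumes [measurable]: "h \<in> borel_measurable borel" and h: "\<And>g. g \<notin> K \<Longrightarrow> h g = 0"
  shows "(\<integral>g. h g \<partial>\<mu>) = (\<integral>g. h g \<partial>\<nu>)"
proof -
  have "(\<integral>g. h g \<partial>\<nu>) = (\<integral>g. indicator K g *\<^sub>R h g \<partial>\<mu>)"
    unfolding \<nu>_def by (subst integral_density[symmetric]) (auto simp: ennreal_indicator sets_\<mu> measurable_cong_sets[OF sets_\<mu> refl])
  also have "\<dots> = (\<integral>g. h g \<partial>\<mu>)"
    using h by (intro Bochner_Integration.integral_cong) (auto simp: indicator_def)
  finally show ?thesis by simp
qed

lemma gact_eq:
  assumes [measurable]: "f \<in> borel_measurable borel"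
  shows "gact \<mu> \<phi> f x = (\<integral>g. \<phi> g * f (adj2 g *v x) \<partial>\<nu>)"
proof -
  have "gact \<mu> \<phi> f x = (\<integral>g. \<phi> g * f (adj2 g *v x) \<partial>\<mu>)"
    unfolding gact_def
  proof (intro Bochner_Integration.integral_cong refl)
    fix g show "\<phi> g * f (matrix_inv g *v x) = \<phi> g * f (adj2 g *v x)"
      using matrix_inv_SL2[OF comm, of g] \<phi>_0[of g] K by (cases "g \<in> K") auto
  qed
  also have "\<dots> = (\<integral>g. \<phi> g * f (adj2 g *v x) \<partial>\<nu>)"
    by (rule integral_\<nu>) (use \<phi>_0 in auto)
  finally show ?thesis .
qed

lemma K_bound: "\<exists>R\<ge>1. \<forall>g\<in>K. \<forall>x. norm x \<le> R * norm (adj2 g *v x)"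
proof -
  have "continuous_on K entry_norm" unfolding entry_norm_def by (intro continuous_intros)
  then have "bounded (entry_norm ` K)" using K by (intro compact_imp_bounded compact_continuous_image)
  then obtain B where B: "\<And>g. g \<in> K \<Longrightarrow> \<bar>entry_norm g\<bar> \<le> B" unfolding bounded_iff by fastforce
  show ?thesis
  proof (intro exI[of _ "max 1 B"] conjI ballI allI)
    fix g x assume g: "g \<in> K"
    have "norm x = norm (g *v (adj2 g *v x))" using adj2_mv_SL2[OF comm] g K by auto
    also have "\<dots> \<le> entry_norm g * norm (adj2 g *v x)" by (rule norm_matrix_vector_le)
    also have "\<dots> \<le> max 1 B * norm (adj2 g *v x)" using B[OF g] by (intro mult_right_mono) auto
    finally show "norm x \<le> max 1 B * norm (adj2 g *v x)" .
  qed simp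
qed

text \<open>R is determined by K and is the same for all f and C, so the estimate is uniform along
  sequences that share one weight constant.\<close>

lemma gact_integrand_bound:
  "\<exists>R\<ge>0. \<forall>f C g x. f \<in> wdom C \<longrightarrow> cmod (\<phi> g * f (adj2 g *v x)) \<le> (C * R * W2 x) * cmod (\<phi> g)"
proof -
  obtain R where R: "R \<ge> 1" "\<And>g x. g \<in> K \<Longrightarrow> norm x \<le> R * norm (adj2 g *v x)" using K_bound by blast
  show ?thesis
  proof (intro exI[of _ "(R\<^sup>2) ^ DIM('f^2)"] conjI allI impI)
    fix f :: "'f^2 \<Rightarrow> complex" and C g x assume f: "f \<in> wdom C"
    show "cmod (\<phi> g * f (adj2 g *v x)) \<le> (C * (R\<^sup>2) ^ DIM('f^2) * W2 x) * cmod (\<phi> g)"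
    proof (cases "g \<in> K")
      case True
      have "cmod (f (adj2 g *v x)) \<le> C * W2 (adj2 g *v x)" by (rule wdomD[OF f])
      also have "\<dots> \<le> C * ((R\<^sup>2) ^ DIM('f^2) * W2 x)"
        by (intro mult_left_mono W2_le_scaled R True wdom_nonneg[OF f])
      finally have "cmod (\<phi> g) * cmod (f (adj2 g *v x)) \<le> cmod (\<phi> g) * (C * ((R\<^sup>2) ^ DIM('f^2) * W2 x))"
        by (rule mult_left_mono) simp
      then show ?thesis by (simp only: norm_mult mult_ac)
    qed (simp add: \<phi>_0)
  qed simp
qed

lemma gact_integrable:
  assumes f: "f \<in> wdom C"
  shows "integrable \<nu> (\<lambda>g. \<phi> g * f (adj2 g *v x))"
proof -
  note [measurable] = wdom_measurable[OF f]
  show ?thesis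
    by (rule Bochner_Integration.integrable_bound[of _ "\<lambda>g. C * cmod (\<phi> g)"])
      (use \<phi>_integrable wdom_bounded[OF f] wdom_nonneg[OF f] in \<open>auto simp: norm_mult mult.commute[of C] intro!: AE_I2 mult_left_mono\<close>)
qed

lemma gact_wdom: "\<exists>R\<ge>0. \<forall>f C. f \<in> wdom C \<longrightarrow> gact \<mu> \<phi> f \<in> wdom (C * R)"
proof -
  obtain R where R: "R \<ge> 0" "\<And>f C g x. f \<in> wdom C \<Longrightarrow> cmod (\<phi> g * f (adj2 g *v x)) \<le> (C * R * W2 x) * cmod (\<phi> g)"
    using gact_integrand_bound by blast
  define I where "I = (\<integral>g. cmod (\<phi> g) \<partial>\<nu>)"
  have I: "I \<ge> 0" by (simp add: I_def integral_nonneg_AE)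
  show ?thesis
  proof (intro exI[of _ "R * I"] conjI allI impI)
    fix f :: "'f^2 \<Rightarrow> complex" and C assume f: "f \<in> wdom C"
    note [measurable] = wdom_measurable[OF f]
    show "gact \<mu> \<phi> f \<in> wdom (C * (R * I))"
      unfolding wdom_def
    proof (intro CollectI conjI allI)
      show "gact \<mu> \<phi> f \<in> borel_measurable borel"
        unfolding gact_eq[OF wdom_measurable[OF f], abs_def] by measurable
      fix x
      have "cmod (gact \<mu> \<phi> f x) \<le> (\<integral>g. (C * R * W2 x) * cmod (\<phi> g) \<partial>\<nu>)"
        unfolding gact_eq[OF wdom_measurable[OF f]]
        using \<phi>_integrable by (intro Bochner_Integration.integral_norm_bound_integral gact_integrable[OF f] R f) auto
      then show "cmod (gact \<mu> \<phi> f x) \<le> C * (R * I) * W2 x" by (simp add: I_def mult_ac)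
    qed
  qed (use R I in simp)
qed

lemma gact_continuous:
  assumes f: "f \<in> wdom C" and c: "continuous_on UNIV f"
  shows "continuous_on UNIV (gact \<mu> \<phi> f)"
  unfolding continuous_on_sequentially gact_eq[OF wdom_measurable[OF f], abs_def] o_def
proof (intro allI ballI impI, elim conjE)
  note [measurable] = wdom_measurable[OF f]
  fix u :: "nat \<Rightarrow> 'f^2" and a assume u: "u \<longlonglongrightarrow> a"
  show "(\<lambda>n. \<integral>g. \<phi> g * f (adj2 g *v u n) \<partial>\<nu>) \<longlonglongrightarrow> (\<integral>g. \<phi> g * f (adj2 g *v a) \<partial>\<nu>)"
  proof (rule integral_dominated_convergence[where w="\<lambda>g. C * cmod (\<phi> g)"])
    show "integrable \<nu> (\<lambda>g. C * cmod (\<phi> g))" using \<phi>_integrable by simp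
    show "AE g in \<nu>. (\<lambda>n. \<phi> g * f (adj2 g *v u n)) \<longlonglongrightarrow> \<phi> g * f (adj2 g *v a)"
    proof (rule AE_I2)
      fix g
      have "continuous_on UNIV (\<lambda>x. f (adj2 g *v x))"
        by (rule continuous_on_compose2[OF c]) (auto intro!: continuous_intros)
      then have "(\<lambda>n. f (adj2 g *v u n)) \<longlonglongrightarrow> f (adj2 g *v a)"
        by (rule continuous_on_tendsto_compose[OF _ u]) auto
      then show "(\<lambda>n. \<phi> g * f (adj2 g *v u n)) \<longlonglongrightarrow> \<phi> g * f (adj2 g *v a)" by (intro tendsto_intros)
    qed
    show "AE g in \<nu>. cmod (\<phi> g * f (adj2 g *v u n)) \<le> C * cmod (\<phi> g)" for n
      using wdom_bounded[OF f] by (intro AE_I2) (auto simp: norm_mult mult.commute[of C] intro!: mult_left_mono)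
  qed measurable
qed

lemma gact_tendsto:
  assumes h: "\<And>n. h n \<in> wdom C" and f: "f \<in> wdom C" and lim: "\<And>x. x \<noteq> 0 \<Longrightarrow> (\<lambda>n. h n x) \<longlonglongrightarrow> f x" and x: "x \<noteq> 0"
  shows "(\<lambda>n. gact \<mu> \<phi> (h n) x) \<longlonglongrightarrow> gact \<mu> \<phi> f x"
proof -
  note [measurable] = wdom_measurable[OF h] wdom_measurable[OF f]
  show ?thesis
    unfolding gact_eq[OF wdom_measurable[OF h]] gact_eq[OF wdom_measurable[OF f]]
  proof (rule integral_dominated_convergence[where w="\<lambda>g. C * cmod (\<phi> g)"])
    show "integrable \<nu> (\<lambda>g. C * cmod (\<phi> g))" using \<phi>_integrable by simp
    show "AE g in \<nu>. (\<lambda>n. \<phi> g * h n (adj2 g *v x)) \<longlonglongrightarrow> \<phi> g * f (adj2 g *v x)"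
    proof (rule AE_I2)
      fix g
      show "(\<lambda>n. \<phi> g * h n (adj2 g *v x)) \<longlonglongrightarrow> \<phi> g * f (adj2 g *v x)"
      proof (cases "g \<in> K")
        case True
        have "adj2 g *v x \<noteq> 0"
        proof
          assume "adj2 g *v x = 0"
          then have "g *v (adj2 g *v x) = 0" by (simp add: matrix_vector_2 vec_eq_iff forall_2)
          then show False using adj2_mv_SL2(2)[OF comm, of g x] True K x by auto
        qed
        then show ?thesis by (intro tendsto_intros lim)
      qed (simp add: \<phi>_0)
    qed
    show "AE g in \<nu>. cmod (\<phi> g * h n (adj2 g *v x)) \<le> C * cmod (\<phi> g)" for n
      using wdom_bounded[OF h] by (intro AE_I2) (auto simp: norm_mult mult.commute[of C] intro!: mult_left_mono)
  qed measurable
qed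

text \<open>The support lies in the compact set of all products of K with the support of f, which
  misses 0 because the elements of K are invertible.\<close>

lemma gact_CcV:
  assumes f: "f \<in> CcV"
  shows "gact \<mu> \<phi> f \<in> CcV"
proof -
  obtain C where C: "f \<in> wdom C" using modfuns_wdom[OF CcV_modfuns[OF f]] by blast
  have fc: "continuous_on UNIV f" by (rule Cc_continuous[OF f]) auto
  obtain S where S: "S \<subseteq> - {0}" "compact S" "\<And>x. x \<notin> S \<Longrightarrow> f x = 0" using f by (auto simp: Cc_def)
  define T where "T = (\<lambda>(g, y). g *v y) ` (K \<times> S)"
  have "compact T" unfolding T_def using K S
    by (intro compact_continuous_image compact_Times) (auto simp: split_beta intro!: continuous_intros)
  moreover have "T \<subseteq> - {0}"
  proof
    fix z assume "z \<in> T"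
    then obtain g y where gy: "g \<in> K" "y \<in> S" "z = g *v y" by (auto simp: T_def)
    have "y = adj2 g *v z" using adj2_mv_SL2(1)[OF comm, of g y] gy K by auto
    then have "y = 0" if "z = 0" using that by (simp only: matrix_vector_mult_0_right)
    then show "z \<in> - {0}" using gy S by auto
  qed
  moreover have "gact \<mu> \<phi> f x = 0" if x: "x \<notin> T" for x
  proof -
    have "\<phi> g * f (adj2 g *v x) = 0" for g
    proof (cases "g \<in> K")
      case True
      have "x = g *v (adj2 g *v x)" using adj2_mv_SL2(2)[OF comm, of g x] True K by auto
      moreover have "g *v y \<in> T" if "y \<in> S" for y
        unfolding T_def using True that by (intro image_eqI[of _ _ "(g, y)"]) auto
      ultimately have "adj2 g *v x \<notin> S" using x by metis
      then show ?thesis using S by simp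
    qed (simp add: \<phi>_0)
    then have "(\<lambda>g. \<phi> g * f (adj2 g *v x)) = (\<lambda>g. 0)" by (rule ext)
    then show ?thesis by (simp add: gact_eq[OF wdom_measurable[OF C]] del: mult_eq_0_iff)
  qed
  ultimately show ?thesis
    unfolding Cc_def using gact_continuous[OF C fc] continuous_on_subset by blast
qed

lemma pairing_gact:
  assumes f: "f \<in> wdom C" and k: "k \<in> wdom D"
  shows "pairing (gact \<mu> \<phi> f) k \<alpha> = (\<integral>g. cnj (\<phi> g) * pairing (\<lambda>x. f (adj2 g *v x)) k \<alpha> \<partial>\<nu>)"
proof -
  note [measurable] = wdom_measurable[OF f] wdom_measurable[OF k]
  interpret P: pair_sigma_finite \<nu> lborel ..
  obtain R where R: "R \<ge> 0" "\<And>g x. cmod (\<phi> g * f (adj2 g *v x)) \<le> (C * R * W2 x) * cmod (\<phi> g)"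
    using gact_integrand_bound f by blast
  define h where "h g x = cnj (\<phi> g) * (cnj (f (adj2 g *v x)) * k (rsmult x \<alpha>))" for g x
  have hm[measurable]: "case_prod h \<in> borel_measurable (\<nu> \<Otimes>\<^sub>M lborel)" unfolding h_def by measurable
  have "integrable (\<nu> \<Otimes>\<^sub>M lborel) (case_prod h)"
  proof (rule P.integrable_pair_bound)
    show "integrable \<nu> (\<lambda>g. cmod (\<phi> g))" using \<phi>_integrable by simp
    show "integrable lborel (\<lambda>x::'f^2. C * R * W2 x * D)"
      unfolding W2_def by (intro integrable_mult_left integrable_mult_right integrable_wt) simp
    fix g x
    have "cmod (h g x) = cmod (\<phi> g * f (adj2 g *v x)) * cmod (k (rsmult x \<alpha>))" by (simp add: h_def norm_mult)
    also have "\<dots> \<le> ((C * R * W2 x) * cmod (\<phi> g)) * D"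
      using R wdom_bounded[OF k] wdom_nonneg[OF f] by (intro mult_mono) auto
    finally show "norm (case_prod h (g, x)) \<le> cmod (\<phi> g) * (C * R * W2 x * D)" by (simp add: mult_ac)
  qed (rule hm)
  note Fub = P.Fubini_integral[OF this]
  have "pairing (gact \<mu> \<phi> f) k \<alpha> = norm \<alpha> ^ DIM('f) * (\<integral>x. (\<integral>g. h g x \<partial>\<nu>) \<partial>lborel)"
    unfolding pairing_def
  proof (intro arg_cong[where f="(*) _"] Bochner_Integration.integral_cong refl)
    fix x
    have "cnj (gact \<mu> \<phi> f x) = (\<integral>g. cnj (\<phi> g * f (adj2 g *v x)) \<partial>\<nu>)"
      unfolding gact_eq[OF wdom_measurable[OF f]] by (rule Bochner_Integration.integral_cnj[symmetric])
    then have "cnj (gact \<mu> \<phi> f x) * k (rsmult x \<alpha>) = (\<integral>g. cnj (\<phi> g * f (adj2 g *v x)) * k (rsmult x \<alpha>) \<partial>\<nu>)"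
      by (simp only: integral_mult_left_zero)
    then show "cnj (gact \<mu> \<phi> f x) * k (rsmult x \<alpha>) = (\<integral>g. h g x \<partial>\<nu>)"
      by (simp add: h_def mult.assoc)
  qed
  also have "\<dots> = norm \<alpha> ^ DIM('f) * (\<integral>g. (\<integral>x. h g x \<partial>lborel) \<partial>\<nu>)" by (simp only: Fub)
  also have "\<dots> = (\<integral>g. cnj (\<phi> g) * pairing (\<lambda>x. f (adj2 g *v x)) k \<alpha> \<partial>\<nu>)"
  proof -
    have "(\<integral>x. h g x \<partial>lborel) = cnj (\<phi> g) * (\<integral>x. cnj (f (adj2 g *v x)) * k (rsmult x \<alpha>) \<partial>lborel)" for g
      unfolding h_def by (rule integral_mult_right_zero)
    then show ?thesis
      unfolding pairing_def by (simp only: integral_mult_right_zero[symmetric] mult.left_commute)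
  qed
  finally show ?thesis .
qed

text \<open>Equivariance of the transform and the pairing formula are applied under the integral
  over g. In this way neither the regularity nor the transform of the averaged function
  \<open>gact \<mu> \<phi> f\<close> enters.\<close>

lemma pairing_gact_fourier_w:
  assumes f: "f \<in> schwartz" and k: "k \<in> schwartz"
  shows "pairing (gact \<mu> \<phi> (fourier_w f)) (fourier_w k) \<alpha> = pairing (gact \<mu> \<phi> f) k (inverse \<alpha>)"
proof (cases "\<alpha> = 0")
  case True
  then show ?thesis by (simp add: pairing_def)
next
  case False
  obtain C D C' D' where C: "f \<in> wdom C" "k \<in> wdom D" "fourier_w f \<in> wdom C'" "fourier_w k \<in> wdom D'"
    using modfuns_wdom[OF schwartz_modfuns] f k fourier_w_schwartz by metis
  note [measurable] = wdom_measurable[OF C(1)]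
  show ?thesis
    unfolding pairing_gact[OF C(3,4)] pairing_gact[OF C(1,2)]
  proof (intro Bochner_Integration.integral_cong refl)
    fix g
    show "cnj (\<phi> g) * pairing (\<lambda>x. fourier_w f (adj2 g *v x)) (fourier_w k) \<alpha> = cnj (\<phi> g) * pairing (\<lambda>x. f (adj2 g *v x)) k (inverse \<alpha>)"
    proof (cases "g \<in> K")
      case True
      then have g: "g \<in> SL2" using K by auto
      have "integrable lborel (\<lambda>x. f (adj2 g *v x))"
        using integrable_preserves_lborel[OF preserves_lborel_SL2[OF comm adj2_SL2[OF comm g]], of f] wdom_integrable[OF C(1)] by simp
      then show ?thesis
        by (simp add: fourier_w_adj2[OF comm g, symmetric] pairing_fourier_w[OF comm _ k False])
    qed (simp add: \<phi>_0)
  qed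
qed

end

lemma (in left_action) lact_diff_right: "lact b (x - y) = lact b x - lact b y"
  using lact_add_right[of b x "(- 1) *\<^sub>C y"] lact_scaleC_right[of b "-1" y] by (simp add: scaleC_minus1)

lemma (in left_action) lact_diff_left: "lact (b - c) x = lact b x - lact c x"
  using lact_add_left[of b "(- 1) *\<^sub>C c" x] lact_scaleC_left[of "-1" c x] by (simp add: scaleC_minus1)

lemma (in left_action) lact_tendsto_right: "u \<longlonglongrightarrow> x \<Longrightarrow> (\<lambda>n. lact b (u n)) \<longlonglongrightarrow> lact b x"
proof -
  assume u: "u \<longlonglongrightarrow> x"
  have "(\<lambda>n. norm b * norm (u n - x)) \<longlonglongrightarrow> norm b * norm (x - x)" by (intro tendsto_intros u)
  then have lim: "(\<lambda>n. norm b * norm (u n - x)) \<longlonglongrightarrow> 0" by simp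
  have "(\<lambda>n. norm (lact b (u n) - lact b x)) \<longlonglongrightarrow> 0"
    by (rule tendsto_sandwich[OF _ _ tendsto_const lim])
      (auto intro!: always_eventually lact_norm simp: lact_diff_right[symmetric])
  then show ?thesis by (simp add: tendsto_norm_zero_iff LIM_zero_iff)
qed

lemma (in left_action) lact_tendsto_left: "b \<longlonglongrightarrow> c \<Longrightarrow> (\<lambda>n. lact (b n) x) \<longlonglongrightarrow> lact c x"
proof -
  assume b: "b \<longlonglongrightarrow> c"
  have "(\<lambda>n. norm (b n - c) * norm x) \<longlonglongrightarrow> norm (c - c) * norm x" by (intro tendsto_intros b)
  then have lim: "(\<lambda>n. norm (b n - c) * norm x) \<longlonglongrightarrow> 0" by simp
  have "(\<lambda>n. norm (lact (b n) x - lact c x)) \<longlonglongrightarrow> 0"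
    by (rule tendsto_sandwich[OF _ _ tendsto_const lim])
      (auto intro!: always_eventually lact_norm simp: lact_diff_left[symmetric])
  then show ?thesis by (simp add: tendsto_norm_zero_iff LIM_zero_iff)
qed

context ps_module
begin

text \<open>The action is prescribed on \<open>CcV\<close>, and for Schwartz f the averaged function
  is not shown to lie in \<open>modfuns\<close>. Its class is identified through pairings with
  Schwartz functions, as a limit along cutoffs of f.\<close>

lemma ip_lact:
  assumes comm: "\<And>x y::'f. x * y = y * x" and haar: "is_haarG \<mu>"
    and L: "left_action act ip \<iota> \<mu> jr lact" and phi: "\<phi> \<in> Cc SL2"
    and f: "f \<in> schwartz" and k: "k \<in> schwartz"
  shows "ip (lact (jr \<phi>) (\<iota> f)) (\<iota> k) = j (pairing (gact \<mu> \<phi> f) k)"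
proof -
  interpret left_action act ip \<iota> \<mu> jr lact by fact
  obtain K where "compact K" "K \<subseteq> SL2" "\<And>g. g \<notin> K \<Longrightarrow> \<phi> g = 0" "continuous_on SL2 \<phi>"
    using phi by (auto simp: Cc_def)
  then interpret G: comm_G_integral \<mu> \<phi> K by unfold_locales (use comm haar in auto)
  obtain C D where C: "f \<in> wdom C" and D: "k \<in> wdom D"
    using modfuns_wdom[OF schwartz_modfuns] f k by metis
  obtain R where R: "R \<ge> 0" "\<And>f C. f \<in> wdom C \<Longrightarrow> gact \<mu> \<phi> f \<in> wdom (C * R)" using G.gact_wdom by blast
  obtain h where h: "\<And>n. h n \<in> CcV" "\<And>n. h n \<in> wdom C" "\<And>x. x \<noteq> 0 \<Longrightarrow> (\<lambda>n. h n x) \<longlonglongrightarrow> f x" "(\<lambda>n. \<iota> (h n)) \<longlonglongrightarrow> \<iota> f"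
    using CcV_sequence[OF schwartz_modfuns[OF f] C] by metis
  have "ip (lact (jr \<phi>) (\<iota> (h n))) (\<iota> k) = j (pairing (gact \<mu> \<phi> (h n)) k)" for n
    by (simp add: lact_gact[OF phi h(1)] \<iota>_ip CcV_modfuns[OF G.gact_CcV[OF h(1)]] schwartz_modfuns[OF k])
  moreover have "(\<lambda>n. ip (lact (jr \<phi>) (\<iota> (h n))) (\<iota> k)) \<longlonglongrightarrow> ip (lact (jr \<phi>) (\<iota> f)) (\<iota> k)"
    by (intro ip_tendsto lact_tendsto_right h tendsto_const)
  moreover have "(\<lambda>n. j (pairing (gact \<mu> \<phi> (h n)) k)) \<longlonglongrightarrow> j (pairing (gact \<mu> \<phi> f) k)"
  proof (rule is_cstarL_tendsto[OF cstarL pairing_L1L(1)[OF R(2)[OF h(2)] D] pairing_L1L(1)[OF R(2)[OF C] D]])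
    have "(\<lambda>n. \<integral>l. cmod (pairing (\<lambda>x. gact \<mu> \<phi> (h n) x - gact \<mu> \<phi> f x) k l) \<partial>haarL) \<longlonglongrightarrow> 0"
    proof (rule pairing_L1_tendsto_0[OF wdom_diff[OF R(2)[OF h(2)] R(2)[OF C]] D])
      fix x :: "'f^2" assume "x \<noteq> 0"
      then show "(\<lambda>n. gact \<mu> \<phi> (h n) x - gact \<mu> \<phi> f x) \<longlonglongrightarrow> 0"
        using G.gact_tendsto[OF h(2) C h(3)] by (simp add: LIM_zero_iff)
    qed
    then show "(\<lambda>n. \<integral>l. cmod (pairing (gact \<mu> \<phi> (h n)) k l - pairing (gact \<mu> \<phi> f) k l) \<partial>haarL) \<longlonglongrightarrow> 0"
      by (simp add: pairing_diff_left[OF R(2)[OF h(2)] R(2)[OF C] D])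
  qed
  ultimately show ?thesis using LIMSEQ_unique by simp
qed

lemma unitary_commutes_lact:
  assumes comm: "\<And>x y::'f. x * y = y * x" and tw: "weyl_twist j tw" and haar: "is_haarG \<mu>"
    and red: "is_cstar_redG \<mu> jr" and L: "left_action act ip \<iota> \<mu> jr lact"
    and U\<iota>: "\<And>f. f \<in> schwartz \<Longrightarrow> U (\<iota> f) = \<iota> (fourier_w f)"
    and U_lim: "\<And>u x. u \<longlonglongrightarrow> x \<Longrightarrow> (\<lambda>n. U (u n)) \<longlonglongrightarrow> U x"
    and iso: "module_isometry (act_w tw act) (ip_w tw ip) act ip U"
    and UU: "\<And>x. U (U x) = x"
  shows "U (lact b \<xi>) = lact b (U \<xi>)"
proof -
  interpret left_action act ip \<iota> \<mu> jr lact by fact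
  interpret weyl_twist j tw by fact
  interpret red: cstar_completion "Cc SL2" "convG \<mu>" starG "reduced_normG \<mu>" jr by fact
  have ipU: "ip (U x) (U y) = tw (ip x y)" for x y using iso by (simp add: module_isometry_def ip_w_def)
  have 1: "U (lact (jr \<phi>) (\<iota> f)) = lact (jr \<phi>) (U (\<iota> f))" if phi: "\<phi> \<in> Cc SL2" and f: "f \<in> schwartz" for \<phi> f
  proof -
    obtain K where "compact K" "K \<subseteq> SL2" "\<And>g. g \<notin> K \<Longrightarrow> \<phi> g = 0" "continuous_on SL2 \<phi>"
      using phi by (auto simp: Cc_def)
    then interpret G: comm_G_integral \<mu> \<phi> K by unfold_locales (use comm haar in auto)
    \<comment> \<open>The defect of commutation. It vanishes once it is orthogonal to the vectors
      \<open>U (\<iota> k)\<close>, which are dense because U is onto.\<close>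
    define X where "X = U (lact (jr \<phi>) (\<iota> f)) - lact (jr \<phi>) (U (\<iota> f))"
    have X: "ip X (U (\<iota> k)) = 0" if k: "k \<in> schwartz" for k
    proof -
      obtain C D where C: "f \<in> wdom C" and D: "k \<in> wdom D"
        using modfuns_wdom[OF schwartz_modfuns] f k by metis
      obtain R where R: "gact \<mu> \<phi> f \<in> wdom (C * R)" using G.gact_wdom C by blast
      have "ip (U (lact (jr \<phi>) (\<iota> f))) (U (\<iota> k)) = tw (j (pairing (gact \<mu> \<phi> f) k))"
        by (simp add: ipU ip_lact[OF comm haar L phi f k])
      also have "\<dots> = j (\<lambda>\<alpha>. pairing (gact \<mu> \<phi> f) k (inverse \<alpha>))"
        by (intro tw_j_L1L[OF cstarL] pairing_L1L[OF R D] 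
          continuous_on_subset[OF pairing_continuous[OF wdom_integrable[OF R] schwartz_continuous[OF k] wdom_bounded[OF D]]]) auto
      also have "\<dots> = j (pairing (gact \<mu> \<phi> (fourier_w f)) (fourier_w k))"
        by (simp add: G.pairing_gact_fourier_w[OF f k, symmetric])
      also have "\<dots> = ip (lact (jr \<phi>) (U (\<iota> f))) (U (\<iota> k))"
        by (simp add: U\<iota> f k ip_lact[OF comm haar L phi fourier_w_schwartz[OF f] fourier_w_schwartz[OF k]])
      finally show ?thesis by (simp add: X_def ip_diff_left)
    qed
    have "ip X z = 0" for z
    proof -
      \<comment> \<open>Approximating U z instead of z makes \<open>U (\<iota> (k n))\<close>
        converge to U (U z) = z.\<close>
      obtain k where k: "\<And>n. k n \<in> schwartz" "(\<lambda>n. \<iota> (k n)) \<longlonglongrightarrow> U z" using schwartz_sequence by metis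
      have "(\<lambda>n. ip X (U (\<iota> (k n)))) \<longlonglongrightarrow> ip X (U (U z))" by (intro ip_tendsto tendsto_const U_lim k)
      then show ?thesis using X[OF k(1)] UU[of z] LIMSEQ_unique[OF _ tendsto_const] by simp
    qed
    then have "X = 0" by (intro ip_self_eq_0)
    then show ?thesis by (simp add: X_def)
  qed
  have 2: "U (lact (jr \<phi>) x) = lact (jr \<phi>) (U x)" if phi: "\<phi> \<in> Cc SL2" for \<phi> x
  proof -
    obtain f where f: "\<And>n. f n \<in> schwartz" "(\<lambda>n. \<iota> (f n)) \<longlonglongrightarrow> x" using schwartz_sequence by metis
    show ?thesis
      using U_lim[OF lact_tendsto_right[OF f(2), of "jr \<phi>"]] lact_tendsto_right[OF U_lim[OF f(2)], of "jr \<phi>"]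
        1[OF phi f(1)] LIMSEQ_unique by simp
  qed
  have "b \<in> closure (jr ` Cc SL2)" by (simp add: red.j_dense)
  then obtain u where u: "\<And>n. u n \<in> jr ` Cc SL2" "u \<longlonglongrightarrow> b" unfolding closure_sequential by blast
  have "U (lact (u n) \<xi>) = lact (u n) (U \<xi>)" for n using u(1)[of n] 2 by auto
  then show ?thesis
    using U_lim[OF lact_tendsto_left[OF u(2), of \<xi>]] lact_tendsto_left[OF u(2), of "U \<xi>"] LIMSEQ_unique by simp
qed

end

section \<open>The composition with the intertwining integral\<close>

lemma nbar_eq: "nbar t = mat2 1 0 t 1"
  by (simp add: nbar_def mat2_eq_iff)

lemma column_weyl_nbar: "column 1 (g ** weyl ** nbar t) = (g::'f::rch^2^2) *v vec2 (- t) 1"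
  by (simp add: weyl_eq nbar_eq matrix_matrix_2 matrix_vector_2 column_def vec_eq_iff forall_2)

lemma column_1_rsmult: "g *v vec2 s 0 = rsmult (column 1 g) (s::'f::rch)"
  by (simp add: matrix_vector_2 column_def vec_eq_iff forall_2)

text \<open>From (1 + |a|^2)(1 + |b|^2) \<le> (1 + |a|^2 + |b|^2)^2: the order 2d of
  \<open>W2\<close> splits into d for each coordinate, which is enough for integrability on
  F.\<close>

lemma W2_vec2_le: "W2 (vec2 a b :: 'f::rch^2) \<le> wt DIM('f) a * wt DIM('f) b"
proof -
  have p: "1 + (norm a)\<^sup>2 > 0" "1 + (norm b)\<^sup>2 > 0" "1 + (norm (vec2 a b))\<^sup>2 > 0" by (simp_all add: add_pos_nonneg)
  have "(norm (vec2 a b))\<^sup>2 = (norm a)\<^sup>2 + (norm b)\<^sup>2" by (simp add: norm_vec_2)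
  then have "(1 + (norm a)\<^sup>2) * (1 + (norm b)\<^sup>2) \<le> (1 + (norm (vec2 a b))\<^sup>2)\<^sup>2"
    using zero_le_power2[of "(norm a)\<^sup>2"] zero_le_power2[of "(norm b)\<^sup>2"] mult_nonneg_nonneg[of "(norm a)\<^sup>2" "(norm b)\<^sup>2"]
    by (simp add: power2_eq_square[of "1 + _"] algebra_simps)
  then have "((1 + (norm a)\<^sup>2) * (1 + (norm b)\<^sup>2)) ^ DIM('f) \<le> ((1 + (norm (vec2 a b))\<^sup>2)\<^sup>2) ^ DIM('f)"
    using p by (intro power_mono) auto
  then have le: "(1 + (norm a)\<^sup>2) ^ DIM('f) * (1 + (norm b)\<^sup>2) ^ DIM('f) \<le> (1 + (norm (vec2 a b))\<^sup>2) ^ DIM('f^2)"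
    by (simp add: power_mult_distrib power_mult[symmetric] mult.commute)
  have "1 / Z \<le> 1 / X * (1 / Y)" if "X * Y \<le> Z" "X > 0" "Y > 0" for X Y Z :: real
    using frac_le[OF _ _ _ that(1), of 1 1] that by simp
  from this[OF le] show ?thesis unfolding W2_def wt_def using p by simp
qed

lemma W2_adj2:
  fixes g :: "'f::rch^2^2"
  assumes comm: "\<And>x y::'f. x * y = y * x" and g: "g \<in> SL2"
  obtains c where "c \<ge> 0" "\<And>v. W2 (g *v v) \<le> c * W2 v"
proof
  define R where "R = max 1 (entry_norm (adj2 g))"
  show "0 \<le> (R\<^sup>2) ^ DIM('f^2)" by simp
  fix v
  have "norm v = norm (adj2 g *v (g *v v))" by (simp add: adj2_mv_SL2[OF comm g])
  also have "\<dots> \<le> entry_norm (adj2 g) * norm (g *v v)" by (rule norm_matrix_vector_le)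
  also have "\<dots> \<le> R * norm (g *v v)" by (intro mult_right_mono) (auto simp: R_def)
  finally show "W2 (g *v v) \<le> (R\<^sup>2) ^ DIM('f^2) * W2 v" by (intro W2_le_scaled) (simp_all add: R_def)
qed

lemma borel_measurable_re [measurable]: "(re :: 'f::rch \<Rightarrow> real) \<in> borel_measurable borel"
  unfolding re_def by measurable

lemma continuous_on_re [continuous_intros]: "continuous_on S f \<Longrightarrow> continuous_on S (\<lambda>x. re (f x :: 'f::rch))"
  unfolding re_def by (intro continuous_intros)

text \<open>In the coordinates \<open>y = g(\<lambda>, \<mu>)\<close> the transform of \<open>f\<close> along the line
  \<open>g(-t, 1)\<close> is the Fourier transform of the partial integral \<open>\<Phi>(\<mu>)\<close>; hence the integral over
  \<open>t\<close> is \<open>\<Phi>(0)\<close> by Fourier inversion on \<open>F\<close>.\<close>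

lemma interw_fourier_w:
  fixes f :: "'f::rch^2 \<Rightarrow> complex"
  assumes comm: "\<And>x y::'f. x * y = y * x" and f: "f \<in> schwartz" and g: "g \<in> SL2"
  shows "integrable lborel (\<lambda>t. fourier_w f (column 1 (g ** weyl ** nbar t)))"
    and "interw (fourier_w f) g = (\<integral>s. ee (re s) * f (rsmult (column 1 g) s) \<partial>lborel)"
    and "integrable lborel (\<lambda>s. ee (re s) * f (rsmult (column 1 g) s))"
proof -
  define h where "h = fourier_w f"
  have hs: "h \<in> schwartz" unfolding h_def by (rule fourier_w_schwartz[OF f])
  obtain C D where C: "f \<in> wdom C" and D: "h \<in> wdom D"
    using modfuns_wdom[OF schwartz_modfuns] f hs by metis
  note [measurable] = wdom_measurable[OF C] wdom_measurable[OF D]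
  have fc: "continuous_on UNIV f" using f by (rule schwartz_continuous)
  obtain c where c: "c \<ge> 0" "\<And>v. W2 (g *v v) \<le> c * W2 v" using W2_adj2[OF comm g] by metis
  define w where "w = (wt DIM('f) :: 'f \<Rightarrow> real)"
  have [measurable]: "w \<in> borel_measurable borel" unfolding w_def by measurable
  have w: "0 \<le> w a" "w a \<le> 1" for a by (simp_all only: w_def wt_nonneg wt_le_1)
  have wi: "integrable lborel w" unfolding w_def by (rule integrable_wt) simp
  have bound: "cmod (u (g *v vec2 a b)) \<le> E * c * w a * w b" if u: "u \<in> wdom E" for u E a b
  proof -
    have "cmod (u (g *v vec2 a b)) \<le> E * W2 (g *v vec2 a b)" by (rule wdomD[OF u])
    also have "\<dots> \<le> E * (c * (w a * w b))"
      unfolding w_def using c wdom_nonneg[OF u]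
      by (intro mult_left_mono order_trans[OF c(2)] W2_vec2_le) auto
    finally show ?thesis by (simp add: mult_ac)
  qed
  have hi: "integrable lborel (\<lambda>t. h (g *v vec2 (- t) 1))"
  proof (rule Bochner_Integration.integrable_bound)
    show "integrable lborel (\<lambda>t. D * c * w t)" using wi by simp
    show "AE t in lborel. norm (h (g *v vec2 (- t) 1)) \<le> norm (D * c * w t)"
    proof (rule AE_I2)
      fix t
      have "cmod (h (g *v vec2 (- t) 1)) \<le> D * c * w (- t) * w 1" by (rule bound[OF D])
      also have "\<dots> \<le> D * c * w t * 1"
        using c w wdom_nonneg[OF D] by (intro mult_mono) (auto simp: w_def wt_def)
      finally show "norm (h (g *v vec2 (- t) 1)) \<le> norm (D * c * w t)" by simp
    qed
  qed measurable
  then show "integrable lborel (\<lambda>t. fourier_w f (column 1 (g ** weyl ** nbar t)))"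
    by (simp add: column_weyl_nbar h_def)
  define \<Phi> where "\<Phi> b = (\<integral>a. ee (re a) * f (g *v vec2 a b) \<partial>lborel)" for b
  have ib: "integrable lborel (\<lambda>a. ee (re a) * f (g *v vec2 a b))" for b
  proof (rule Bochner_Integration.integrable_bound)
    show "integrable lborel (\<lambda>a. C * c * w a * w b)" using wi by simp
    show "AE a in lborel. norm (ee (re a) * f (g *v vec2 a b)) \<le> norm (C * c * w a * w b)"
      by (intro AE_I2) (auto simp: norm_mult intro!: order_trans[OF bound[OF C] abs_ge_self[THEN order_trans]] simp: abs_mult)
  qed measurable
  from ib[of 0] show "integrable lborel (\<lambda>s. ee (re s) * f (rsmult (column 1 g) s))"
    by (simp add: column_1_rsmult)
  have \<Phi>_cont: "continuous_on UNIV \<Phi>"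
    unfolding continuous_on_sequentially o_def \<Phi>_def
  proof (intro allI ballI impI, elim conjE)
    fix u :: "nat \<Rightarrow> 'f" and b assume u: "u \<longlonglongrightarrow> b"
    show "(\<lambda>n. \<integral>a. ee (re a) * f (g *v vec2 a (u n)) \<partial>lborel) \<longlonglongrightarrow> (\<integral>a. ee (re a) * f (g *v vec2 a b) \<partial>lborel)"
    proof (rule integral_dominated_convergence[where w="\<lambda>a. C * c * w a"])
      show "integrable lborel (\<lambda>a. C * c * w a)" using wi by simp
      show "AE a in lborel. (\<lambda>n. ee (re a) * f (g *v vec2 a (u n))) \<longlonglongrightarrow> ee (re a) * f (g *v vec2 a b)"
      proof (rule AE_I2)
        fix a
        have "continuous_on UNIV (\<lambda>b. f (g *v vec2 a b))"
          by (rule continuous_on_compose2[OF fc]) (auto intro!: continuous_intros)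
        then have "(\<lambda>n. f (g *v vec2 a (u n))) \<longlonglongrightarrow> f (g *v vec2 a b)"
          by (rule continuous_on_tendsto_compose[OF _ u]) auto
        then show "(\<lambda>n. ee (re a) * f (g *v vec2 a (u n))) \<longlonglongrightarrow> ee (re a) * f (g *v vec2 a b)" by (intro tendsto_intros)
      qed
      show "AE a in lborel. cmod (ee (re a) * f (g *v vec2 a (u n))) \<le> C * c * w a" for n
      proof (rule AE_I2)
        fix a
        have "cmod (f (g *v vec2 a (u n))) \<le> C * c * w a * w (u n)" by (rule bound[OF C])
        also have "\<dots> \<le> C * c * w a * 1" using c w wdom_nonneg[OF C] by (intro mult_left_mono) auto
        finally show "cmod (ee (re a) * f (g *v vec2 a (u n))) \<le> C * c * w a" by (simp add: norm_mult)
      qed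
    qed measurable
  qed
  have [measurable]: "\<Phi> \<in> borel_measurable borel" using \<Phi>_cont by (rule borel_measurable_continuous_onI)
  define I where "I = (\<integral>a. w a \<partial>lborel)"
  have \<Phi>_bound: "cmod (\<Phi> b) \<le> C * c * I * w b" for b
  proof -
    have "cmod (\<Phi> b) \<le> (\<integral>a. (C * c * w b) * w a \<partial>lborel)"
      unfolding \<Phi>_def using wi
      by (intro Bochner_Integration.integral_norm_bound_integral ib) (auto simp: norm_mult intro!: order_trans[OF bound[OF C]])
    then show ?thesis by (simp add: I_def mult_ac)
  qed
  have I: "0 \<le> I" unfolding I_def using w by (intro integral_nonneg_AE) auto
  have \<Phi>_i: "integrable lborel \<Phi>"
    by (rule Bochner_Integration.integrable_bound[of _ "\<lambda>b. C * c * I * w b"])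
      (use wi in \<open>auto intro!: AE_I2 order_trans[OF \<Phi>_bound] abs_ge_self\<close>)
  have \<Phi>_b: "cmod (\<Phi> b) \<le> C * c * I" for b
  proof -
    have "C * c * I * w b \<le> C * c * I * 1" using w c I wdom_nonneg[OF C] by (intro mult_left_mono) auto
    then show ?thesis using \<Phi>_bound[of b] by simp
  qed
  have key: "h (g *v vec2 (- t) 1) = fourier \<Phi> (cjg t)" for t
  proof -
    define H where "H y = ee (inner (kk (g *v vec2 (- t) 1)) y) * f y" for y
    have [measurable]: "H \<in> borel_measurable borel" unfolding H_def by measurable
    define G where "G a b = ee (re a) * (ee (inner (cjg t) b) * f (g *v vec2 a b))" for a b
    \<comment> \<open>Invariance of the form removes g from the phase. For (-t, 1) against (a, b)
      the phase is Re a + Re(t b), which separates the two variables.\<close>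
    have k: "inner (kk (g *v v)) (g *v y) = inner (kk v) y" for v y
      using inner_kk_adj2[OF comm, of "adj2 g" v "g *v y"] by (simp add: adj2_mv_SL2[OF comm g])
    have G: "H (g *v vec2 a b) = G a b" for a b
      unfolding H_def k unfolding inner_kk by (simp add: G_def re_mult[symmetric] re_minus ee_add mult_ac)
    have Hi: "integrable lborel H" unfolding H_def by (intro integrable_ee_mult wdom_integrable[OF C]) measurable
    have Gi: "integrable (lborel \<Otimes>\<^sub>M lborel) (\<lambda>(a, b). G a b)"
    proof -
      have "integrable lborel (\<lambda>v. H (g *v v))"
        using integrable_preserves_lborel[OF preserves_lborel_SL2[OF comm g], of H] Hi by simp
      then have "integrable lborel (\<lambda>(a, b). H (g *v vec2 a b))"
        by (subst integrable_vec2) auto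
      then show ?thesis by (simp add: G lborel_prod)
    qed
    have "h (g *v vec2 (- t) 1) = (\<integral>y. H y \<partial>lborel)" by (simp add: h_def fourier_w_eq fourier_def H_def)
    also have "\<dots> = (\<integral>y. H (g *v y) \<partial>lborel)"
      by (rule integral_preserves_lborel[OF preserves_lborel_SL2[OF comm g], symmetric]) measurable
    also have "\<dots> = (\<integral>(a, b). G a b \<partial>(lborel \<Otimes>\<^sub>M lborel))"
      by (subst integral_vec2[symmetric]) (auto simp: G lborel_prod)
    also have "\<dots> = (\<integral>b. (\<integral>a. G a b \<partial>lborel) \<partial>lborel)"
      by (rule lborel_pair.integral_snd[OF Gi, symmetric])
    also have "\<dots> = fourier \<Phi> (cjg t)"
      unfolding fourier_def \<Phi>_def integral_mult_right_zero[symmetric]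
      by (simp only: G_def mult.left_commute)
    finally show ?thesis .
  qed
  \<comment> \<open>Up to conjugation of the variable, \<open>fourier \<Phi>\<close> is the Schwartz
    function h along a line; its integrability comes from there and not from smoothness of
    \<Phi>.\<close>
  have F\<Phi>_i: "integrable lborel (fourier \<Phi>)"
    using hi integrable_similarity[OF linear_cjg, of 1 "fourier \<Phi>"] by (simp add: key)
  have "interw (fourier_w f) g = (\<integral>t. fourier \<Phi> (cjg t) \<partial>lborel)"
    unfolding interw_def column_weyl_nbar h_def[symmetric] key ..
  also have "\<dots> = (\<integral>\<xi>. ee (- inner \<xi> 0) * fourier \<Phi> \<xi> \<partial>lborel)"
    using integral_similarity[OF linear_cjg, of 1 "fourier \<Phi>"] by simp
  also have "\<dots> = \<Phi> 0" by (rule fourier_inversion[OF \<Phi>_cont \<Phi>_b \<Phi>_i F\<Phi>_i])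
  also have "\<dots> = (\<integral>s. ee (re s) * f (rsmult (column 1 g) s) \<partial>lborel)"
    by (simp add: \<Phi>_def column_1_rsmult)
  finally show "interw (fourier_w f) g = (\<integral>s. ee (re s) * f (rsmult (column 1 g) s) \<partial>lborel)" .
qed

text \<open>After inversion of l the factor |l|^-d of the action becomes |l|^d and cancels the
  density of Haar measure, so that Lebesgue measure remains.\<close>

lemma ract_ee:
  fixes f :: "'f::rch^2 \<Rightarrow> complex"
  assumes [measurable]: "f \<in> borel_measurable borel"
  defines "\<gamma> \<equiv> \<lambda>l. ee (re (inverse l))"
  shows "ract f \<gamma> x = (\<integral>s. ee (re s) * f (rsmult x s) \<partial>lborel)"
    and "integrable haarL (ract_integrand f \<gamma> x) \<longleftrightarrow> integrable lborel (\<lambda>s. ee (re s) * f (rsmult x s))"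
proof -
  define P where "P l = complex_of_real (norm l ^ DIM('f)) * (ee (re l) * f (rsmult x l))" for l
  have [measurable]: "P \<in> borel_measurable borel" unfolding P_def by measurable
  have r: "ract_integrand f \<gamma> x = (\<lambda>l. P (inverse l))"
    by (simp add: fun_eq_iff ract_integrand_def P_def \<gamma>_def norm_inverse power_inverse divide_inverse)
  have AE: "AE l in lborel. (1 / norm l ^ DIM('f)) *\<^sub>R P l = ee (re l) * f (rsmult x l)"
    using AE_lborel_singleton[of 0] by eventually_elim (simp add: P_def scaleR_conv_of_real)
  have "ract f \<gamma> x = (\<integral>l. P l \<partial>haarL)"
    unfolding ract_def r by (rule integral_haarL_inverse) measurable
  also have "\<dots> = (\<integral>l. (1 / norm l ^ DIM('f)) *\<^sub>R P l \<partial>lborel)" by (rule integral_haarL) measurable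
  also have "\<dots> = (\<integral>s. ee (re s) * f (rsmult x s) \<partial>lborel)" by (rule integral_cong_AE[OF _ _ AE]) measurable
  finally show "ract f \<gamma> x = (\<integral>s. ee (re s) * f (rsmult x s) \<partial>lborel)" .
  have "integrable haarL (ract_integrand f \<gamma> x) \<longleftrightarrow> integrable haarL P"
    unfolding r by (rule integrable_haarL_inverse) measurable
  also have "\<dots> \<longleftrightarrow> integrable lborel (\<lambda>l. (1 / norm l ^ DIM('f)) *\<^sub>R P l)" by (rule integrable_haarL) measurable
  also have "\<dots> \<longleftrightarrow> integrable lborel (\<lambda>s. ee (re s) * f (rsmult x s))" by (rule integrable_cong_AE[OF _ _ AE]) measurable
  finally show "integrable haarL (ract_integrand f \<gamma> x) \<longleftrightarrow> integrable lborel (\<lambda>s. ee (re s) * f (rsmult x s))" .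
qed

lemma (in ps_module) composition_acts_by_ee:
  assumes comm: "\<And>x y::'f. x * y = y * x"
    and U\<iota>: "\<And>f. f \<in> schwartz \<Longrightarrow> U (\<iota> f) = \<iota> (fourier_w f)"
  shows "composition_acts_by \<iota> U (\<lambda>l. ee (re (inverse l)))"
  unfolding composition_acts_by_def
proof (intro exI[of _ schwartz] conjI ballI)
  show "dense_subspace \<iota> schwartz"
    unfolding dense_subspace_def
    by (auto intro: schwartz_modfuns zero_schwartz schwartz_add schwartz_cmult simp: schwartz_dense)
  fix f :: "'f^2 \<Rightarrow> complex" assume f: "f \<in> schwartz"
  have fm: "f \<in> borel_measurable borel" by (intro rapid_measurable schwartz_imp_rapid f)
  show "\<exists>h\<in>interw_dom. U (\<iota> f) = \<iota> h \<and>
      (\<forall>g\<in>SL2. integrable haarL (ract_integrand f (\<lambda>l. ee (re (inverse l))) (column 1 g)) \<and>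
        interw h g = ract f (\<lambda>l. ee (re (inverse l))) (column 1 g))"
  proof (intro bexI[of _ "fourier_w f"] conjI ballI)
    show "fourier_w f \<in> interw_dom"
      unfolding interw_dom_def using interw_fourier_w(1)[OF comm f] schwartz_modfuns[OF fourier_w_schwartz[OF f]] by blast
    show "U (\<iota> f) = \<iota> (fourier_w f)" by (rule U\<iota>[OF f])
    fix g :: "'f^2^2" assume g: "g \<in> SL2"
    show "integrable haarL (ract_integrand f (\<lambda>l. ee (re (inverse l))) (column 1 g))"
      unfolding ract_ee(2)[OF fm] by (rule interw_fourier_w(3)[OF comm f g])
    show "interw (fourier_w f) g = ract f (\<lambda>l. ee (re (inverse l))) (column 1 g)"
      unfolding ract_ee(1)[OF fm] by (rule interw_fourier_w(2)[OF comm f g])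
  qed
qed

section \<open>A representation of \<open>L\<close> separating non-commuting scalars\<close>

text \<open>Cauchy-Schwarz applied to |A p|^2 = <p, A' A p> bounds the norm of A, and applied to |A'
  r|^2 it shows that A' has no larger norm than A.\<close>

lemma onorm_cstar_identity:
  fixes A A' :: "'h::real_inner \<Rightarrow> 'h"
  assumes A: "bounded_linear A" and A': "bounded_linear A'" and adj: "\<And>p r. inner (A p) r = inner p (A' r)"
  shows "onorm (A' \<circ> A) = (onorm A)\<^sup>2"
proof (rule antisym)
  have AA: "bounded_linear (A' \<circ> A)" unfolding o_def by (rule bounded_linear_compose[OF A' A])
  have pos: "0 \<le> onorm A" "0 \<le> onorm (A' \<circ> A)" by (rule onorm_pos_le[OF A], rule onorm_pos_le[OF AA])
  have "onorm A' \<le> onorm A"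
  proof (rule onorm_bound[OF pos(1)])
    fix r
    have "(norm (A' r))\<^sup>2 = inner (A (A' r)) r" by (simp add: power2_norm_eq_inner adj)
    also have "\<dots> \<le> norm (A (A' r)) * norm r" by (rule norm_cauchy_schwarz)
    also have "\<dots> \<le> (onorm A * norm (A' r)) * norm r" by (intro mult_right_mono onorm[OF A]) simp
    finally have "norm (A' r) * norm (A' r) \<le> norm (A' r) * (onorm A * norm r)" by (simp add: power2_eq_square mult_ac)
    then show "norm (A' r) \<le> onorm A * norm r"
      by (cases "A' r = 0") (auto simp: pos(1) mult_le_cancel_left)
  qed
  then show "onorm (A' \<circ> A) \<le> (onorm A)\<^sup>2"
    using onorm_compose[OF A' A] mult_right_mono[OF _ pos(1), of "onorm A'" "onorm A"] by (simp add: power2_eq_square)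
  have "onorm A \<le> sqrt (onorm (A' \<circ> A))"
  proof (rule onorm_bound)
    fix p
    have "(norm (A p))\<^sup>2 = inner p ((A' \<circ> A) p)" by (simp add: power2_norm_eq_inner adj)
    also have "\<dots> \<le> norm p * norm ((A' \<circ> A) p)" by (rule norm_cauchy_schwarz)
    also have "\<dots> \<le> norm p * (onorm (A' \<circ> A) * norm p)" by (intro mult_left_mono onorm[OF AA]) simp
    also have "\<dots> = (sqrt (onorm (A' \<circ> A)) * norm p)\<^sup>2"
      unfolding power_mult_distrib real_sqrt_pow2[OF pos(2)] by (simp add: power2_eq_square)
    finally show "norm (A p) \<le> sqrt (onorm (A' \<circ> A)) * norm p"
      by (rule power2_le_imp_le) (simp add: pos)
  qed (simp add: pos)
  then show "(onorm A)\<^sup>2 \<le> onorm (A' \<circ> A)" using pos by (metis power_mono real_sqrt_pow2)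
qed

text \<open>The pair \<open>(u, v)\<close> stands for \<open>u + iv\<close> in \<open>F \<otimes> \<complex>\<close>.\<close>

definition cs :: "complex \<Rightarrow> 'f::real_vector \<times> 'f \<Rightarrow> 'f \<times> 'f"
  where "cs c p = (Re c *\<^sub>R fst p - Im c *\<^sub>R snd p, Re c *\<^sub>R snd p + Im c *\<^sub>R fst p)"

definition ls :: "'f::times \<Rightarrow> 'f \<times> 'f \<Rightarrow> 'f \<times> 'f"
  where "ls s p = (s * fst p, s * snd p)"

lemma cs_cs: "cs c (cs d p) = cs (c * d) p"
  by (simp add: cs_def algebra_simps)

lemma ls_ls: "ls s (ls t p) = ls (s * t) (p :: 'f::rch \<times> 'f)"
  by (simp add: ls_def mult.assoc)

lemma ls_cs: "ls s (cs c p) = cs c (ls s (p :: 'f::rch \<times> 'f))"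
  by (simp add: ls_def cs_def algebra_simps)

lemma cs_of_real: "cs (complex_of_real r) p = r *\<^sub>R p"
  by (simp add: cs_def prod_eq_iff)

lemma norm_cs: "norm (cs c p) = cmod c * norm (p :: 'f::rch \<times> 'f)"
proof -
  have "inner (cs c p) (cs c p) = (cmod c)\<^sup>2 * inner p p"
    unfolding cmod_power2
    by (simp add: cs_def inner_prod_def inner_add_left inner_add_right inner_diff_left inner_diff_right
        inner_commute power2_eq_square algebra_simps)
  then show ?thesis by (simp add: norm_eq_sqrt_inner real_sqrt_mult)
qed

lemma norm_ls: "norm (ls s p) = norm s * norm (p :: 'f::rch \<times> 'f)"
  by (simp add: ls_def norm_prod_def norm_mult power_mult_distrib distrib_left[symmetric] real_sqrt_mult)

lemma bounded_linear_cs: "bounded_linear (cs c :: 'f::rch \<times> 'f \<Rightarrow> _)"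
  by (rule bounded_linear_intro[where K="cmod c"]) (simp add: cs_def algebra_simps, simp add: cs_def algebra_simps, simp add: norm_cs)

lemma bounded_linear_cs_left: "bounded_linear (\<lambda>c. cs c (p :: 'f::rch \<times> 'f))"
  by (rule bounded_linear_intro[where K="norm p"]) (simp add: cs_def algebra_simps, simp add: cs_def algebra_simps, simp add: norm_cs)

lemma bounded_linear_ls: "bounded_linear (ls s :: 'f::rch \<times> 'f \<Rightarrow> _)"
  by (rule bounded_linear_intro[where K="norm s"]) (simp add: ls_def algebra_simps, simp add: ls_def algebra_simps, simp add: norm_ls)

lemma inner_cs: "inner (cs c p) r = inner p (cs (cnj c) (r :: 'f::rch \<times> 'f))"
  by (simp add: cs_def inner_prod_def inner_add_left inner_add_right inner_diff_left inner_diff_right)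

lemma inner_ls:
  assumes "norm s = 1" shows "inner (ls s p) r = inner p (ls (inverse s) (r :: 'f::rch \<times> 'f))"
proof -
  have "s \<noteq> 0" using assms by auto
  then have e: "inner (s * a) b = inner a (inverse s * b)" for a b :: 'f
    using inner_mult_left_norm[of s a "inverse s * b"] assms by (simp add: mult.assoc[symmetric])
  show ?thesis by (simp add: ls_def inner_prod_def e)
qed

lemma sgn_inverse_rch: "sgn (inverse l) = inverse (sgn (l::'f::rch))"
  by (cases "l = 0") (simp_all add: sgn_div_norm norm_inverse nonzero_inverse_scaleR_distrib del: inverse_eq_divide)

lemma sgn_mult_rch: "sgn (m * l) = sgn m * sgn (l::'f::rch)"
  by (simp add: sgn_div_norm norm_mult)

lemma norm_sgn_le: "norm (sgn (l::'f::rch)) \<le> 1"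
  by (simp add: norm_sgn)

lemma borel_measurable_sgn_rch [measurable]: "(sgn :: 'f::rch \<Rightarrow> 'f) \<in> borel_measurable borel"
  unfolding sgn_div_norm by measurable

lemma borel_measurable_cs_ls [measurable (raw)]:
  fixes u :: "'a \<Rightarrow> 'f::rch"
  assumes [measurable]: "c \<in> borel_measurable M" "u \<in> borel_measurable M"
  shows "(\<lambda>x. cs (c x) (ls (u x) p)) \<in> borel_measurable M"
  unfolding cs_def ls_def by simp measurable

text \<open>Dividing l by its norm makes left multiplication unitary. This is the integrated form of
  that unitary representation, so its operator norm competes in the supremum
  \<open>cstar_normL\<close>.\<close>

definition repr :: "('f::rch \<Rightarrow> complex) \<Rightarrow> 'f \<times> 'f \<Rightarrow> 'f \<times> 'f"
  where "repr \<phi> p = (\<integral>l. cs (\<phi> l) (ls (sgn l) p) \<partial>haarL)"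

lemma norm_cs_ls_sgn: "norm (cs c (ls (sgn l) p)) \<le> cmod c * norm (p :: 'f::rch \<times> 'f)"
  unfolding norm_cs norm_ls using norm_sgn_le[of l] by (intro mult_left_mono mult_left_le_one_le) auto

lemma repr_integrable:
  assumes "\<phi> \<in> L1L"
  shows "integrable haarL (\<lambda>l. cs (\<phi> l) (ls (sgn l) p))"
proof (rule Bochner_Integration.integrable_bound)
  note [measurable] = L1L_measurable[OF assms]
  show "integrable haarL (\<lambda>l. cmod (\<phi> l) * norm p)" using assms by (simp add: L1L_def)
  show "(\<lambda>l. cs (\<phi> l) (ls (sgn l) p)) \<in> borel_measurable haarL" by measurable
qed (auto intro!: AE_I2 order_trans[OF norm_cs_ls_sgn])

lemma norm_repr_le:
  assumes "\<phi> \<in> L1L"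
  shows "norm (repr \<phi> p) \<le> (\<integral>l. cmod (\<phi> l) \<partial>haarL) * norm p"
proof -
  have "norm (repr \<phi> p) \<le> (\<integral>l. cmod (\<phi> l) * norm p \<partial>haarL)"
    unfolding repr_def using assms
    by (intro Bochner_Integration.integral_norm_bound_integral repr_integrable norm_cs_ls_sgn) (auto simp: L1L_def)
  then show ?thesis by simp
qed

lemma bounded_linear_repr:
  assumes p: "\<phi> \<in> L1L"
  shows "bounded_linear (repr \<phi>)"
proof (rule bounded_linear_intro[where K="\<integral>l. cmod (\<phi> l) \<partial>haarL"])
  have bl: "bounded_linear (\<lambda>p. cs (\<phi> l) (ls (sgn l) p))" for l
    by (rule bounded_linear_compose[OF bounded_linear_cs bounded_linear_ls])
  show "repr \<phi> (x + y) = repr \<phi> x + repr \<phi> y" for x y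
    unfolding repr_def using repr_integrable[OF p] by (simp add: linear_add[OF bounded_linear.linear[OF bl]])
  show "repr \<phi> (r *\<^sub>R x) = r *\<^sub>R repr \<phi> x" for r x
    unfolding repr_def using repr_integrable[OF p] by (simp add: linear_cmul[OF bounded_linear.linear[OF bl]])
  show "norm (repr \<phi> x) \<le> norm x * (\<integral>l. cmod (\<phi> l) \<partial>haarL)" for x
    using norm_repr_le[OF p, of x] by (simp add: mult.commute)
qed

lemma repr_add:
  assumes "\<phi> \<in> L1L" "\<psi> \<in> L1L"
  shows "repr (\<lambda>l. \<phi> l + \<psi> l) p = repr \<phi> p + repr \<psi> p"
  unfolding repr_def using repr_integrable[OF assms(1)] repr_integrable[OF assms(2)]
  by (simp add: linear_add[OF bounded_linear.linear[OF bounded_linear_cs_left]])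

lemma repr_cmult:
  assumes "\<phi> \<in> L1L"
  shows "repr (\<lambda>l. c * \<phi> l) p = cs c (repr \<phi> p)"
  unfolding repr_def cs_cs[symmetric]
  by (rule integral_bounded_linear[OF bounded_linear_cs repr_integrable[OF assms]])

lemma repr_diff:
  assumes "\<phi> \<in> L1L" "\<psi> \<in> L1L"
  shows "repr (\<lambda>l. \<phi> l - \<psi> l) p = repr \<phi> p - repr \<psi> p"
  using repr_add[OF assms(1) L1L_cmult[OF assms(2)], of "-1" p] repr_cmult[OF assms(2), of "-1" p] cs_of_real[of "-1"]
  by simp

lemma conv_integrable:
  assumes p: "\<phi> \<in> L1L" and q: "\<psi> \<in> (L1L :: ('f::rch \<Rightarrow> complex) set)"
  shows "integrable (haarL \<Otimes>\<^sub>M haarL) (\<lambda>(m, l). \<phi> m * \<psi> (inverse m * l))"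
proof (rule haarL_pair.Fubini_integrable)
  note [measurable] = L1L_measurable[OF p] L1L_measurable[OF q]
  show "(\<lambda>(m, l). \<phi> m * \<psi> (inverse m * l)) \<in> borel_measurable (haarL \<Otimes>\<^sub>M haarL)" by measurable
  have qi: "integrable haarL \<psi>" using q by (simp add: L1L_def)
  have "AE m in haarL. (\<integral>l. norm (\<phi> m * \<psi> (inverse m * l)) \<partial>haarL) = cmod (\<phi> m) * (\<integral>l. cmod (\<psi> l) \<partial>haarL)"
    using AE_haarL_neq_0
  proof eventually_elim
    fix m :: 'f assume "m \<noteq> 0"
    then show "(\<integral>l. norm (\<phi> m * \<psi> (inverse m * l)) \<partial>haarL) = cmod (\<phi> m) * (\<integral>l. cmod (\<psi> l) \<partial>haarL)"
      using integral_haarL_left[of "\<lambda>l. cmod (\<psi> l)" "inverse m"] by (simp add: norm_mult)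
  qed
  moreover have "integrable haarL (\<lambda>m. cmod (\<phi> m) * (\<integral>l. cmod (\<psi> l) \<partial>haarL))"
    using p by (simp add: L1L_def)
  ultimately show "integrable haarL (\<lambda>m. \<integral>l. norm (case (m, l) of (m, l) \<Rightarrow> \<phi> m * \<psi> (inverse m * l)) \<partial>haarL)"
    by (subst integrable_cong_AE[where g="\<lambda>m. cmod (\<phi> m) * (\<integral>l. cmod (\<psi> l) \<partial>haarL)"]) auto
  show "AE m in haarL. integrable haarL (\<lambda>l. case (m, l) of (m, l) \<Rightarrow> \<phi> m * \<psi> (inverse m * l))"
    using AE_haarL_neq_0
  proof eventually_elim
    fix m :: 'f assume "m \<noteq> 0"
    then have "integrable haarL (\<lambda>l. \<psi> (inverse m * l))"
      using qi by (subst integrable_haarL_left) auto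
    then show "integrable haarL (\<lambda>l. case (m, l) of (m, l) \<Rightarrow> \<phi> m * \<psi> (inverse m * l))" by simp
  qed
qed

lemma convL_L1L: "\<phi> \<in> L1L \<Longrightarrow> \<psi> \<in> L1L \<Longrightarrow> convL \<phi> \<psi> \<in> L1L"
  using haarL_pair.integrable_snd[OF conv_integrable[of \<phi> \<psi>]] by (simp add: L1L_def convL_def[abs_def])

lemma starL_L1L: "\<phi> \<in> L1L \<Longrightarrow> starL \<phi> \<in> L1L"
  using L1L_inverse[of \<phi>] by (simp add: starL_def[abs_def] L1L_def)

text \<open>After Fubini, replacing l by m l and using multiplicativity of \<open>sgn\<close>
  separates the two integrals.\<close>

lemma repr_convL:
  assumes p: "\<phi> \<in> L1L" and q: "\<psi> \<in> (L1L :: ('f::rch \<Rightarrow> complex) set)"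
  shows "repr (convL \<phi> \<psi>) x = repr \<phi> (repr \<psi> x)"
proof -
  note [measurable] = L1L_measurable[OF p] L1L_measurable[OF q]
  note i = conv_integrable[OF p q]
  define F where "F m l = cs (\<phi> m * \<psi> (inverse m * l)) (ls (sgn l) x)" for m l
  have Fm[measurable]: "case_prod F \<in> borel_measurable (haarL \<Otimes>\<^sub>M haarL)" unfolding F_def by measurable
  have Fi: "integrable (haarL \<Otimes>\<^sub>M haarL) (case_prod F)"
  proof (rule Bochner_Integration.integrable_bound)
    show "integrable (haarL \<Otimes>\<^sub>M haarL) (\<lambda>y. norm (case y of (m, l) \<Rightarrow> \<phi> m * \<psi> (inverse m * l)) * norm x)"
      by (intro integrable_mult_left integrable_norm i)
    show "AE y in haarL \<Otimes>\<^sub>M haarL. norm (case_prod F y) \<le> norm (norm (case y of (m, l) \<Rightarrow> \<phi> m * \<psi> (inverse m * l)) * norm x)"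
      by (intro AE_I2) (auto simp: F_def intro!: order_trans[OF norm_cs_ls_sgn])
  qed (rule Fm)
  have "repr (convL \<phi> \<psi>) x = (\<integral>l. (\<integral>m. F m l \<partial>haarL) \<partial>haarL)"
    unfolding repr_def
  proof (rule integral_cong_AE)
    show "(\<lambda>l. cs (convL \<phi> \<psi> l) (ls (sgn l) x)) \<in> borel_measurable haarL"
      using L1L_measurable[OF convL_L1L[OF p q]] by measurable
    have "AE l in haarL. integrable haarL (\<lambda>m. \<phi> m * \<psi> (inverse m * l))"
      using haarL_pair.AE_integrable_snd[OF i] .
    then show "AE l in haarL. cs (convL \<phi> \<psi> l) (ls (sgn l) x) = (\<integral>m. F m l \<partial>haarL)"
    proof eventually_elim
      fix l assume "integrable haarL (\<lambda>m. \<phi> m * \<psi> (inverse m * l))"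
      then show "cs (convL \<phi> \<psi> l) (ls (sgn l) x) = (\<integral>m. F m l \<partial>haarL)"
        unfolding convL_def F_def by (rule integral_bounded_linear[OF bounded_linear_cs_left, symmetric])
    qed
  qed measurable
  also have "\<dots> = (\<integral>m. (\<integral>l. F m l \<partial>haarL) \<partial>haarL)" by (rule haarL_pair.Fubini_integral[OF Fi])
  also have "\<dots> = (\<integral>m. cs (\<phi> m) (ls (sgn m) (repr \<psi> x)) \<partial>haarL)"
  proof (rule integral_cong_AE)
    show "AE m in haarL. (\<integral>l. F m l \<partial>haarL) = cs (\<phi> m) (ls (sgn m) (repr \<psi> x))"
      using AE_haarL_neq_0
    proof eventually_elim
      fix m :: 'f assume m: "m \<noteq> 0"
      have bl: "bounded_linear (\<lambda>y. cs (\<phi> m) (ls (sgn m) y))"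
        by (rule bounded_linear_compose[OF bounded_linear_cs bounded_linear_ls])
      have "(\<integral>l. F m l \<partial>haarL) = (\<integral>l. F m (m * l) \<partial>haarL)"
        by (rule integral_haarL_left[symmetric]) (use m in \<open>auto simp: F_def\<close>)
      also have "\<dots> = (\<integral>l. cs (\<phi> m) (ls (sgn m) (cs (\<psi> l) (ls (sgn l) x))) \<partial>haarL)"
        using m by (simp add: F_def ls_cs ls_ls cs_cs sgn_mult_rch mult.assoc[symmetric])
      also have "\<dots> = cs (\<phi> m) (ls (sgn m) (repr \<psi> x))"
        unfolding repr_def by (rule integral_bounded_linear[OF bl repr_integrable[OF q]])
      finally show "(\<integral>l. F m l \<partial>haarL) = cs (\<phi> m) (ls (sgn m) (repr \<psi> x))" .
    qed
  qed measurable
  finally show ?thesis by (simp add: repr_def[of \<phi>])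
qed

text \<open>Inversion preserves Haar measure, and the inverse of a unit scalar acts as its
  adjoint.\<close>

lemma repr_starL:
  assumes p: "\<phi> \<in> (L1L :: ('f::rch \<Rightarrow> complex) set)"
  shows "inner (repr \<phi> x) y = inner x (repr (starL \<phi>) y)"
proof -
  note [measurable] = L1L_measurable[OF p]
  define G where "G l = inner x (cs (starL \<phi> l) (ls (sgn l) y))" for l
  have [measurable]: "G \<in> borel_measurable borel" unfolding G_def starL_def by measurable
  have "inner (repr \<phi> x) y = (\<integral>l. inner (cs (\<phi> l) (ls (sgn l) x)) y \<partial>haarL)"
    unfolding repr_def by (rule integral_inner_left[symmetric]) (rule repr_integrable[OF p])
  also have "\<dots> = (\<integral>l. G (inverse l) \<partial>haarL)"
  proof (rule integral_cong_AE)
    show "AE l in haarL. inner (cs (\<phi> l) (ls (sgn l) x)) y = G (inverse l)"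
      using AE_haarL_neq_0
    proof eventually_elim
      fix l :: 'f assume "l \<noteq> 0"
      then show "inner (cs (\<phi> l) (ls (sgn l) x)) y = G (inverse l)"
        by (simp add: inner_cs inner_ls norm_sgn ls_cs G_def starL_def sgn_inverse_rch)
    qed
  qed measurable
  also have "\<dots> = (\<integral>l. G l \<partial>haarL)" by (rule integral_haarL_inverse) measurable
  also have "\<dots> = inner x (repr (starL \<phi>) y)"
    unfolding repr_def G_def by (rule integral_inner_right) (rule repr_integrable[OF starL_L1L[OF p]])
  finally show ?thesis .
qed

lemma repr_cstar_seminorm: "(\<lambda>\<phi>. onorm (repr \<phi>)) \<in> cstar_seminormsL"
  unfolding cstar_seminormsL_def
proof (intro CollectI conjI ballI allI)
  fix \<phi> :: "'a \<Rightarrow> complex" assume p: "\<phi> \<in> L1L"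
  show "0 \<le> onorm (repr \<phi>)" by (rule onorm_pos_le[OF bounded_linear_repr[OF p]])
  show "onorm (repr \<phi>) \<le> (\<integral>l. cmod (\<phi> l) \<partial>haarL)"
    by (rule onorm_bound) (auto intro: norm_repr_le[OF p] integral_nonneg_AE)
  \<comment> \<open>The opposite inequality is this one for 1/c applied to c \<phi>.\<close>
  have le: "onorm (repr (\<lambda>l. c * \<psi> l)) \<le> cmod c * onorm (repr \<psi>)" if q: "\<psi> \<in> L1L" for c and \<psi> :: "'a \<Rightarrow> complex"
  proof (rule onorm_bound)
    show "0 \<le> cmod c * onorm (repr \<psi>)" using onorm_pos_le[OF bounded_linear_repr[OF q]] by simp
    show "norm (repr (\<lambda>l. c * \<psi> l) x) \<le> cmod c * onorm (repr \<psi>) * norm x" for x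
      unfolding repr_cmult[OF q] norm_cs mult.assoc
      by (intro mult_left_mono onorm[OF bounded_linear_repr[OF q]]) simp
  qed
  show "onorm (repr (\<lambda>l. c * \<phi> l)) = cmod c * onorm (repr \<phi>)" for c
  proof (cases "c = 0")
    case True
    then show ?thesis using le[OF p, of 0] onorm_pos_le[OF bounded_linear_repr[OF L1L_cmult[OF p, of 0]]] by simp
  next
    case False
    have "onorm (repr (\<lambda>l. inverse c * (c * \<phi> l))) \<le> cmod (inverse c) * onorm (repr (\<lambda>l. c * \<phi> l))"
      by (rule le[OF L1L_cmult[OF p]])
    then have "onorm (repr \<phi>) \<le> cmod (inverse c) * onorm (repr (\<lambda>l. c * \<phi> l))"
      using False by (simp add: mult.assoc[symmetric])
    then have "cmod c * onorm (repr \<phi>) \<le> onorm (repr (\<lambda>l. c * \<phi> l))"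
      using False by (simp add: norm_divide field_simps)
    then show ?thesis using le[OF p, of c] by simp
  qed
  show "onorm (repr (\<lambda>l. \<phi> l + \<psi> l)) \<le> onorm (repr \<phi>) + onorm (repr \<psi>)" if q: "\<psi> \<in> L1L" for \<psi>
    unfolding repr_add[OF p q, abs_def] by (rule onorm_triangle[OF bounded_linear_repr[OF p] bounded_linear_repr[OF q]])
  have conv: "repr (convL \<psi> \<delta>) = repr \<psi> \<circ> repr \<delta>" if "\<psi> \<in> L1L" "\<delta> \<in> L1L" for \<psi> \<delta> :: "'a \<Rightarrow> complex"
    using repr_convL[OF that] by auto
  show "onorm (repr (convL \<phi> \<psi>)) \<le> onorm (repr \<phi>) * onorm (repr \<psi>)" if q: "\<psi> \<in> L1L" for \<psi>
    unfolding conv[OF p q] by (rule onorm_compose[OF bounded_linear_repr[OF p] bounded_linear_repr[OF q]])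
  show "onorm (repr (convL (starL \<phi>) \<phi>)) = (onorm (repr \<phi>))\<^sup>2"
    unfolding conv[OF starL_L1L[OF p] p]
    by (rule onorm_cstar_identity[OF bounded_linear_repr[OF p] bounded_linear_repr[OF starL_L1L[OF p]] repr_starL[OF p]])
qed

text \<open>Testing against a cutoff times the positive part of <e, e l0> gives a nonnegative
  integrand of integral 0 that would be positive near l0. This is the passage from integrated
  operators to single group elements.\<close>

lemma haarL_weak_zero:
  fixes e :: "'f::rch \<Rightarrow> 'h::euclidean_space"
  assumes e: "continuous_on (- {0}) e"
    and z: "\<And>\<phi>::'f \<Rightarrow> real. (\<lambda>l. complex_of_real (\<phi> l)) \<in> CcL \<Longrightarrow> (\<integral>l. \<phi> l *\<^sub>R e l \<partial>haarL) = 0"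
    and ei: "\<And>\<phi>::'f \<Rightarrow> real. (\<lambda>l. complex_of_real (\<phi> l)) \<in> CcL \<Longrightarrow> integrable haarL (\<lambda>l. \<phi> l *\<^sub>R e l)"
    and l0: "l0 \<noteq> 0"
  shows "e l0 = 0"
proof (rule ccontr)
  assume ne: "e l0 \<noteq> 0"
  have "\<forall>\<^sub>F n in sequentially. cutoff n l0 > 0"
    using order_tendstoD(1)[OF cutoff_tendsto[OF l0], of 0] by simp
  then obtain n where n: "cutoff n l0 > 0" by (auto simp: eventually_sequentially)
  define s where "s l = inner (e l) (e l0)" for l
  define \<phi> where "\<phi> l = cutoff n l * max 0 (s l)" for l
  have sc: "continuous_on (- {0}) (\<lambda>l. max 0 (s l))" unfolding s_def by (intro continuous_intros e)
  have phi: "(\<lambda>l. complex_of_real (\<phi> l)) \<in> CcL"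
    using cutoff_Cc[of "\<lambda>l. complex_of_real (max 0 (s l))" n] sc by (simp add: \<phi>_def continuous_on_of_real)
  have pc: "continuous_on UNIV \<phi>"
  proof -
    have "continuous_on UNIV (\<lambda>l. Re (complex_of_real (\<phi> l)))"
      by (rule continuous_on_Re[OF Cc_continuous[OF phi]]) auto
    then show ?thesis by simp
  qed
  have i: "integrable haarL (\<lambda>l. \<phi> l * s l)"
    using integrable_inner_left[OF ei[OF phi], of "e l0"] by (simp add: s_def)
  have "(\<integral>l. \<phi> l * s l \<partial>haarL) = inner (\<integral>l. \<phi> l *\<^sub>R e l \<partial>haarL) (e l0)"
    unfolding s_def using integral_inner_left[of "e l0" haarL "\<lambda>l. \<phi> l *\<^sub>R e l"] ei[OF phi] by simp
  then have "(\<integral>l. \<phi> l * s l \<partial>haarL) = 0" by (simp add: z[OF phi])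
  moreover have "AE l in haarL. 0 \<le> \<phi> l * s l" by (intro AE_I2) (auto simp: \<phi>_def max_def)
  ultimately have "AE l in haarL. \<phi> l * s l = 0" using integral_nonneg_eq_0_iff_AE[OF i] by simp
  then have "AE l in lborel. \<phi> l * s l = 0 \<or> l = 0"
    unfolding haarL_def by (subst (asm) AE_density) (auto elim!: eventually_mono)
  moreover have "\<phi> l * s l \<noteq> 0" if "\<phi> l > 0" for l
    using that by (auto simp: \<phi>_def max_def split: if_splits)
  ultimately have AE: "AE l in lborel. \<not> (\<phi> l > 0 \<and> l \<noteq> 0)"
    by (auto elim!: eventually_mono)
  define A where "A = {l. \<phi> l > 0} \<inter> - {0}"
  have "open A" unfolding A_def by (intro open_Int open_Collect_less pc continuous_intros)
  moreover have "l0 \<in> A" using n ne l0 by (simp add: A_def \<phi>_def s_def)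
  ultimately obtain r where r: "r > 0" "ball l0 r \<subseteq> A" by (meson open_contains_ball)
  have "AE l in lborel. l \<notin> ball l0 r" using AE by (rule eventually_mono) (use r in \<open>auto simp: A_def\<close>)
  then have "emeasure lborel (ball l0 r) = 0" by (subst (asm) AE_iff_measurable[of "ball l0 r"]) auto
  then show False using r unit_ball_vol_pos[of "real DIM('f)"] by (simp add: emeasure_ball)
qed

text \<open>Wanted because the extended formula \<open>tw_j_L1L\<close> for the twist asks for
  continuity off 0.\<close>

lemma convL_continuous:
  assumes p: "\<phi> \<in> CcL" and q: "\<psi> \<in> (CcL :: ('f::rch \<Rightarrow> complex) set)"
  shows "continuous_on UNIV (convL \<phi> \<psi>)"
  unfolding continuous_on_sequentially o_def convL_def
proof (intro allI ballI impI, elim conjE)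
  have qc: "continuous_on UNIV \<psi>" by (rule Cc_continuous[OF q]) auto
  have [measurable]: "\<phi> \<in> borel_measurable borel" "\<psi> \<in> borel_measurable borel"
    using p q CcL_L1L L1L_measurable by blast+
  \<comment> \<open>\<open>wt 0\<close> is the constant 1, so B is a bound of the supremum of
    \<psi>.\<close>
  obtain B where B: "\<And>x. cmod (\<psi> x) \<le> B * wt 0 x" using rapid_bound[OF Cc_rapid[OF q]] by fastforce
  fix u :: "nat \<Rightarrow> 'f" and a assume u: "u \<longlonglongrightarrow> a"
  show "(\<lambda>n. \<integral>m. \<phi> m * \<psi> (inverse m * u n) \<partial>haarL) \<longlonglongrightarrow> (\<integral>m. \<phi> m * \<psi> (inverse m * a) \<partial>haarL)"
  proof (rule integral_dominated_convergence[where w="\<lambda>m. B * cmod (\<phi> m)"])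
    show "integrable haarL (\<lambda>m. B * cmod (\<phi> m))" using p CcL_L1L by (auto simp: L1L_def)
    show "AE m in haarL. (\<lambda>n. \<phi> m * \<psi> (inverse m * u n)) \<longlonglongrightarrow> \<phi> m * \<psi> (inverse m * a)"
    proof (rule AE_I2)
      fix m
      have "(\<lambda>n. inverse m * u n) \<longlonglongrightarrow> inverse m * a" by (intro tendsto_intros u)
      then have "(\<lambda>n. \<psi> (inverse m * u n)) \<longlonglongrightarrow> \<psi> (inverse m * a)"
        by (rule continuous_on_tendsto_compose[OF qc]) auto
      then show "(\<lambda>n. \<phi> m * \<psi> (inverse m * u n)) \<longlonglongrightarrow> \<phi> m * \<psi> (inverse m * a)" by (intro tendsto_intros)
    qed
    show "AE m in haarL. cmod (\<phi> m * \<psi> (inverse m * u n)) \<le> B * cmod (\<phi> m)" for n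
      using B by (intro AE_I2) (auto simp: norm_mult mult.commute[of B] wt_def intro!: mult_left_mono)
  qed measurable
qed

text \<open>Inversion is an antiautomorphism of L, hence the reversed order of the factors.\<close>

lemma convL_inverse:
  assumes p: "\<phi> \<in> CcL" and q: "\<psi> \<in> (CcL :: ('f::rch \<Rightarrow> complex) set)"
  shows "convL \<phi> \<psi> (inverse l) = convL (\<lambda>l. \<psi> (inverse l)) (\<lambda>l. \<phi> (inverse l)) l"
proof -
  have [measurable]: "\<phi> \<in> borel_measurable borel" "\<psi> \<in> borel_measurable borel"
    using p q CcL_L1L L1L_measurable by blast+
  \<comment> \<open>Because \<open>inverse 0 = 0\<close>, the points l = 0 and m = 0 also have to be
    covered; test functions vanish there.\<close>
  have 0: "\<phi> 0 = 0" "\<psi> 0 = 0" using p q by (auto simp: Cc_def)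
  show ?thesis
  proof (cases "l = 0")
    case False
    define G where "G m = \<psi> (inverse m) * \<phi> (inverse (inverse m * l))" for m
    have [measurable]: "G \<in> borel_measurable borel" unfolding G_def by measurable
    have "convL (\<lambda>l. \<psi> (inverse l)) (\<lambda>l. \<phi> (inverse l)) l = (\<integral>m. G m \<partial>haarL)"
      by (simp add: convL_def G_def)
    also have "\<dots> = (\<integral>m. G (l * m) \<partial>haarL)" by (rule integral_haarL_left[symmetric]) (use False in auto)
    also have "\<dots> = (\<integral>m. \<phi> m * \<psi> (inverse m * inverse l) \<partial>haarL)"
    proof (rule Bochner_Integration.integral_cong[OF refl])
      fix m show "G (l * m) = \<phi> m * \<psi> (inverse m * inverse l)"
      proof (cases "m = 0")
        case False
        then have "inverse (l * m) = inverse m * inverse l" using \<open>l \<noteq> 0\<close> by (simp add: nonzero_inverse_mult_distrib)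
        moreover have "inverse (l * m) * l = inverse m"
          using False \<open>l \<noteq> 0\<close> by (simp add: nonzero_inverse_mult_distrib mult.assoc)
        ultimately show ?thesis by (simp add: G_def mult.commute)
      qed (simp add: G_def 0)
    qed
    finally show ?thesis by (simp add: convL_def)
  qed (simp add: convL_def 0)
qed

text \<open>The twist turns \<open>\<phi> * \<psi>\<close> into \<open>\<psi>\<^sup>w * \<phi>\<^sup>w\<close>, so its multiplicativity makes \<open>C*(L)\<close> commutative; the
  representation above then forces \<open>F\<close> to be commutative.\<close>

lemma weyl_twist_commutative:
  fixes j :: "('f::rch \<Rightarrow> complex) \<Rightarrow> 'a::cstar_algebra"
  assumes j: "is_cstarL j" and tw: "weyl_twist j tw"
  shows "x * y = y * (x::'f)"
proof -
  interpret C: cstar_completion L1L convL starL cstar_normL j by fact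
  interpret weyl_twist j tw by fact
  have L: "\<phi> \<in> L1L" if "\<phi> \<in> CcL" for \<phi> :: "'f \<Rightarrow> complex" using that CcL_L1L by blast
  have jcomm: "j \<phi> * j \<psi> = j \<psi> * j \<phi>" if p: "\<phi> \<in> CcL" and q: "\<psi> \<in> CcL" for \<phi> \<psi>
  proof -
    have "tw (j \<phi> * j \<psi>) = tw (j (convL \<phi> \<psi>))" by (simp add: C.j_mul L p q)
    also have "\<dots> = j (\<lambda>l. convL \<phi> \<psi> (inverse l))"
      by (intro tw_j_L1L[OF j] convL_L1L L p q continuous_on_subset[OF convL_continuous[OF p q]]) auto
    also have "\<dots> = j (convL (\<lambda>l. \<psi> (inverse l)) (\<lambda>l. \<phi> (inverse l)))"
      by (simp add: convL_inverse[OF p q] )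
    also have "\<dots> = j (\<lambda>l. \<psi> (inverse l)) * j (\<lambda>l. \<phi> (inverse l))"
      by (intro C.j_mul L1L_inverse L p q)
    also have "\<dots> = tw (j \<psi> * j \<phi>)" by (simp add: tw_mult tw_j p q)
    finally show ?thesis by (metis tw_tw)
  qed
  have rcomm: "repr \<phi> (repr \<psi> p) = repr \<psi> (repr \<phi> p)" if p: "\<phi> \<in> CcL" and q: "\<psi> \<in> CcL" for \<phi> \<psi> :: "'f \<Rightarrow> complex" and p
  proof -
    \<comment> \<open>The map j kills this commutator, so its C*-norm is 0; the seminorm given by
      \<open>repr\<close> lies below that norm and vanishes too.\<close>
    define \<delta> where "\<delta> l = convL \<phi> \<psi> l - convL \<psi> \<phi> l" for l
    have c: "convL \<phi> \<psi> \<in> L1L" "convL \<psi> \<phi> \<in> L1L" by (intro convL_L1L L p q)+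
    have chi: "\<delta> \<in> L1L" unfolding \<delta>_def by (intro L1L_diff c)
    have "j \<delta> = j (convL \<phi> \<psi>) - j (convL \<psi> \<phi>)"
      unfolding \<delta>_def by (rule C.j_diff[OF c L1L_cmult[OF c(2)]])
    also have "\<dots> = 0" by (simp add: C.j_mul L p q jcomm[OF p q])
    finally have "cstar_normL \<delta> = 0" using C.j_norm[OF chi] by simp
    then have "onorm (repr \<delta>) \<le> 0" using cstar_normL_ge[OF chi repr_cstar_seminorm] by simp
    then have "norm (repr \<delta> p) \<le> 0"
      using onorm[OF bounded_linear_repr[OF chi], of p] mult_nonpos_nonneg[OF _ norm_ge_zero, of "onorm (repr \<delta>)" p] by linarith
    then have "repr (convL \<phi> \<psi>) p - repr (convL \<psi> \<phi>) p = 0"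
      using repr_diff[OF c, of p] by (simp add: \<delta>_def[abs_def])
    then show ?thesis by (simp add: repr_convL L p q)
  qed
  have sgn_c: "continuous_on (- {0}) (sgn :: 'f \<Rightarrow> 'f)"
    unfolding sgn_div_norm by (intro continuous_intros) auto
  have ls_c: "continuous_on (- {0}) (\<lambda>l. ls (sgn l) (p :: 'f \<times> 'f))" for p
    unfolding ls_def by (intro continuous_intros sgn_c)
  have ls_m[measurable]: "(\<lambda>l. ls (sgn l) (p :: 'f \<times> 'f)) \<in> borel_measurable borel" for p
    unfolding ls_def by measurable
  \<comment> \<open>If A commutes with all integrated operators, it commutes with every single
    \<open>ls (sgn l)\<close>. This is used first for A = \<open>repr \<psi>\<close> and then, with
    the outcome, for A = \<open>ls (sgn m)\<close>.\<close>
  have weak: "ls (sgn l) (A p) = A (ls (sgn l) p)"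
    if A: "bounded_linear A" and z: "\<And>\<phi> :: 'f \<Rightarrow> complex. \<phi> \<in> CcL \<Longrightarrow> repr \<phi> (A p) = A (repr \<phi> p)" and l: "l \<noteq> 0"
    for A :: "'f \<times> 'f \<Rightarrow> 'f \<times> 'f" and l :: 'f and p
  proof -
    define e where "e l = ls (sgn l) (A p) - A (ls (sgn l) p)" for l
    have Ac: "continuous_on UNIV A" using A by (simp add: linear_continuous_on)
    have [measurable]: "A \<in> borel_measurable borel" using Ac by (rule borel_measurable_continuous_onI)
    have "e l = 0"
    proof (rule haarL_weak_zero[OF _ _ _ l])
      show "continuous_on (- {0}) e"
        unfolding e_def by (intro continuous_intros ls_c continuous_on_compose2[OF Ac]) auto
      fix \<phi> :: "'f \<Rightarrow> real" assume phi: "(\<lambda>l. complex_of_real (\<phi> l)) \<in> CcL"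
      have r: "integrable haarL (\<lambda>l. \<phi> l *\<^sub>R ls (sgn l) q)" "(\<integral>l. \<phi> l *\<^sub>R ls (sgn l) q \<partial>haarL) = repr (\<lambda>l. complex_of_real (\<phi> l)) q" for q
        using repr_integrable[OF L[OF phi], of q] by (simp_all add: cs_of_real repr_def)
      have rA: "integrable haarL (\<lambda>l. A (\<phi> l *\<^sub>R ls (sgn l) p))" "(\<integral>l. A (\<phi> l *\<^sub>R ls (sgn l) p) \<partial>haarL) = A (\<integral>l. \<phi> l *\<^sub>R ls (sgn l) p \<partial>haarL)"
        by (rule integrable_bounded_linear[OF A r(1)], rule integral_bounded_linear[OF A r(1)])
      have e: "\<phi> l *\<^sub>R e l = \<phi> l *\<^sub>R ls (sgn l) (A p) - A (\<phi> l *\<^sub>R ls (sgn l) p)" for l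
        by (simp add: e_def scaleR_diff_right linear_cmul[OF bounded_linear.linear[OF A]])
      show "integrable haarL (\<lambda>l. \<phi> l *\<^sub>R e l)" unfolding e by (intro Bochner_Integration.integrable_diff r rA)
      show "(\<integral>l. \<phi> l *\<^sub>R e l \<partial>haarL) = 0"
        unfolding e Bochner_Integration.integral_diff[OF r(1) rA(1)] rA(2) r(2) using z[OF phi] by simp
    qed
    then show ?thesis by (simp add: e_def)
  qed
  have 1: "ls (sgn l) (repr \<psi> p) = repr \<psi> (ls (sgn l) p)" if "\<psi> \<in> CcL" "l \<noteq> 0" for \<psi> :: "'f \<Rightarrow> complex" and l p
    by (rule weak[OF bounded_linear_repr[OF L]]) (use that rcomm in auto)
  have 2: "ls (sgn l) (ls (sgn m) p) = ls (sgn m) (ls (sgn l) p)" if "l \<noteq> 0" "m \<noteq> 0" for l m :: 'f and p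
    by (rule weak[OF bounded_linear_ls]) (use that 1 in auto)
  show ?thesis
  proof (cases "x = 0 \<or> y = 0")
    case False
    \<comment> \<open>On the vector (1, 0) the operators become the scalars themselves.\<close>
    then have "sgn x * sgn y = sgn y * sgn x" using 2[of x y "(1, 0)"] by (simp add: ls_def)
    then show ?thesis using False by (simp add: sgn_div_norm mult.commute[of "inverse (norm y)" "inverse (norm x)"])
  qed auto
qed



theorem theorem3p2:
  fixes j :: "('f::rch \<Rightarrow> complex) \<Rightarrow> 'a::cstar_algebra"
    and act :: "'e::complex_banach \<Rightarrow> 'a \<Rightarrow> 'e"
    and ip :: "'e \<Rightarrow> 'e \<Rightarrow> 'a"
    and \<iota> :: "('f^2 \<Rightarrow> complex) \<Rightarrow> 'e"
    and tw :: "'a \<Rightarrow> 'a"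
    and \<mu> :: "('f^2^2) measure"
    and jr :: "('f^2^2 \<Rightarrow> complex) \<Rightarrow> 'b::cstar_algebra"
    and lact :: "'b \<Rightarrow> 'e \<Rightarrow> 'e"
  assumes "ps_module act ip j \<iota>"
    and "weyl_twist j tw"
    and "is_haarG \<mu>"
    and "is_cstar_redG \<mu> jr"
    and "left_action act ip \<iota> \<mu> jr lact"
  shows "\<exists>U :: 'e \<Rightarrow> 'e.
      (\<forall>f\<in>schwartz. fourier_w f \<in> schwartz \<and> U (\<iota> f) = \<iota> (fourier_w f)) \<and>
      module_isometry (act_w tw act) (ip_w tw ip) act ip U \<and>
      (\<forall>b \<xi>. U (lact b \<xi>) = lact b (U \<xi>)) \<and>
      (\<exists>\<gamma> :: 'f \<Rightarrow> complex. continuous_on (- {0}) \<gamma> \<and> composition_acts_by \<iota> U \<gamma> \<and>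
        (\<forall>l. l \<noteq> 0 \<longrightarrow> \<gamma> l = exp (- 2 * \<i> * complex_of_real (pi * re (inverse l)))))"
proof -
  interpret ps_module act ip j \<iota> by fact
  have comm: "x * y = y * x" for x y :: 'f
    by (rule weyl_twist_commutative[OF cstarL assms(2)])
  obtain U where U: "\<And>f. f \<in> schwartz \<Longrightarrow> U (\<iota> f) = \<iota> (fourier_w f)"
    and U_lim: "\<And>u x. u \<longlonglongrightarrow> x \<Longrightarrow> (\<lambda>n. U (u n)) \<longlonglongrightarrow> U x"
    and iso: "module_isometry (act_w tw act) (ip_w tw ip) act ip U"
    and UU: "\<And>x. U (U x) = x"
    using unitary_extension[OF comm assms(2)] by metis
  show ?thesis
  proof (intro exI[of _ U] exI[of _ "\<lambda>l. ee (re (inverse l))"] conjI ballI allI impI)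
    show "fourier_w f \<in> schwartz" "U (\<iota> f) = \<iota> (fourier_w f)" if "f \<in> schwartz" for f
      using that by (simp_all add: fourier_w_schwartz U)
    show "module_isometry (act_w tw act) (ip_w tw ip) act ip U" by (rule iso)
    show "U (lact b \<xi>) = lact b (U \<xi>)" for b \<xi>
      by (rule unitary_commutes_lact[OF comm assms(2-5) U U_lim iso UU])
    show "continuous_on (- {0}) (\<lambda>l::'f. ee (re (inverse l)))"
      by (intro continuous_intros) auto
    show "composition_acts_by \<iota> U (\<lambda>l. ee (re (inverse l)))"
      by (rule composition_acts_by_ee[OF comm U])
    show "ee (re (inverse l)) = exp (- 2 * \<i> * complex_of_real (pi * re (inverse l)))" if "l \<noteq> 0" for l :: 'f
      by (simp only: ee_def)
  qed
qed

end
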